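(* Let $R$ be a commutative Noetherian local ring, let $t$ be an integer, and let $M,N$ be finitely generated $R$-modules. Assume that $\operatorname{depth}(M)\ge t$, $\operatorname{depth}(N)=t$, $\operatorname{Ass}(N)=\operatorname{Min}(N)$, and that for some integer $s\ge t$ one has $\operatorname{Ext}^i_R(M,N)=0$ for all $1\le i\le s$. If $\operatorname{Hom}_R(M,N)\cong N^r$ for some $r\in\mathbb N$, then $M/IM\cong (R/I)^r$, where $I=\operatorname{Ann}_R(N)$. Furthermore, if one of the following holds: (1) $N$ is faithful; or (2) $\operatorname{Ass}(R)\subseteq \operatorname{Ass}(N)$ and $s>0$, then $M\cong R^r$.
   Context: $\operatorname{Min}(N)$ denotes the set of minimal elements of $\operatorname{Supp}(N)$. The integer $t$ is not assumed to equal $\operatorname{depth} R$. The zero module has depth $\infty$. *)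

theory Defs
  imports "HOL-Algebra.Algebra" "HOL-Library.Extended_Real"
begin

locale noetherian_local_ring = cring + noetherian_ring +
  assumes local: "\<exists>!m. maximalideal m R"

definition max_ideal :: "('r, 'a) ring_scheme \<Rightarrow> 'r set" where
  "max_ideal R = (THE m. maximalideal m R)"


section \<open>Submodules, quotients, powers\<close>

text \<open>
  The type of module records extends the type of ring records, so every module record has fields
  \<^const>\<open>monoid.mult\<close> and \<^const>\<open>one\<close>. They play no role in the locale \<^locale>\<open>module\<close> and are left
  undefined in the constructions below.
\<close>

definition mod_span :: "('r, 'a) ring_scheme \<Rightarrow> ('r, 'm, 'b) module_scheme \<Rightarrow> 'm set \<Rightarrow> 'm set" where
  "mod_span R M A = \<Inter> {H. submodule H R M \<and> A \<subseteq> H}"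

definition fin_gen_module :: "('r, 'a) ring_scheme \<Rightarrow> ('r, 'm, 'b) module_scheme \<Rightarrow> bool" where
  "fin_gen_module R M \<longleftrightarrow>
     module R M \<and> (\<exists>A. finite A \<and> A \<subseteq> carrier M \<and> mod_span R M A = carrier M)"

definition ideal_smult :: "('r, 'a) ring_scheme \<Rightarrow> 'r set \<Rightarrow> ('r, 'm, 'b) module_scheme \<Rightarrow> 'm set" where
  "ideal_smult R I M = mod_span R M {a \<odot>\<^bsub>M\<^esub> x | a x. a \<in> I \<and> x \<in> carrier M}"

text \<open>The union in \<^const>\<open>module.smult\<close> is the coset of \<open>a \<odot> x\<close> for any representative \<open>x\<close> of \<open>C\<close>.\<close>

definition module_quotient :: "('r, 'm, 'b) module_scheme \<Rightarrow> 'm set \<Rightarrow> ('r, 'm set) module" where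
  "module_quotient M H =
     \<lparr>carrier = a_rcosets\<^bsub>M\<^esub> H, monoid.mult = undefined, monoid.one = undefined,
      ring.zero = H, ring.add = set_add M,
      module.smult = (\<lambda>a C. \<Union>x\<in>C. H +>\<^bsub>M\<^esub> (a \<odot>\<^bsub>M\<^esub> x))\<rparr>"

definition module_power :: "('r, 'm, 'b) module_scheme \<Rightarrow> nat \<Rightarrow> ('r, nat \<Rightarrow> 'm) module" where
  "module_power M n =
     \<lparr>carrier = {..<n} \<rightarrow>\<^sub>E carrier M, monoid.mult = undefined, monoid.one = undefined,
      ring.zero = (\<lambda>i\<in>{..<n}. \<zero>\<^bsub>M\<^esub>),
      ring.add = (\<lambda>x y. \<lambda>i\<in>{..<n}. x i \<oplus>\<^bsub>M\<^esub> y i),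
      module.smult = (\<lambda>a x. \<lambda>i\<in>{..<n}. a \<odot>\<^bsub>M\<^esub> x i)\<rparr>"

definition regular_module :: "('r, 'a) ring_scheme \<Rightarrow> ('r, 'r) module" where
  "regular_module R =
     \<lparr>carrier = carrier R, monoid.mult = monoid.mult R, monoid.one = monoid.one R,
      ring.zero = ring.zero R, ring.add = ring.add R,
      module.smult = monoid.mult R\<rparr>"


section \<open>Homomorphisms\<close>

definition module_hom ::
  "('r, 'a) ring_scheme \<Rightarrow> ('r, 'm, 'b) module_scheme \<Rightarrow> ('r, 'n, 'c) module_scheme \<Rightarrow> ('m \<Rightarrow> 'n) set" where
  "module_hom R M N =
     {f \<in> carrier M \<rightarrow>\<^sub>E carrier N.
        (\<forall>x\<in>carrier M. \<forall>y\<in>carrier M. f (x \<oplus>\<^bsub>M\<^esub> y) = f x \<oplus>\<^bsub>N\<^esub> f y) \<and>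
        (\<forall>a\<in>carrier R. \<forall>x\<in>carrier M. f (a \<odot>\<^bsub>M\<^esub> x) = a \<odot>\<^bsub>N\<^esub> f x)}"

definition Hom_module ::
  "('r, 'a) ring_scheme \<Rightarrow> ('r, 'm, 'b) module_scheme \<Rightarrow> ('r, 'n, 'c) module_scheme \<Rightarrow> ('r, 'm \<Rightarrow> 'n) module" where
  "Hom_module R M N =
     \<lparr>carrier = module_hom R M N, monoid.mult = undefined, monoid.one = undefined,
      ring.zero = (\<lambda>x\<in>carrier M. \<zero>\<^bsub>N\<^esub>),
      ring.add = (\<lambda>f g. \<lambda>x\<in>carrier M. f x \<oplus>\<^bsub>N\<^esub> g x),
      module.smult = (\<lambda>a f. \<lambda>x\<in>carrier M. a \<odot>\<^bsub>N\<^esub> f x)\<rparr>"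

definition module_isomorphic ::
  "('r, 'a) ring_scheme \<Rightarrow> ('r, 'm, 'b) module_scheme \<Rightarrow> ('r, 'n, 'c) module_scheme \<Rightarrow> bool" where
  "module_isomorphic R M N \<longleftrightarrow> (\<exists>f\<in>module_hom R M N. bij_betw f (carrier M) (carrier N))"


section \<open>Annihilators, associated primes, support\<close>

definition annihilator :: "('r, 'a) ring_scheme \<Rightarrow> ('r, 'm, 'b) module_scheme \<Rightarrow> 'r set" where
  "annihilator R M = {a \<in> carrier R. \<forall>x\<in>carrier M. a \<odot>\<^bsub>M\<^esub> x = \<zero>\<^bsub>M\<^esub>}"

definition faithful_module :: "('r, 'a) ring_scheme \<Rightarrow> ('r, 'm, 'b) module_scheme \<Rightarrow> bool" where
  "faithful_module R M \<longleftrightarrow> annihilator R M = {\<zero>\<^bsub>R\<^esub>}"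

definition Ass :: "('r, 'a) ring_scheme \<Rightarrow> ('r, 'm, 'b) module_scheme \<Rightarrow> 'r set set" where
  "Ass R M =
     {p. primeideal p R \<and> (\<exists>x\<in>carrier M. p = {a \<in> carrier R. a \<odot>\<^bsub>M\<^esub> x = \<zero>\<^bsub>M\<^esub>})}"

definition fraction_rel ::
  "('r, 'm, 'b) module_scheme \<Rightarrow> 'r set \<Rightarrow> (('m \<times> 'r) \<times> ('m \<times> 'r)) set" where
  "fraction_rel M S =
     {((x, s), (y, t)) | x s y t. x \<in> carrier M \<and> y \<in> carrier M \<and> s \<in> S \<and> t \<in> S \<and>
        (\<exists>u\<in>S. u \<odot>\<^bsub>M\<^esub> (t \<odot>\<^bsub>M\<^esub> x) = u \<odot>\<^bsub>M\<^esub> (s \<odot>\<^bsub>M\<^esub> y))}"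

text \<open>The localization of \<open>M\<close> at a multiplicative set \<open>S\<close>, as a module over \<open>R\<close>; the pair
  \<open>(x, s)\<close> represents the fraction \<open>x/s\<close>.\<close>

definition localization ::
  "('r, 'a) ring_scheme \<Rightarrow> ('r, 'm, 'b) module_scheme \<Rightarrow> 'r set \<Rightarrow> ('r, ('m \<times> 'r) set) module" where
  "localization R M S =
     \<lparr>carrier = (carrier M \<times> S) // fraction_rel M S,
      monoid.mult = undefined, monoid.one = undefined,
      ring.zero = fraction_rel M S `` {(\<zero>\<^bsub>M\<^esub>, \<one>\<^bsub>R\<^esub>)},
      ring.add = (\<lambda>C D. \<Union>(x, s)\<in>C. \<Union>(y, t)\<in>D.
               fraction_rel M S `` {(t \<odot>\<^bsub>M\<^esub> x \<oplus>\<^bsub>M\<^esub> s \<odot>\<^bsub>M\<^esub> y, s \<otimes>\<^bsub>R\<^esub> t)}),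
      module.smult = (\<lambda>a C. \<Union>(x, s)\<in>C. fraction_rel M S `` {(a \<odot>\<^bsub>M\<^esub> x, s)})\<rparr>"

definition Supp :: "('r, 'a) ring_scheme \<Rightarrow> ('r, 'm, 'b) module_scheme \<Rightarrow> 'r set set" where
  "Supp R M =
     {p. primeideal p R \<and>
         carrier (localization R M (carrier R - p)) \<noteq> {\<zero>\<^bsub>localization R M (carrier R - p)\<^esub>}}"

definition Min_Supp :: "('r, 'a) ring_scheme \<Rightarrow> ('r, 'm, 'b) module_scheme \<Rightarrow> 'r set set" where
  "Min_Supp R M = {p \<in> Supp R M. \<forall>q\<in>Supp R M. q \<subseteq> p \<longrightarrow> q = p}"


section \<open>Depth\<close>

definition regular_sequence :: "('r, 'a) ring_scheme \<Rightarrow> ('r, 'm, 'b) module_scheme \<Rightarrow> 'r list \<Rightarrow> bool" where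
  "regular_sequence R M xs \<longleftrightarrow>
     set xs \<subseteq> carrier R \<and>
     (\<forall>i<length xs.
        let Q = module_quotient M (ideal_smult R (genideal R (set (take i xs))) M)
        in \<forall>z\<in>carrier Q. (xs ! i) \<odot>\<^bsub>Q\<^esub> z = \<zero>\<^bsub>Q\<^esub> \<longrightarrow> z = \<zero>\<^bsub>Q\<^esub>) \<and>
     ideal_smult R (genideal R (set xs)) M \<noteq> carrier M"

definition depth :: "('r, 'a) ring_scheme \<Rightarrow> ('r, 'm, 'b) module_scheme \<Rightarrow> enat" where
  "depth R M =
     (if carrier M = {\<zero>\<^bsub>M\<^esub>} then \<infinity>
      else Sup {enat (length xs) | xs. set xs \<subseteq> max_ideal R \<and> regular_sequence R M xs})"


section \<open>Ext\<close>

abbreviation free_module :: "('r, 'a) ring_scheme \<Rightarrow> nat \<Rightarrow> ('r, nat \<Rightarrow> 'r) module" where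
  "free_module R n \<equiv> module_power (regular_module R) n"

text \<open>
  Exactness of \<open>\<dots> \<rightarrow> R\<^bsup>n 2\<^esup> \<rightarrow> R\<^bsup>n 1\<^esup> \<rightarrow> R\<^bsup>n 0\<^esup> \<rightarrow> M \<rightarrow> 0\<close>, where \<open>d i\<close> maps \<open>R\<^bsup>n (i+1)\<^esup>\<close> to \<open>R\<^bsup>n i\<^esup>\<close>
  and \<open>e\<close> is the augmentation.
\<close>

definition free_resolution ::
  "('r, 'a) ring_scheme \<Rightarrow> ('r, 'm, 'b) module_scheme \<Rightarrow>
   (nat \<Rightarrow> nat) \<Rightarrow> (nat \<Rightarrow> (nat \<Rightarrow> 'r) \<Rightarrow> (nat \<Rightarrow> 'r)) \<Rightarrow> ((nat \<Rightarrow> 'r) \<Rightarrow> 'm) \<Rightarrow> bool" where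
  "free_resolution R M n d e \<longleftrightarrow>
     (\<forall>i. d i \<in> module_hom R (free_module R (n (Suc i))) (free_module R (n i))) \<and>
     e \<in> module_hom R (free_module R (n 0)) M \<and>
     e ` carrier (free_module R (n 0)) = carrier M \<and>
     d 0 ` carrier (free_module R (n 1)) = a_kernel (free_module R (n 0)) M e \<and>
     (\<forall>i. d (Suc i) ` carrier (free_module R (n (Suc (Suc i)))) =
          a_kernel (free_module R (n (Suc i))) (free_module R (n i)) (d i))"

definition cocycles ::
  "('r, 'a) ring_scheme \<Rightarrow> (nat \<Rightarrow> nat) \<Rightarrow> (nat \<Rightarrow> (nat \<Rightarrow> 'r) \<Rightarrow> (nat \<Rightarrow> 'r)) \<Rightarrow>
   ('r, 'n, 'c) module_scheme \<Rightarrow> nat \<Rightarrow> ((nat \<Rightarrow> 'r) \<Rightarrow> 'n) set" where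
  "cocycles R n d N i =
     {f \<in> module_hom R (free_module R (n i)) N.
        compose (carrier (free_module R (n (Suc i)))) f (d i) =
          \<zero>\<^bsub>Hom_module R (free_module R (n (Suc i))) N\<^esub>}"

definition coboundaries ::
  "('r, 'a) ring_scheme \<Rightarrow> (nat \<Rightarrow> nat) \<Rightarrow> (nat \<Rightarrow> (nat \<Rightarrow> 'r) \<Rightarrow> (nat \<Rightarrow> 'r)) \<Rightarrow>
   ('r, 'n, 'c) module_scheme \<Rightarrow> nat \<Rightarrow> ((nat \<Rightarrow> 'r) \<Rightarrow> 'n) set" where
  "coboundaries R n d N i =
     (case i of
        0 \<Rightarrow> {\<zero>\<^bsub>Hom_module R (free_module R (n 0)) N\<^esub>}
      | Suc j \<Rightarrow> (\<lambda>f. compose (carrier (free_module R (n (Suc j)))) f (d j)) `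
                   module_hom R (free_module R (n j)) N)"

text \<open>
  \<open>Ext R M N i\<close> is the \<open>i\<close>-th cohomology of \<open>Hom(F, N)\<close> for a chosen resolution \<open>F\<close> of \<open>M\<close> by
  free modules of finite rank. Such a resolution exists for every finitely generated module over a
  Noetherian ring, and another choice gives isomorphic modules; for a module without such a
  resolution the value is meaningless.
\<close>

definition Ext ::
  "('r, 'a) ring_scheme \<Rightarrow> ('r, 'm, 'b) module_scheme \<Rightarrow> ('r, 'n, 'c) module_scheme \<Rightarrow> nat \<Rightarrow>
   ('r, ((nat \<Rightarrow> 'r) \<Rightarrow> 'n) set) module" where
  "Ext R M N i =
     (let (n, d, e) = (SOME (n, d, e). free_resolution R M n d e)
      in module_quotient
           ((Hom_module R (free_module R (n i)) N)\<lparr>carrier := cocycles R n d N i\<rparr>)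
           (coboundaries R n d N i))"

end

theory Submission
  imports Defs
begin

text \<open>
  Let \<open>x\<close> be a maximal \<open>N\<close>-regular sequence in the maximal ideal \<open>m\<close>; it has length \<open>t\<close>. Since
  \<open>Ext\<^sup>i(M, N) = 0\<close> for \<open>1 \<le> i \<le> t\<close>, every linear map \<open>M \<rightarrow> N/xN\<close> lifts to \<open>N\<close> and
  \<open>Hom(M, N/xN) = Hom(M, N)/x Hom(M, N) \<cong> (N/xN)\<^sup>r\<close>. The elements of \<open>N/xN\<close> killed by \<open>m\<close> form a
  nonzero module \<open>S\<close>, and comparing the elements killed by \<open>m\<close> on both sides gives
  \<open>S\<^sup>\<mu> \<cong> S\<^sup>r\<close> for the minimal number \<open>\<mu>\<close> of generators of \<open>M\<close>; so \<open>M\<close> has \<open>r\<close> generators. Evaluation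
  at these generators turns \<open>Hom(M, N) \<cong> N\<^sup>r\<close> into an injective endomorphism of \<open>N\<^sup>r\<close>. It is
  surjective after localizing at each \<open>p \<in> Min(N)\<close>, where \<open>N\<close> has finite length, while its cokernel
  embeds into \<open>Hom(K, N)\<close>, with \<open>K\<close> the kernel of \<open>R\<^sup>r \<rightarrow> M\<close>, and so has its associated primes in
  \<open>Ass(N) = Min(N)\<close>. Hence it is surjective, which says that \<open>K \<subseteq> I R\<^sup>r\<close>. If moreover
  \<open>Ext\<^sup>1(M, N) = 0\<close>, then \<open>Hom(K, N) = 0\<close>, and \<open>Ass(K) \<subseteq> Ass(R) \<subseteq> Ass(N)\<close> forces \<open>K = 0\<close>.
\<close>

section \<open>Submodules and spans\<close>

text \<open>The argument stays inside \<open>N\<close>, its powers and free modules. A statement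
  about N/xN is a congruence modulo the submodule \<open>H t\<close>, the annihilator of a residue
  class is a \<open>colon\<close> ideal, and a statement at a prime \<open>p\<close> reads: after
  multiplication by some \<open>c\<close> outside \<open>p\<close>. So the two finiteness arguments,
  one over the residue field of \<open>R\<close> for the number of generators and one at the minimal
  primes for surjectivity, become instances of \<open>generic_surjectivity\<close>: an injective
  self-correspondence of a layer killed by \<open>p\<close> in a Noetherian module is onto at
  \<open>p\<close>. A correspondence is needed because the map from S^\<mu> to S^r is defined only
  up to \<open>H t\<close>. Of S^\<mu> and S^r only \<mu> \<le> r is compared, since a generating
  system may be padded with zeros; for r < \<mu> the image of S^\<mu> would lie in S^r, a proper
  part of S^\<mu>. The condition s > 0 asks for Ext^1 to vanish, which t \<le> s yields only when t
  > 0.\<close>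

definition colon :: "('r, 'a) ring_scheme \<Rightarrow> ('r, 'm, 'b) module_scheme \<Rightarrow> 'm set \<Rightarrow> 'm \<Rightarrow> 'r set" where
  "colon R M H x = {a \<in> carrier R. a \<odot>\<^bsub>M\<^esub> x \<in> H}"

context module
begin

lemma submodule_carrier: "submodule H R M \<Longrightarrow> x \<in> H \<Longrightarrow> x \<in> carrier M"
  using submoduleE(1) by blast

lemma submodule_zero: "submodule H R M \<Longrightarrow> \<zero>\<^bsub>M\<^esub> \<in> H"
  using subgroup.one_closed[OF submodule.axioms(1)] by fastforce

lemma submodule_minus:
  "submodule H R M \<Longrightarrow> x \<in> H \<Longrightarrow> y \<in> H \<Longrightarrow> x \<ominus>\<^bsub>M\<^esub> y \<in> H"
  by (simp add: M.minus_eq submoduleE(3,5))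

lemma submodule_subI:
  assumes "H \<subseteq> carrier M" "\<zero>\<^bsub>M\<^esub> \<in> H"
    and "\<And>x y. x \<in> H \<Longrightarrow> y \<in> H \<Longrightarrow> x \<oplus>\<^bsub>M\<^esub> y \<in> H"
    and sm: "\<And>a x. a \<in> carrier R \<Longrightarrow> x \<in> H \<Longrightarrow> a \<odot>\<^bsub>M\<^esub> x \<in> H"
  shows "submodule H R M"
proof (rule submoduleI)
  fix x assume x: "x \<in> H"
  then have "\<ominus>\<^bsub>M\<^esub> x = (\<ominus> \<one>) \<odot>\<^bsub>M\<^esub> x"
    using assms(1) by (simp add: smult_l_minus subset_iff)
  then show "\<ominus>\<^bsub>M\<^esub> x \<in> H" using sm[OF _ x] by simp
qed (use assms in auto)

lemma submodule_add_cancel: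
  assumes H: "submodule H R M" and "y \<in> H" "x \<in> carrier M" "x \<oplus>\<^bsub>M\<^esub> y \<in> H"
  shows "x \<in> H"
proof -
  have "(x \<oplus>\<^bsub>M\<^esub> y) \<ominus>\<^bsub>M\<^esub> y = x"
    using assms submodule_carrier[OF H] by (simp add: M.minus_eq M.a_assoc M.r_neg)
  then show ?thesis using submodule_minus[OF H assms(4,2)] by simp
qed

lemma submodule_diff_cancel:
  assumes H: "submodule H R M" and "y \<in> H" "x \<in> carrier M" "x \<ominus>\<^bsub>M\<^esub> y \<in> H"
  shows "x \<in> H"
proof -
  have "(x \<ominus>\<^bsub>M\<^esub> y) \<oplus>\<^bsub>M\<^esub> y = x"
    using assms submodule_carrier[OF H] by (simp add: M.minus_eq M.a_assoc M.l_neg)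
  then show ?thesis using submoduleE(5)[OF H assms(4,2)] by simp
qed

lemma diff_add_cancel: "x \<in> carrier M \<Longrightarrow> y \<in> carrier M \<Longrightarrow> y \<oplus>\<^bsub>M\<^esub> (x \<ominus>\<^bsub>M\<^esub> y) = x"
  by (simp add: M.minus_eq M.a_lcomm M.r_neg)

lemma diff_eq_zeroD:
  assumes "x \<in> carrier M" "y \<in> carrier M" "x \<ominus>\<^bsub>M\<^esub> y = \<zero>\<^bsub>M\<^esub>"
  shows "x = y"
  using diff_add_cancel[OF assms(1,2)] assms by simp

lemma diff_diff_left_cancel:
  assumes "x \<in> carrier M" "y \<in> carrier M" "z \<in> carrier M"
  shows "(x \<ominus>\<^bsub>M\<^esub> z) \<ominus>\<^bsub>M\<^esub> (x \<ominus>\<^bsub>M\<^esub> y) = y \<ominus>\<^bsub>M\<^esub> z"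
proof -
  have "(x \<ominus>\<^bsub>M\<^esub> z) \<ominus>\<^bsub>M\<^esub> (x \<ominus>\<^bsub>M\<^esub> y) = (x \<ominus>\<^bsub>M\<^esub> x) \<oplus>\<^bsub>M\<^esub> (y \<ominus>\<^bsub>M\<^esub> z)"
    using assms by (simp add: M.minus_eq M.minus_add M.a_ac)
  then show ?thesis using assms by (simp add: M.minus_eq M.r_neg)
qed

lemma smult_r_diff:
  "a \<in> carrier R \<Longrightarrow> x \<in> carrier M \<Longrightarrow> y \<in> carrier M
    \<Longrightarrow> a \<odot>\<^bsub>M\<^esub> (x \<ominus>\<^bsub>M\<^esub> y) = a \<odot>\<^bsub>M\<^esub> x \<ominus>\<^bsub>M\<^esub> a \<odot>\<^bsub>M\<^esub> y"
  by (simp add: M.minus_eq smult_r_distr smult_r_minus)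

lemma smult_l_diff:
  "a \<in> carrier R \<Longrightarrow> b \<in> carrier R \<Longrightarrow> x \<in> carrier M
    \<Longrightarrow> (a \<ominus> b) \<odot>\<^bsub>M\<^esub> x = a \<odot>\<^bsub>M\<^esub> x \<ominus>\<^bsub>M\<^esub> b \<odot>\<^bsub>M\<^esub> x"
  by (simp add: M.minus_eq R.minus_eq smult_l_distr smult_l_minus)

lemma smult_commute:
  "a \<in> carrier R \<Longrightarrow> b \<in> carrier R \<Longrightarrow> x \<in> carrier M \<Longrightarrow> a \<odot>\<^bsub>M\<^esub> (b \<odot>\<^bsub>M\<^esub> x) = b \<odot>\<^bsub>M\<^esub> (a \<odot>\<^bsub>M\<^esub> x)"
  by (metis smult_assoc1 R.m_comm)

lemma add_diff_add:
  assumes "x \<in> carrier M" "y \<in> carrier M" "z \<in> carrier M" "w \<in> carrier M"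
  shows "(x \<oplus>\<^bsub>M\<^esub> y) \<ominus>\<^bsub>M\<^esub> (z \<oplus>\<^bsub>M\<^esub> w) = (x \<ominus>\<^bsub>M\<^esub> z) \<oplus>\<^bsub>M\<^esub> (y \<ominus>\<^bsub>M\<^esub> w)"
  using assms by (simp add: M.minus_eq M.minus_add M.a_ac)

lemma add_add_add:
  assumes "x \<in> carrier M" "y \<in> carrier M" "z \<in> carrier M" "w \<in> carrier M"
  shows "(x \<oplus>\<^bsub>M\<^esub> y) \<oplus>\<^bsub>M\<^esub> (z \<oplus>\<^bsub>M\<^esub> w) = (x \<oplus>\<^bsub>M\<^esub> z) \<oplus>\<^bsub>M\<^esub> (y \<oplus>\<^bsub>M\<^esub> w)"
  using assms by (simp add: M.a_ac)

lemma submodule_zero_singleton: "submodule {\<zero>\<^bsub>M\<^esub>} R M"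
  by (rule submodule_subI) auto

lemma submodule_Int: "submodule H R M \<Longrightarrow> submodule K R M \<Longrightarrow> submodule (H \<inter> K) R M"
  by (rule submodule_subI) (auto simp: submoduleE submodule_zero submodule_carrier)

lemma submodule_image:
  assumes "x \<in> carrier R" shows "submodule {x \<odot>\<^bsub>M\<^esub> v | v. v \<in> carrier M} R M"
proof (rule submodule_subI)
  show "\<zero>\<^bsub>M\<^esub> \<in> {x \<odot>\<^bsub>M\<^esub> v | v. v \<in> carrier M}"
    using assms by (auto intro!: exI[of _ "\<zero>\<^bsub>M\<^esub>"])
  show "\<And>u w. u \<in> {x \<odot>\<^bsub>M\<^esub> v | v. v \<in> carrier M} \<Longrightarrow> w \<in> {x \<odot>\<^bsub>M\<^esub> v | v. v \<in> carrier M}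
      \<Longrightarrow> u \<oplus>\<^bsub>M\<^esub> w \<in> {x \<odot>\<^bsub>M\<^esub> v | v. v \<in> carrier M}"
    using assms by clarsimp (metis M.a_closed smult_r_distr)
  show "\<And>a u. a \<in> carrier R \<Longrightarrow> u \<in> {x \<odot>\<^bsub>M\<^esub> v | v. v \<in> carrier M}
      \<Longrightarrow> a \<odot>\<^bsub>M\<^esub> u \<in> {x \<odot>\<^bsub>M\<^esub> v | v. v \<in> carrier M}"
    using assms by clarsimp (metis smult_closed smult_commute)
qed (use assms in auto)

lemma submodule_cyclic:
  assumes "x \<in> carrier M" shows "submodule {a \<odot>\<^bsub>M\<^esub> x | a. a \<in> carrier R} R M"
proof (rule submodule_subI)
  show "\<zero>\<^bsub>M\<^esub> \<in> {a \<odot>\<^bsub>M\<^esub> x | a. a \<in> carrier R}"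
    using assms by (auto intro!: exI[of _ "\<zero>"])
  show "\<And>u w. u \<in> {a \<odot>\<^bsub>M\<^esub> x | a. a \<in> carrier R} \<Longrightarrow> w \<in> {a \<odot>\<^bsub>M\<^esub> x | a. a \<in> carrier R}
      \<Longrightarrow> u \<oplus>\<^bsub>M\<^esub> w \<in> {a \<odot>\<^bsub>M\<^esub> x | a. a \<in> carrier R}"
    using assms by clarsimp (metis R.a_closed smult_l_distr)
  show "\<And>a u. a \<in> carrier R \<Longrightarrow> u \<in> {a \<odot>\<^bsub>M\<^esub> x | a. a \<in> carrier R}
      \<Longrightarrow> a \<odot>\<^bsub>M\<^esub> u \<in> {a \<odot>\<^bsub>M\<^esub> x | a. a \<in> carrier R}"
    using assms by clarsimp (metis R.m_closed smult_assoc1)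
qed (use assms in auto)

lemma mem_set_add: "x \<in> H <+>\<^bsub>M\<^esub> K \<longleftrightarrow> (\<exists>h\<in>H. \<exists>k\<in>K. x = h \<oplus>\<^bsub>M\<^esub> k)"
  by (auto simp: set_add_def set_mult_def)

lemma submodule_set_add:
  assumes H: "submodule H R M" and K: "submodule K R M"
  shows "submodule (H <+>\<^bsub>M\<^esub> K) R M"
proof (rule submodule_subI)
  show "H <+>\<^bsub>M\<^esub> K \<subseteq> carrier M"
    using submodule_carrier[OF H] submodule_carrier[OF K] by (auto simp: mem_set_add)
  show "\<zero>\<^bsub>M\<^esub> \<in> H <+>\<^bsub>M\<^esub> K"
    using submodule_zero[OF H] submodule_zero[OF K] by (force simp: mem_set_add)
next
  fix x y assume "x \<in> H <+>\<^bsub>M\<^esub> K" "y \<in> H <+>\<^bsub>M\<^esub> K"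
  then obtain h k h' k' where *: "h \<in> H" "k \<in> K" "h' \<in> H" "k' \<in> K"
    "x = h \<oplus>\<^bsub>M\<^esub> k" "y = h' \<oplus>\<^bsub>M\<^esub> k'" by (auto simp: mem_set_add)
  then have "x \<oplus>\<^bsub>M\<^esub> y = (h \<oplus>\<^bsub>M\<^esub> h') \<oplus>\<^bsub>M\<^esub> (k \<oplus>\<^bsub>M\<^esub> k')"
    using submodule_carrier[OF H] submodule_carrier[OF K] by (simp add: add_add_add)
  with * show "x \<oplus>\<^bsub>M\<^esub> y \<in> H <+>\<^bsub>M\<^esub> K"
    using submoduleE(5)[OF H] submoduleE(5)[OF K] unfolding mem_set_add by blast
next
  fix a x assume "a \<in> carrier R" "x \<in> H <+>\<^bsub>M\<^esub> K"
  then show "a \<odot>\<^bsub>M\<^esub> x \<in> H <+>\<^bsub>M\<^esub> K"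
    using submodule_carrier[OF H] submodule_carrier[OF K] submoduleE(4)[OF H] submoduleE(4)[OF K]
    by (auto simp: mem_set_add) (metis smult_r_distr)
qed

lemma set_add_upper1:
  assumes "submodule H R M" "submodule K R M" shows "H \<subseteq> H <+>\<^bsub>M\<^esub> K"
proof
  fix x assume x: "x \<in> H"
  then have "x = x \<oplus>\<^bsub>M\<^esub> \<zero>\<^bsub>M\<^esub>" using submodule_carrier[OF assms(1)] by simp
  then show "x \<in> H <+>\<^bsub>M\<^esub> K" using x submodule_zero[OF assms(2)] unfolding mem_set_add by blast
qed

lemma set_add_upper2:
  assumes "submodule H R M" "submodule K R M" shows "K \<subseteq> H <+>\<^bsub>M\<^esub> K"
proof
  fix x assume x: "x \<in> K"
  then have "x = \<zero>\<^bsub>M\<^esub> \<oplus>\<^bsub>M\<^esub> x" using submodule_carrier[OF assms(2)] by simp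
  then show "x \<in> H <+>\<^bsub>M\<^esub> K" using x submodule_zero[OF assms(1)] unfolding mem_set_add by blast
qed

lemma colon_ideal:
  assumes H: "submodule H R M" and x: "x \<in> carrier M"
  shows "ideal (colon R M H x) R"
proof (rule idealI)
  show "ring R" by (rule R.ring_axioms)
  show "subgroup (colon R M H x) (add_monoid R)"
  proof (rule R.add.subgroupI)
    show "colon R M H x \<subseteq> carrier R" by (auto simp: colon_def)
    show "colon R M H x \<noteq> {}"
      using x submodule_zero[OF H] by (auto simp: colon_def intro!: exI[of _ \<zero>])
    show "\<ominus> a \<in> colon R M H x" if "a \<in> colon R M H x" for a
      using that x submoduleE(3)[OF H]
      by (auto simp: colon_def smult_l_minus)
    show "a \<oplus> b \<in> colon R M H x"
      if "a \<in> colon R M H x" "b \<in> colon R M H x" for a b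
      using that x submoduleE(5)[OF H] by (auto simp: colon_def smult_l_distr)
  qed
  fix a b assume ab: "a \<in> colon R M H x" "b \<in> carrier R"
  then show "b \<otimes> a \<in> colon R M H x"
    using x submoduleE(4)[OF H] by (auto simp: colon_def smult_assoc1)
  with ab show "a \<otimes> b \<in> colon R M H x"
    by (auto simp: colon_def R.m_comm)
qed

lemma span_submodule:
  assumes "A \<subseteq> carrier M" shows "submodule (mod_span R M A) R M"
proof (rule submodule_subI)
  show "mod_span R M A \<subseteq> carrier M"
    using assms carrier_is_submodule by (auto simp: mod_span_def)
qed (auto simp: mod_span_def submodule_zero submoduleE(4,5))

lemma span_superset: "A \<subseteq> mod_span R M A"
  by (auto simp: mod_span_def)

lemma span_least: "submodule H R M \<Longrightarrow> A \<subseteq> H \<Longrightarrow> mod_span R M A \<subseteq> H"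
  by (auto simp: mod_span_def)

lemma span_mono: "A \<subseteq> B \<Longrightarrow> mod_span R M A \<subseteq> mod_span R M B"
  by (auto simp: mod_span_def)

lemma span_empty: "mod_span R M {} = {\<zero>\<^bsub>M\<^esub>}"
  using span_least[OF submodule_zero_singleton] submodule_zero[OF span_submodule] by auto

lemma span_carrier: "A \<subseteq> carrier M \<Longrightarrow> x \<in> mod_span R M A \<Longrightarrow> x \<in> carrier M"
  using span_submodule submodule_carrier by blast

lemma span_insert:
  assumes g: "g \<in> carrier M" and A: "A \<subseteq> carrier M"
  shows "mod_span R M (insert g A) = {a \<odot>\<^bsub>M\<^esub> g | a. a \<in> carrier R} <+>\<^bsub>M\<^esub> mod_span R M A"
    (is "_ = ?C <+>\<^bsub>M\<^esub> _")
proof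
  note C = submodule_cyclic[OF g] and S = span_submodule[OF A]
  have "g \<in> ?C" using g by (auto intro!: exI[of _ \<one>])
  then show "mod_span R M (insert g A) \<subseteq> ?C <+>\<^bsub>M\<^esub> mod_span R M A"
    using set_add_upper1[OF C S] set_add_upper2[OF C S] span_superset[of A]
    by (intro span_least submodule_set_add[OF C S]) auto
  have I: "submodule (mod_span R M (insert g A)) R M"
    using g A by (intro span_submodule) auto
  show "?C <+>\<^bsub>M\<^esub> mod_span R M A \<subseteq> mod_span R M (insert g A)"
    using span_mono[OF subset_insertI] span_superset[of "insert g A"]
      submoduleE(4,5)[OF I] by (auto simp: mem_set_add subset_iff)
qed

lemma span_insertE:
  assumes "x \<in> mod_span R M (insert g A)" "g \<in> carrier M" "A \<subseteq> carrier M"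
  obtains a v where "a \<in> carrier R" "v \<in> mod_span R M A" "x = a \<odot>\<^bsub>M\<^esub> g \<oplus>\<^bsub>M\<^esub> v"
  using assms by (auto simp: span_insert mem_set_add)

end

section \<open>Noetherian modules\<close>

locale noetherian_module = module +
  assumes submodule_fg: "submodule H R M \<Longrightarrow> \<exists>A. finite A \<and> A \<subseteq> H \<and> mod_span R M A = H"

text \<open>The condition on \<open>a\<close> says that \<open>a g\<close> lies in
  \<open>H + S\<close>, so the set is the colon ideal of \<open>g\<close> modulo
  \<open>H + S\<close>. It plays the part of the leading coefficients in the Hilbert basis
  theorem.\<close>

lemma (in module) leading_coefficient_ideal:
  assumes H: "submodule H R M" and S: "submodule S R M" and g: "g \<in> carrier M"
  shows "ideal {a \<in> carrier R. \<exists>v\<in>S. a \<odot>\<^bsub>M\<^esub> g \<oplus>\<^bsub>M\<^esub> v \<in> H} R"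
proof -
  have "{a \<in> carrier R. \<exists>v\<in>S. a \<odot>\<^bsub>M\<^esub> g \<oplus>\<^bsub>M\<^esub> v \<in> H} = colon R M (H <+>\<^bsub>M\<^esub> S) g"
  proof (rule Set.set_eqI, rule iffI)
    fix a assume "a \<in> {a \<in> carrier R. \<exists>v\<in>S. a \<odot>\<^bsub>M\<^esub> g \<oplus>\<^bsub>M\<^esub> v \<in> H}"
    then obtain v where v: "a \<in> carrier R" "v \<in> S" "a \<odot>\<^bsub>M\<^esub> g \<oplus>\<^bsub>M\<^esub> v \<in> H" by auto
    have "a \<odot>\<^bsub>M\<^esub> g = (a \<odot>\<^bsub>M\<^esub> g \<oplus>\<^bsub>M\<^esub> v) \<oplus>\<^bsub>M\<^esub> \<ominus>\<^bsub>M\<^esub> v"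
      using v g submodule_carrier[OF S] by (simp add: M.a_assoc M.r_neg)
    with v show "a \<in> colon R M (H <+>\<^bsub>M\<^esub> S) g"
      using submoduleE(3)[OF S v(2)] by (auto simp: colon_def mem_set_add)
  next
    fix a assume "a \<in> colon R M (H <+>\<^bsub>M\<^esub> S) g"
    then obtain h v where v: "a \<in> carrier R" "v \<in> S" "h \<in> H" "a \<odot>\<^bsub>M\<^esub> g = h \<oplus>\<^bsub>M\<^esub> v"
      by (auto simp: colon_def mem_set_add)
    then have "a \<odot>\<^bsub>M\<^esub> g \<oplus>\<^bsub>M\<^esub> \<ominus>\<^bsub>M\<^esub> v = h"
      using submodule_carrier[OF S] submodule_carrier[OF H] by (simp add: M.a_assoc M.r_neg)
    then show "a \<in> {a \<in> carrier R. \<exists>v\<in>S. a \<odot>\<^bsub>M\<^esub> g \<oplus>\<^bsub>M\<^esub> v \<in> H}"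
      using v(1,3) submoduleE(3)[OF S v(2)] by (auto intro!: bexI[of _ "\<ominus>\<^bsub>M\<^esub> v"])
  qed
  then show ?thesis using colon_ideal[OF submodule_set_add[OF H S] g] by simp
qed

text \<open>Induction on the generators. \<open>H\<close> is controlled by two finitely generated
  pieces: the ideal of coefficients at \<open>g\<close> of its elements, and its intersection with
  the span of the other generators.\<close>

lemma (in module) submodule_of_fin_span_fg:
  assumes "noetherian_ring R" "finite A"
  shows "A \<subseteq> carrier M \<Longrightarrow> submodule H R M \<Longrightarrow> H \<subseteq> mod_span R M A
    \<Longrightarrow> \<exists>B. finite B \<and> B \<subseteq> H \<and> mod_span R M B = H"
  using assms(2)
proof (induction A arbitrary: H rule: finite_induct)
  case empty
  then have "H = {\<zero>\<^bsub>M\<^esub>}" using span_empty submodule_zero by blast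
  then show ?case using span_empty by (intro exI[of _ "{}"]) auto
next
  case (insert g A)
  interpret noetherian_ring R by fact
  have g: "g \<in> carrier M" and A: "A \<subseteq> carrier M" using insert by auto
  note S = span_submodule[OF A] and H = insert.prems(2)
  let ?J = "\<lambda>H. {a \<in> carrier R. \<exists>v\<in>mod_span R M A. a \<odot>\<^bsub>M\<^esub> g \<oplus>\<^bsub>M\<^esub> v \<in> H}"
  obtain T where T: "T \<subseteq> carrier R" "finite T" "?J H = Idl T"
    using finetely_gen[OF leading_coefficient_ideal[OF H S g]] by blast
  have "\<forall>a\<in>T. \<exists>v\<in>mod_span R M A. a \<odot>\<^bsub>M\<^esub> g \<oplus>\<^bsub>M\<^esub> v \<in> H"
    using T(3) genideal_self[OF T(1)] by auto
  then obtain w where w: "\<And>a. a \<in> T \<Longrightarrow> w a \<in> mod_span R M A \<and> a \<odot>\<^bsub>M\<^esub> g \<oplus>\<^bsub>M\<^esub> w a \<in> H"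
    by metis
  obtain B where B: "finite B" "B \<subseteq> H \<inter> mod_span R M A" "mod_span R M B = H \<inter> mod_span R M A"
    using insert.IH[OF A submodule_Int[OF H S]] by auto
  let ?C = "(\<lambda>a. a \<odot>\<^bsub>M\<^esub> g \<oplus>\<^bsub>M\<^esub> w a) ` T \<union> B"
  have CH: "?C \<subseteq> H" using w B by auto
  then have Cs: "submodule (mod_span R M ?C) R M"
    using submoduleE(1)[OF H] by (intro span_submodule) blast
  have "T \<subseteq> ?J (mod_span R M ?C)" using T(1) w span_superset[of ?C] by blast
  \<comment> \<open>Every coefficient at \<open>g\<close> of an element of \<open>H\<close> already
    occurs in the span of \<open>?C\<close>; after subtraction the rest lies in \<open>H\<close> and
    in the span of \<open>A\<close>, and \<open>B\<close> generates that intersection.\<close>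
  then have JC: "?J H \<subseteq> ?J (mod_span R M ?C)"
    unfolding T(3) by (rule genideal_minimal[OF leading_coefficient_ideal[OF Cs S g]])
  have "H \<subseteq> mod_span R M ?C"
  proof
    fix x assume x: "x \<in> H"
    then obtain a v where av: "a \<in> carrier R" "v \<in> mod_span R M A" "x = a \<odot>\<^bsub>M\<^esub> g \<oplus>\<^bsub>M\<^esub> v"
      using span_insertE[OF subsetD[OF insert.prems(3)] g A] by blast
    with x JC obtain v' where v': "v' \<in> mod_span R M A" "a \<odot>\<^bsub>M\<^esub> g \<oplus>\<^bsub>M\<^esub> v' \<in> mod_span R M ?C"
      by blast
    have "x \<ominus>\<^bsub>M\<^esub> (a \<odot>\<^bsub>M\<^esub> g \<oplus>\<^bsub>M\<^esub> v') = v \<ominus>\<^bsub>M\<^esub> v'"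
      using av v' g span_carrier[OF A] by (simp add: add_diff_add) (simp add: M.minus_eq M.r_neg)
    moreover have "mod_span R M ?C \<subseteq> H" by (rule span_least[OF H CH])
    ultimately have "x \<ominus>\<^bsub>M\<^esub> (a \<odot>\<^bsub>M\<^esub> g \<oplus>\<^bsub>M\<^esub> v') \<in> H \<inter> mod_span R M A"
      using submodule_minus[OF S av(2) v'(1)] submodule_minus[OF H x] v'(2) by (metis IntI subsetD)
    then have "x \<ominus>\<^bsub>M\<^esub> (a \<odot>\<^bsub>M\<^esub> g \<oplus>\<^bsub>M\<^esub> v') \<in> mod_span R M ?C"
      using B(3) span_mono[of B ?C] by auto
    then show "x \<in> mod_span R M ?C"
      using submodule_diff_cancel[OF Cs v'(2)] x submodule_carrier[OF H] by blast
  qed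
  then show ?case using T(2) B(1) CH span_least[OF H CH] by (intro exI[of _ ?C]) auto
qed

lemma fin_gen_module_noetherian:
  assumes "noetherian_ring R" "fin_gen_module R M"
  shows "noetherian_module R M"
proof -
  interpret module R M using assms by (simp add: fin_gen_module_def)
  obtain A where A: "finite A" "A \<subseteq> carrier M" "mod_span R M A = carrier M"
    using assms(2) by (auto simp: fin_gen_module_def)
  show ?thesis
    using submodule_of_fin_span_fg[OF assms(1) A(1,2)] A(3) submoduleE(1)
    by unfold_locales blast
qed

text \<open>Zorn's lemma: the union of a chain is a submodule, its finitely many generators lie in
  one member of the chain, so the union is that member and belongs to the family.\<close>

lemma (in noetherian_module) submodule_maximal:
  assumes ne: "\<F> \<noteq> {}" and F: "\<And>H. H \<in> \<F> \<Longrightarrow> submodule H R M"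
  shows "\<exists>G\<in>\<F>. \<forall>H\<in>\<F>. G \<subseteq> H \<longrightarrow> H = G"
proof (rule subset_Zorn_nonempty[OF ne])
  fix C assume C: "C \<noteq> {}" "subset.chain \<F> C"
  then have CF: "C \<subseteq> \<F>" and lin: "\<And>U W. U \<in> C \<Longrightarrow> W \<in> C \<Longrightarrow> U \<subseteq> W \<or> W \<subseteq> U"
    by (auto simp: subset.chain_def)
  have sub: "submodule Z R M" if "Z \<in> C" for Z
    using F CF that by auto
  have UC: "submodule (\<Union>C) R M"
  proof (rule submodule_subI)
    show "\<Union>C \<subseteq> carrier M" using submoduleE(1)[OF sub] by auto
    show "\<zero>\<^bsub>M\<^esub> \<in> \<Union>C" using C(1) submodule_zero[OF sub] by auto
    show "x \<oplus>\<^bsub>M\<^esub> y \<in> \<Union>C" if xy: "x \<in> \<Union>C" "y \<in> \<Union>C" for x y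
    proof -
      obtain U W where UW: "x \<in> U" "U \<in> C" "y \<in> W" "W \<in> C" using xy by auto
      have "\<exists>Z\<in>C. x \<in> Z \<and> y \<in> Z"
        using lin[OF UW(2,4)]
      proof
        assume "U \<subseteq> W" then show ?thesis using UW by auto
      next
        assume "W \<subseteq> U" then show ?thesis using UW by auto
      qed
      then obtain Z where Z: "Z \<in> C" "x \<in> Z" "y \<in> Z" by auto
      then have "x \<oplus>\<^bsub>M\<^esub> y \<in> Z" using submoduleE(5)[OF sub] by simp
      then show ?thesis using Z(1) by auto
    qed
    show "\<And>a x. a \<in> carrier R \<Longrightarrow> x \<in> \<Union>C \<Longrightarrow> a \<odot>\<^bsub>M\<^esub> x \<in> \<Union>C"
      using submoduleE(4)[OF sub] by auto
  qed
  obtain A where A: "finite A" "A \<subseteq> \<Union>C" "mod_span R M A = \<Union>C"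
    using submodule_fg[OF UC] by auto
  obtain U where U: "U \<in> C" "A \<subseteq> U"
    using finite_subset_Union_chain[OF A(1,2) C(1,2)] by auto
  then have "\<Union>C \<subseteq> U" using A(3) span_least[OF sub[OF U(1)] U(2)] by simp
  then have "\<Union>C = U" using U by blast
  then show "\<Union>C \<in> \<F>" using U CF by blast
qed

section \<open>Primes and colon ideals\<close>

lemma regular_module_simps [simp]:
  "carrier (regular_module R) = carrier R"
  "\<zero>\<^bsub>regular_module R\<^esub> = \<zero>\<^bsub>R\<^esub>"
  "x \<oplus>\<^bsub>regular_module R\<^esub> y = x \<oplus>\<^bsub>R\<^esub> y"
  "a \<odot>\<^bsub>regular_module R\<^esub> x = a \<otimes>\<^bsub>R\<^esub> x"
  by (simp_all add: regular_module_def)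

lemma (in cring) regular_module: "module R (regular_module R)"
proof (rule moduleI)
  show "abelian_group (regular_module R)"
    by (rule abelian_groupI) (auto simp: a_ac intro: bexI[of _ "\<ominus> _"] l_neg)
qed (auto simp: l_distr r_distr m_assoc is_cring)

lemma (in cring) ideal_is_submodule:
  assumes "ideal I R" shows "submodule I R (regular_module R)"
proof -
  interpret ideal I R by fact
  show ?thesis
    by (rule module.submodule_subI[OF regular_module]) (auto simp: I_l_closed Icarr)
qed

lemma (in cring) regular_module_fin_gen: "fin_gen_module R (regular_module R)"
proof -
  interpret RM: module R "regular_module R" by (rule regular_module)
  have S: "submodule (mod_span R (regular_module R) {\<one>}) R (regular_module R)"
    by (rule RM.span_submodule) simp
  have "\<one> \<in> mod_span R (regular_module R) {\<one>}" using RM.span_superset by blast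
  then have "x \<in> mod_span R (regular_module R) {\<one>}" if "x \<in> carrier R" for x
    using RM.submoduleE(4)[OF S that] that by fastforce
  then have "mod_span R (regular_module R) {\<one>} = carrier (regular_module R)"
    using RM.submoduleE(1)[OF S] by auto
  then show ?thesis
    unfolding fin_gen_module_def using regular_module by (auto intro!: exI[of _ "{\<one>}"])
qed

lemma ideal_maximal:
  assumes "cring R" "noetherian_ring R" "\<F> \<noteq> {}" and F: "\<And>I. I \<in> \<F> \<Longrightarrow> ideal I R"
  shows "\<exists>G\<in>\<F>. \<forall>I\<in>\<F>. G \<subseteq> I \<longrightarrow> I = G"
proof -
  interpret cring R by fact
  interpret noetherian_module R "regular_module R"
    by (rule fin_gen_module_noetherian[OF assms(2) regular_module_fin_gen])
  show ?thesis
    by (rule submodule_maximal[OF assms(3)]) (rule ideal_is_submodule[OF F])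
qed

text \<open>A product of elements chosen outside \<open>P\<close> works. This turns separate scalars
  outside \<open>P\<close>, one for each of finitely many generators, into a common one, in place of
  an argument in the localization.\<close>

lemma (in cring) prime_avoids_finite:
  assumes P: "primeideal P R" and "finite F"
  shows "(\<And>I. I \<in> F \<Longrightarrow> ideal I R \<and> \<not> I \<subseteq> P)
    \<Longrightarrow> \<exists>y\<in>carrier R - P. \<forall>I\<in>F. y \<in> I"
  using assms(2)
proof (induction F rule: finite_induct)
  case empty
  have "\<one> \<notin> P" using ideal.one_imp_carrier primeideal.I_notcarr[OF P] primeideal.axioms(1)[OF P] by metis
  then show ?case by auto
next
  case (insert I F)
  then obtain y where y: "y \<in> carrier R" "y \<notin> P" "\<forall>I\<in>F. y \<in> I" by auto
  obtain x where x: "x \<in> I" "x \<notin> P" using insert.prems[of I] by auto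
  have I: "ideal I R" using insert.prems[of I] by simp
  have xc: "x \<in> carrier R" using ideal.Icarr[OF I x(1)] .
  have "x \<otimes> y \<notin> P" using primeideal.I_prime[OF P xc y(1)] x y by auto
  moreover have "\<forall>K\<in>insert I F. x \<otimes> y \<in> K"
    using ideal.I_r_closed[OF I x(1) y(1)] ideal.I_l_closed[of _ R y x] xc y(3) insert.prems by auto
  ultimately show ?case using xc y(1) by auto
qed

text \<open>Induction over the primes: an \<open>x\<close> that fails only at the new prime
  \<open>P\<close> is corrected by some \<open>y\<close> of \<open>J\<close> that lies in all the
  other primes but not in \<open>P\<close>. Incomparability provides \<open>y\<close>.\<close>

lemma (in cring) prime_avoidance:
  assumes J: "ideal J R" and "finite F"
  shows "(\<And>P. P \<in> F \<Longrightarrow> primeideal P R \<and> \<not> J \<subseteq> P)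
    \<Longrightarrow> (\<And>P Q. P \<in> F \<Longrightarrow> Q \<in> F \<Longrightarrow> P \<subseteq> Q \<Longrightarrow> P = Q)
    \<Longrightarrow> \<exists>x\<in>J. \<forall>P\<in>F. x \<notin> P"
  using assms(2)
proof (induction F rule: finite_induct)
  case empty
  then show ?case using additive_subgroup.zero_closed ideal.axioms(1)[OF J] by auto
next
  case (insert P F)
  then obtain x where x: "x \<in> J" "\<forall>Q\<in>F. x \<notin> Q" by auto
  have P: "primeideal P R" using insert.prems by simp
  show ?case
  proof (cases "x \<in> P")
    case False
    then show ?thesis using x by auto
  next
    case True
    have "\<exists>y\<in>carrier R - P. \<forall>I\<in>insert J F. y \<in> I"
    proof (rule prime_avoids_finite[OF P])
      fix I assume "I \<in> insert J F"
      moreover have "\<not> I \<subseteq> P" if "I \<in> F" using insert.prems(2)[of I P] insert.hyps that by auto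
      ultimately show "ideal I R \<and> \<not> I \<subseteq> P"
        using J insert.prems(1) primeideal.axioms(1) by auto
    qed (use insert.hyps in auto)
    then obtain y where y: "y \<in> carrier R" "y \<notin> P" "y \<in> J" "\<forall>Q\<in>F. y \<in> Q" by auto
    have xc: "x \<in> carrier R" using ideal.Icarr[OF J x(1)] .
    have cancel: "y' \<in> I" if "ideal I R" "x' \<in> I" "x' \<oplus> y' \<in> I" "y' \<in> carrier R" for I x' y'
    proof -
      interpret ideal I R by fact
      have "y' = \<ominus> x' \<oplus> (x' \<oplus> y')" using that Icarr by (simp add: r_neg1)
      then show ?thesis using that by (metis a_closed a_inv_closed)
    qed
    have "x \<oplus> y \<notin> Q" if Q: "Q \<in> insert P F" for Q
    proof
      assume xy: "x \<oplus> y \<in> Q"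
      have Qi: "ideal Q R" using insert.prems(1)[OF Q] primeideal.axioms(1) by auto
      show False
      proof (cases "Q = P")
        case True
        then show False using cancel[OF Qi _ xy y(1)] \<open>x \<in> P\<close> y(2) by simp
      next
        case False
        then have "Q \<in> F" using Q by simp
        then show False using cancel[OF Qi, of y x] xy y xc x(2) by (simp add: a_comm)
      qed
    qed
    moreover have "x \<oplus> y \<in> J"
      using x y additive_subgroup.a_closed[OF ideal.axioms(1)[OF J]] by simp
    ultimately show ?thesis by blast
  qed
qed

section \<open>Primes among the colon ideals of a module\<close>

context module
begin

lemma colon_subset_colon_smult:
  assumes "submodule H R M" "x \<in> carrier M" "b \<in> carrier R"
  shows "colon R M H x \<subseteq> colon R M H (b \<odot>\<^bsub>M\<^esub> x)"
proof
  fix a assume a: "a \<in> colon R M H x"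
  then have "a \<odot>\<^bsub>M\<^esub> (b \<odot>\<^bsub>M\<^esub> x) = b \<odot>\<^bsub>M\<^esub> (a \<odot>\<^bsub>M\<^esub> x)"
    using assms by (simp add: colon_def smult_commute)
  then show "a \<in> colon R M H (b \<odot>\<^bsub>M\<^esub> x)"
    using a assms submoduleE(4)[OF assms(1)] by (simp add: colon_def)
qed

text \<open>If \<open>a b x\<close> is in \<open>H\<close> but \<open>b x\<close> is not, then
  \<open>a\<close> lies in the colon ideal of \<open>b x\<close>, which by maximality is no larger
  than that of \<open>x\<close>.\<close>

lemma maximal_colon_prime:
  assumes H: "submodule H R M" and x: "x \<in> carrier M" "x \<notin> H"
    and max: "\<And>b. b \<in> carrier R \<Longrightarrow> b \<odot>\<^bsub>M\<^esub> x \<notin> H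
      \<Longrightarrow> colon R M H (b \<odot>\<^bsub>M\<^esub> x) \<subseteq> colon R M H x"
  shows "primeideal (colon R M H x) R"
proof (rule primeidealI[OF colon_ideal[OF H x(1)] R.is_cring])
  show "carrier R \<noteq> colon R M H x" using x by (auto simp: colon_def set_eq_iff intro!: exI[of _ \<one>])
  fix a b assume ab: "a \<in> carrier R" "b \<in> carrier R" "a \<otimes> b \<in> colon R M H x"
  show "a \<in> colon R M H x \<or> b \<in> colon R M H x"
  proof (cases "b \<odot>\<^bsub>M\<^esub> x \<in> H")
    case True
    then show ?thesis using ab by (simp add: colon_def)
  next
    case False
    have "a \<in> colon R M H (b \<odot>\<^bsub>M\<^esub> x)" using ab x by (simp add: colon_def smult_assoc1)
    then show ?thesis using max[OF ab(2) False] by blast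
  qed
qed

text \<open>Produces an associated prime of the quotient by \<open>H\<close> on a multiple of a
  prescribed \<open>x\<close>, by maximality among the colon ideals of the multiples of
  \<open>x\<close> outside \<open>H\<close>.\<close>

lemma exists_prime_colon:
  assumes noeth: "noetherian_ring R" and H: "submodule H R M" and x: "x \<in> carrier M" "x \<notin> H"
  obtains b where "b \<in> carrier R" "b \<odot>\<^bsub>M\<^esub> x \<notin> H" "primeideal (colon R M H (b \<odot>\<^bsub>M\<^esub> x)) R"
proof -
  let ?F = "{colon R M H (b \<odot>\<^bsub>M\<^esub> x) | b. b \<in> carrier R \<and> b \<odot>\<^bsub>M\<^esub> x \<notin> H}"
  have "?F \<noteq> {}" using x by (auto intro!: exI[of _ \<one>])
  moreover have F: "ideal I R" if "I \<in> ?F" for I using that x colon_ideal[OF H] by auto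
  ultimately obtain G where G: "G \<in> ?F" "\<And>I. I \<in> ?F \<Longrightarrow> G \<subseteq> I \<Longrightarrow> I = G"
    using ideal_maximal[OF R.is_cring noeth, of ?F] F by auto
  then obtain b where b: "b \<in> carrier R" "b \<odot>\<^bsub>M\<^esub> x \<notin> H" "G = colon R M H (b \<odot>\<^bsub>M\<^esub> x)" by blast
  have "primeideal (colon R M H (b \<odot>\<^bsub>M\<^esub> x)) R"
  proof (rule maximal_colon_prime[OF H _ b(2)])
    fix c assume c: "c \<in> carrier R" "c \<odot>\<^bsub>M\<^esub> (b \<odot>\<^bsub>M\<^esub> x) \<notin> H"
    then have "colon R M H (c \<odot>\<^bsub>M\<^esub> (b \<odot>\<^bsub>M\<^esub> x)) \<in> ?F"
      using b x by (auto intro!: exI[of _ "c \<otimes> b"] simp: smult_assoc1)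
    moreover have "G \<subseteq> colon R M H (c \<odot>\<^bsub>M\<^esub> (b \<odot>\<^bsub>M\<^esub> x))"
      using colon_subset_colon_smult[OF H _ c(1)] b x by simp
    ultimately show "colon R M H (c \<odot>\<^bsub>M\<^esub> (b \<odot>\<^bsub>M\<^esub> x)) \<subseteq> colon R M H (b \<odot>\<^bsub>M\<^esub> x)"
      using G(2) b(3) by simp
  qed (use b x in simp)
  then show thesis using that b by simp
qed

end

text \<open>The maximal ideals of the form \<open>(H : x)\<close> are finitely many pairwise incomparable primes,
  so prime avoidance applies to them.\<close>

lemma (in noetherian_module) exists_colon_containing:
  assumes noeth: "noetherian_ring R" and H: "submodule H R M" and J: "ideal J R"
    and zd: "\<And>a. a \<in> J \<Longrightarrow> \<exists>x\<in>carrier M - H. a \<odot>\<^bsub>M\<^esub> x \<in> H"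
  obtains x where "x \<in> carrier M" "x \<notin> H" "\<And>a. a \<in> J \<Longrightarrow> a \<odot>\<^bsub>M\<^esub> x \<in> H"
proof -
  let ?c = "colon R M H"
  \<comment> \<open>The maximal colon ideals are represented by elements, because their finiteness
    will come from the submodule that these elements span.\<close>
  define S where "S = {x \<in> carrier M - H. \<forall>y\<in>carrier M - H. ?c x \<subseteq> ?c y \<longrightarrow> ?c y = ?c x}"
  have SM: "S \<subseteq> carrier M" by (auto simp: S_def)
  have dom: "\<exists>y\<in>S. ?c x \<subseteq> ?c y" if x: "x \<in> carrier M - H" for x
  proof -
    let ?F = "{?c y | y. y \<in> carrier M - H \<and> ?c x \<subseteq> ?c y}"
    have "?F \<noteq> {}" using x by auto
    moreover have F: "ideal I R" if "I \<in> ?F" for I using that colon_ideal[OF H] by auto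
    ultimately obtain G where G: "G \<in> ?F" "\<And>I. I \<in> ?F \<Longrightarrow> G \<subseteq> I \<Longrightarrow> I = G"
      using ideal_maximal[OF R.is_cring noeth, of ?F] F by auto
    then obtain y where y: "y \<in> carrier M - H" "?c x \<subseteq> ?c y" "G = ?c y" by blast
    have "y \<in> S" unfolding S_def using y G(2) by blast
    then show ?thesis using y by blast
  qed
  have Sprime: "primeideal (?c x) R" if x: "x \<in> S" for x
  proof (rule maximal_colon_prime[OF H])
    fix b assume b: "b \<in> carrier R" "b \<odot>\<^bsub>M\<^esub> x \<notin> H"
    have xM: "x \<in> carrier M" using x SM by auto
    have "?c (b \<odot>\<^bsub>M\<^esub> x) = ?c x"
      using x b xM colon_subset_colon_smult[OF H xM b(1)] by (simp add: S_def)
    then show "?c (b \<odot>\<^bsub>M\<^esub> x) \<subseteq> ?c x" by simp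
  qed (use x S_def in auto)
  \<comment> \<open>The span of \<open>S\<close> has finitely many generators within
    \<open>S\<close> itself: a largest span of a finite subset of \<open>S\<close> must contain all
    of \<open>S\<close>.\<close>
  let ?F = "{mod_span R M T | T. finite T \<and> T \<subseteq> S}"
  have "?F \<noteq> {}" by auto
  moreover have F: "submodule K R M" if "K \<in> ?F" for K using that SM span_submodule by blast
  ultimately obtain G where G: "G \<in> ?F" "\<And>K. K \<in> ?F \<Longrightarrow> G \<subseteq> K \<Longrightarrow> K = G"
    using submodule_maximal[of ?F] F by auto
  then obtain T where T: "finite T" "T \<subseteq> S" "G = mod_span R M T" by blast
  have ST: "x \<in> mod_span R M T" if x: "x \<in> S" for x
  proof -
    have "mod_span R M (insert x T) \<in> ?F" using T x by auto
    moreover have "G \<subseteq> mod_span R M (insert x T)" unfolding T(3) by (rule span_mono) auto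
    ultimately have "mod_span R M (insert x T) = G" by (rule G(2))
    then show ?thesis using T(3) span_superset[of "insert x T"] by auto
  qed
  \<comment> \<open>Otherwise some \<open>a\<close> outside the prime of \<open>x\<close> multiplies
    all of \<open>T\<close> into \<open>H\<close>, hence also \<open>x\<close>, which is a
    combination of \<open>T\<close>.\<close>
  have cT: "?c x \<in> ?c ` T" if x: "x \<in> S" for x
  proof (rule ccontr)
    assume no: "?c x \<notin> ?c ` T"
    have "\<exists>a\<in>carrier R - ?c x. \<forall>I\<in>?c ` T. a \<in> I"
    proof (rule R.prime_avoids_finite[OF Sprime[OF x]])
      fix I assume "I \<in> ?c ` T"
      then obtain t where t: "t \<in> T" "I = ?c t" by auto
      have "\<not> ?c t \<subseteq> ?c x"
      proof
        assume "?c t \<subseteq> ?c x"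
        moreover have "t \<in> S" using t T(2) by auto
        ultimately have "?c x = ?c t" using x unfolding S_def by blast
        then show False using no t by auto
      qed
      then show "ideal I R \<and> \<not> I \<subseteq> ?c x"
        using t T(2) SM colon_ideal[OF H] by auto
    qed (use T in auto)
    then obtain a where a: "a \<in> carrier R" "a \<notin> ?c x" "\<And>t. t \<in> T \<Longrightarrow> a \<odot>\<^bsub>M\<^esub> t \<in> H"
      by (auto simp: colon_def)
    have "submodule {w \<in> carrier M. a \<odot>\<^bsub>M\<^esub> w \<in> H} R M"
      by (rule submodule_subI)
        (use a(1) submodule_zero[OF H] submoduleE(4,5)[OF H] in \<open>auto simp: smult_r_distr smult_commute[of a]\<close>)
    then have "mod_span R M T \<subseteq> {w \<in> carrier M. a \<odot>\<^bsub>M\<^esub> w \<in> H}"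
      by (rule span_least) (use a(3) T(2) SM in auto)
    then show False using ST[OF x] a(1,2) by (auto simp: colon_def)
  qed
  have "\<exists>P\<in>?c ` T. J \<subseteq> P"
  proof (rule ccontr)
    assume no: "\<not> (\<exists>P\<in>?c ` T. J \<subseteq> P)"
    have "\<exists>a\<in>J. \<forall>P\<in>?c ` T. a \<notin> P"
    proof (rule R.prime_avoidance[OF J])
      show "primeideal P R \<and> \<not> J \<subseteq> P" if "P \<in> ?c ` T" for P
        using that no T(2) Sprime by auto
      show "P = Q" if PQ: "P \<in> ?c ` T" "Q \<in> ?c ` T" "P \<subseteq> Q" for P Q
      proof -
        obtain u w where "u \<in> S" "w \<in> S" "P = ?c u" "Q = ?c w" using PQ T(2) by auto
        then show ?thesis using PQ(3) by (simp add: S_def)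
      qed
    qed (use T in auto)
    then obtain a where a: "a \<in> J" "\<And>t. t \<in> T \<Longrightarrow> a \<notin> ?c t" by auto
    obtain x where x: "x \<in> carrier M - H" "a \<odot>\<^bsub>M\<^esub> x \<in> H" using zd[OF a(1)] by auto
    obtain y where y: "y \<in> S" "?c x \<subseteq> ?c y" using dom[OF x(1)] by auto
    have "a \<in> ?c x" using x ideal.Icarr[OF J a(1)] by (simp add: colon_def)
    then show False using cT[OF y(1)] y(2) a(2) by auto
  qed
  then obtain t where "t \<in> T" "J \<subseteq> ?c t" by auto
  then show thesis using that[of t] T(2) by (auto simp: S_def colon_def)
qed

section \<open>The maximal ideal of the local ring\<close>

lemma (in noetherian_local_ring) max_ideal_maximal: "maximalideal (max_ideal R) R"
  unfolding max_ideal_def using theI'[OF local] .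

text \<open>The principal ideal of a nonunit is proper, an ideal maximal among those that contain
  \<open>a\<close> but not 1 is a maximal ideal, and the ring has only one.\<close>

lemma (in noetherian_local_ring) unit_if_not_in_max_ideal:
  assumes a: "a \<in> carrier R" "a \<notin> max_ideal R"
  obtains b where "b \<in> carrier R" "b \<otimes> a = \<one>"
proof (rule ccontr)
  note * = that
  assume "\<not> thesis"
  then have no: "\<one> \<noteq> b \<otimes> a" if "b \<in> carrier R" for b using that * by metis
  let ?F = "{I. ideal I R \<and> a \<in> I \<and> \<one> \<notin> I}"
  have "PIdl a \<in> ?F"
    using cgenideal_ideal[OF a(1)] cgenideal_self[OF a(1)] no by (auto simp: cgenideal_def)
  then have ne: "?F \<noteq> {}" by auto
  have "\<exists>G\<in>?F. \<forall>I\<in>?F. G \<subseteq> I \<longrightarrow> I = G"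
    by (rule ideal_maximal[OF is_cring noetherian_ring_axioms ne]) simp
  then obtain G where G: "G \<in> ?F" "\<And>I. I \<in> ?F \<Longrightarrow> G \<subseteq> I \<Longrightarrow> I = G" by auto
  have "maximalideal G R"
  proof (rule maximalidealI)
    show "carrier R \<noteq> G" using G(1) by auto
    fix K assume K: "ideal K R" "G \<subseteq> K" "K \<subseteq> carrier R"
    show "K = G \<or> K = carrier R"
      using G(1) G(2)[of K] K ideal.one_imp_carrier[OF K(1)] by auto
  qed (use G in auto)
  then have "G = max_ideal R" using local max_ideal_maximal by auto
  then show False using G(1) a(2) by auto
qed

section \<open>Generic surjectivity of injective endomorphisms\<close>

text \<open>Modulo \<open>B\<close> the elements of \<open>W\<close> are killed by \<open>p\<close>, and \<open>\<Gamma>\<close> is an injective linear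
  correspondence from \<open>W\<close> to itself; the conclusion says that it is surjective after localizing
  at \<open>p\<close>. Since the orbit of \<open>z\<close> spans a finitely generated module, some relation
  \<open>a\<^sub>0 z + \<dots> + a\<^sub>n \<Gamma>\<^sup>n z \<in> B\<close> with \<open>a\<^sub>n \<notin> p\<close> holds, and for minimal \<open>n\<close> injectivity forces \<open>a\<^sub>0 \<notin> p\<close>.\<close>

lemma (in noetherian_module) generic_surjectivity:
  assumes p: "primeideal p R" and B: "submodule B R M"
    and Gc: "\<And>x y. (x, y) \<in> \<Gamma> \<Longrightarrow> x \<in> carrier M \<and> y \<in> carrier M"
    and G0: "(\<zero>\<^bsub>M\<^esub>, \<zero>\<^bsub>M\<^esub>) \<in> \<Gamma>"
    and Ga: "\<And>x y x' y'. (x, y) \<in> \<Gamma> \<Longrightarrow> (x', y') \<in> \<Gamma> \<Longrightarrow> (x \<oplus>\<^bsub>M\<^esub> x', y \<oplus>\<^bsub>M\<^esub> y') \<in> \<Gamma>"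
    and Gs: "\<And>a x y. a \<in> carrier R \<Longrightarrow> (x, y) \<in> \<Gamma> \<Longrightarrow> (a \<odot>\<^bsub>M\<^esub> x, a \<odot>\<^bsub>M\<^esub> y) \<in> \<Gamma>"
    and W: "W \<subseteq> carrier M" and tot: "\<And>w. w \<in> W \<Longrightarrow> \<exists>w'\<in>W. (w, w') \<in> \<Gamma>"
    and kill: "\<And>a w. a \<in> p \<Longrightarrow> w \<in> W \<Longrightarrow> a \<odot>\<^bsub>M\<^esub> w \<in> B"
    and inj: "\<And>x y. (x, y) \<in> \<Gamma> \<Longrightarrow> y \<in> B \<Longrightarrow> x \<in> B"
    and z: "z \<in> W"
  obtains c x y b where "c \<in> carrier R" "c \<notin> p" "(x, y) \<in> \<Gamma>" "b \<in> B" "c \<odot>\<^bsub>M\<^esub> z = y \<oplus>\<^bsub>M\<^esub> b"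
proof -
  have zM: "z \<in> carrier M" using z W by auto
  have neg: "\<ominus>\<^bsub>M\<^esub> x = (\<ominus> \<one>) \<odot>\<^bsub>M\<^esub> x" if "x \<in> carrier M" for x
    using that by (simp add: smult_l_minus)
  have Gn: "(\<ominus>\<^bsub>M\<^esub> x, \<ominus>\<^bsub>M\<^esub> y) \<in> \<Gamma>" if "(x, y) \<in> \<Gamma>" for x y
    using Gs[OF _ that, of "\<ominus> \<one>"] Gc[OF that] by (simp add: neg)
  have Gd: "(x \<ominus>\<^bsub>M\<^esub> x', y \<ominus>\<^bsub>M\<^esub> y') \<in> \<Gamma>" if "(x, y) \<in> \<Gamma>" "(x', y') \<in> \<Gamma>" for x y x' y'
    using Ga[OF that(1) Gn[OF that(2)]] by (simp add: M.minus_eq)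
  \<comment> \<open>Horner form: \<open>A n\<close> consists of the values at \<open>z\<close> of
    polynomials of degree less than \<open>n\<close> in the correspondence, with all choices of
    images.\<close>
  define A where "A = rec_nat {\<zero>\<^bsub>M\<^esub>}
    (\<lambda>_ S. {a \<odot>\<^bsub>M\<^esub> z \<oplus>\<^bsub>M\<^esub> v' | a v v'. a \<in> carrier R \<and> v \<in> S \<and> (v, v') \<in> \<Gamma>})"
  have A0: "A 0 = {\<zero>\<^bsub>M\<^esub>}" by (simp add: A_def)
  have AS: "A (Suc n) = {a \<odot>\<^bsub>M\<^esub> z \<oplus>\<^bsub>M\<^esub> v' | a v v'. a \<in> carrier R \<and> v \<in> A n \<and> (v, v') \<in> \<Gamma>}" for n
    by (simp add: A_def)
  have Asub: "submodule (A n) R M" for n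
  proof (induction n)
    case 0
    then show ?case using submodule_zero_singleton by (simp add: A0)
  next
    case (Suc n)
    show ?case
    proof (rule submodule_subI)
      show "A (Suc n) \<subseteq> carrier M" using zM Gc by (auto simp: AS)
      have "\<zero>\<^bsub>M\<^esub> = \<zero> \<odot>\<^bsub>M\<^esub> z \<oplus>\<^bsub>M\<^esub> \<zero>\<^bsub>M\<^esub>" using zM by simp
      then show "\<zero>\<^bsub>M\<^esub> \<in> A (Suc n)" unfolding AS using submodule_zero[OF Suc] G0 by blast
    next
      fix x y assume "x \<in> A (Suc n)" "y \<in> A (Suc n)"
      then obtain a v v' b w w' where *: "a \<in> carrier R" "v \<in> A n" "(v, v') \<in> \<Gamma>" "x = a \<odot>\<^bsub>M\<^esub> z \<oplus>\<^bsub>M\<^esub> v'"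
        "b \<in> carrier R" "w \<in> A n" "(w, w') \<in> \<Gamma>" "y = b \<odot>\<^bsub>M\<^esub> z \<oplus>\<^bsub>M\<^esub> w'" unfolding AS by blast
      then have "x \<oplus>\<^bsub>M\<^esub> y = (a \<oplus> b) \<odot>\<^bsub>M\<^esub> z \<oplus>\<^bsub>M\<^esub> (v' \<oplus>\<^bsub>M\<^esub> w')"
        using zM Gc by (simp add: add_add_add smult_l_distr)
      then show "x \<oplus>\<^bsub>M\<^esub> y \<in> A (Suc n)"
        unfolding AS using * Ga submoduleE(5)[OF Suc] by blast
    next
      fix c x assume "c \<in> carrier R" "x \<in> A (Suc n)"
      then obtain a v v' where *: "c \<in> carrier R" "a \<in> carrier R" "v \<in> A n" "(v, v') \<in> \<Gamma>" "x = a \<odot>\<^bsub>M\<^esub> z \<oplus>\<^bsub>M\<^esub> v'"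
        unfolding AS by blast
      then have "c \<odot>\<^bsub>M\<^esub> x = (c \<otimes> a) \<odot>\<^bsub>M\<^esub> z \<oplus>\<^bsub>M\<^esub> c \<odot>\<^bsub>M\<^esub> v'"
        using zM Gc by (simp add: smult_r_distr smult_assoc1)
      then show "c \<odot>\<^bsub>M\<^esub> x \<in> A (Suc n)"
        unfolding AS using * Gs submoduleE(4)[OF Suc] by blast
    qed
  qed
  have Amono: "A n \<subseteq> A (Suc n)" for n
  proof (induction n)
    case 0
    then show ?case using submodule_zero[OF Asub] by (simp add: A0)
  next
    case (Suc n)
    then show ?case by (subst AS, subst AS) blast
  qed
  \<comment> \<open>The increasing chain becomes stationary, and so the orbit of \<open>z\<close>
    will satisfy a monic relation.\<close>
  have "\<exists>n. \<forall>m. A n \<subseteq> A m \<longrightarrow> A m = A n"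
    using submodule_maximal[of "range A"] Asub by auto
  then have "\<exists>n. A (Suc n) = A n" using Amono by metis
  then obtain n where n: "A (Suc n) = A n" by auto
  obtain f where f: "\<And>w. w \<in> W \<Longrightarrow> f w \<in> W \<and> (w, f w) \<in> \<Gamma>" using tot by metis
  \<comment> \<open>One orbit of \<open>z\<close> inside \<open>W\<close>, chosen by totality; it
    supplies the top term of the monic relation.\<close>
  define zs where "zs = rec_nat z (\<lambda>_. f)"
  have zs0: "zs 0 = z" and zsS: "zs (Suc n) = f (zs n)" for n by (simp_all add: zs_def)
  have zsW: "zs n \<in> W" for n by (induction n) (simp_all add: zs0 zsS z f)
  have zsG: "(zs n, zs (Suc n)) \<in> \<Gamma>" for n using f zsW by (simp add: zsS)
  have zsA: "zs n \<in> A (Suc n)" for n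
  proof (induction n)
    case 0
    have "z = \<one> \<odot>\<^bsub>M\<^esub> z \<oplus>\<^bsub>M\<^esub> \<zero>\<^bsub>M\<^esub>" using zM by simp
    then show ?case unfolding zs0 AS[of 0] A0 using G0 by blast
  next
    case (Suc n)
    have "zs (Suc n) = \<zero> \<odot>\<^bsub>M\<^esub> z \<oplus>\<^bsub>M\<^esub> zs (Suc n)" using zM subsetD[OF W zsW] by simp
    then show ?case unfolding AS[of "Suc n"] using Suc zsG by blast
  qed
  \<comment> \<open>The same Horner form in degree exactly \<open>n\<close>, with the innermost,
    that is the leading, coefficient outside \<open>p\<close>. A common element of
    \<open>Y n\<close> and \<open>B\<close> is a relation of degree \<open>n\<close>.\<close>
  define Y where "Y = rec_nat {a \<odot>\<^bsub>M\<^esub> z | a. a \<in> carrier R - p}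
    (\<lambda>_ S. {a \<odot>\<^bsub>M\<^esub> z \<oplus>\<^bsub>M\<^esub> v' | a v v'. a \<in> carrier R \<and> v \<in> S \<and> (v, v') \<in> \<Gamma>})"
  have Y0: "Y 0 = {a \<odot>\<^bsub>M\<^esub> z | a. a \<in> carrier R - p}" by (simp add: Y_def)
  have YS: "Y (Suc n) = {a \<odot>\<^bsub>M\<^esub> z \<oplus>\<^bsub>M\<^esub> v' | a v v'. a \<in> carrier R \<and> v \<in> Y n \<and> (v, v') \<in> \<Gamma>}" for n
    by (simp add: Y_def)
  have one: "\<one> \<notin> p"
    using ideal.one_imp_carrier primeideal.I_notcarr[OF p] primeideal.axioms(1)[OF p] by metis
  \<comment> \<open>Subtracting a polynomial of lower degree keeps the leading coefficient 1. Once
    \<open>A (Suc n) = A n\<close>, the vector \<open>zs n\<close> is itself such a polynomial, so 0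
    lies in \<open>Y n\<close>.\<close>
  have YA: "v \<in> A n \<Longrightarrow> zs n \<ominus>\<^bsub>M\<^esub> v \<in> Y n" for n v
  proof (induction n arbitrary: v)
    case 0
    then have "zs 0 \<ominus>\<^bsub>M\<^esub> v = \<one> \<odot>\<^bsub>M\<^esub> z" using zM by (simp add: zs0 A0 M.minus_eq)
    then show ?case unfolding Y0 using one by blast
  next
    case (Suc n)
    obtain a u u' where u: "a \<in> carrier R" "u \<in> A n" "(u, u') \<in> \<Gamma>" "v = a \<odot>\<^bsub>M\<^esub> z \<oplus>\<^bsub>M\<^esub> u'"
      using Suc.prems unfolding AS by blast
    have "zs (Suc n) \<ominus>\<^bsub>M\<^esub> v = (\<ominus> a) \<odot>\<^bsub>M\<^esub> z \<oplus>\<^bsub>M\<^esub> (zs (Suc n) \<ominus>\<^bsub>M\<^esub> u')"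
      using u zM Gc[OF u(3)] Gc[OF zsG[of n]] by (simp add: smult_l_minus M.minus_eq M.minus_add M.a_ac)
    moreover have "(zs n \<ominus>\<^bsub>M\<^esub> u, zs (Suc n) \<ominus>\<^bsub>M\<^esub> u') \<in> \<Gamma>" by (rule Gd[OF zsG u(3)])
    ultimately show ?case unfolding YS using u Suc.IH by blast
  qed
  have "zs n \<ominus>\<^bsub>M\<^esub> zs n \<in> Y n" using YA zsA n by blast
  moreover have "zs n \<ominus>\<^bsub>M\<^esub> zs n = \<zero>\<^bsub>M\<^esub>" using zsW[of n] W by (auto simp: M.minus_eq M.r_neg)
  ultimately have ex: "\<exists>n. Y n \<inter> B \<noteq> {}" using submodule_zero[OF B] by auto
  define k where "k = (LEAST n. Y n \<inter> B \<noteq> {})"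
  have k: "Y k \<inter> B \<noteq> {}" unfolding k_def using ex by (rule LeastI_ex)
  have kmin: "Y m \<inter> B = {}" if "m < k" for m using not_less_Least that k_def by blast
  show thesis
  proof (cases k)
    case 0
    then obtain a where "a \<in> carrier R" "a \<notin> p" "a \<odot>\<^bsub>M\<^esub> z \<in> B" using k by (auto simp: Y0)
    then show thesis using that[OF _ _ G0, of a "a \<odot>\<^bsub>M\<^esub> z"] zM by simp
  next
    case (Suc m)
    then obtain a v v' where a: "a \<in> carrier R" "v \<in> Y m" "(v, v') \<in> \<Gamma>" "a \<odot>\<^bsub>M\<^esub> z \<oplus>\<^bsub>M\<^esub> v' \<in> B"
      using k by (auto simp: YS)
    have v': "v' \<in> carrier M" using Gc a by blast
    \<comment> \<open>If the constant coefficient were in \<open>p\<close>, then \<open>a z\<close>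
      would be in \<open>B\<close>, hence \<open>v'\<close> too, and injectivity would leave the
      relation \<open>v\<close> of degree \<open>m\<close>, against minimality.\<close>
    have "a \<notin> p"
    proof
      assume "a \<in> p"
      then have "a \<odot>\<^bsub>M\<^esub> z \<in> B" using kill z by simp
      then have "v' \<in> B" using a v' zM submodule_add_cancel[OF B, of "a \<odot>\<^bsub>M\<^esub> z" v'] by (simp add: M.a_comm)
      then show False using inj[OF a(3)] kmin[of m] a(2) Suc by auto
    qed
    moreover have "a \<odot>\<^bsub>M\<^esub> z = \<ominus>\<^bsub>M\<^esub> v' \<oplus>\<^bsub>M\<^esub> (a \<odot>\<^bsub>M\<^esub> z \<oplus>\<^bsub>M\<^esub> v')"
      using a zM v' by (simp add: M.a_ac M.r_neg1 M.r_neg2)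
    ultimately show thesis using that[OF a(1) _ Gn[OF a(3)] a(4)] by simp
  qed
qed

section \<open>Linear maps\<close>

text \<open>No condition is imposed off the carrier. Unlike members of \<open>module_hom\<close>,
  such maps need not be extensional, so sums and composites can be written as plain lambda
  terms.\<close>

definition mlin :: "('r, 'a) ring_scheme \<Rightarrow> ('r, 'm, 'b) module_scheme \<Rightarrow> ('r, 'n, 'c) module_scheme \<Rightarrow> ('m \<Rightarrow> 'n) \<Rightarrow> bool" where
  "mlin R M N f \<longleftrightarrow> f \<in> carrier M \<rightarrow> carrier N \<and>
     (\<forall>x\<in>carrier M. \<forall>y\<in>carrier M. f (x \<oplus>\<^bsub>M\<^esub> y) = f x \<oplus>\<^bsub>N\<^esub> f y) \<and>
     (\<forall>a\<in>carrier R. \<forall>x\<in>carrier M. f (a \<odot>\<^bsub>M\<^esub> x) = a \<odot>\<^bsub>N\<^esub> f x)"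

lemma mlinI:
  assumes "\<And>x. x \<in> carrier M \<Longrightarrow> f x \<in> carrier N"
    and "\<And>x y. x \<in> carrier M \<Longrightarrow> y \<in> carrier M \<Longrightarrow> f (x \<oplus>\<^bsub>M\<^esub> y) = f x \<oplus>\<^bsub>N\<^esub> f y"
    and "\<And>a x. a \<in> carrier R \<Longrightarrow> x \<in> carrier M \<Longrightarrow> f (a \<odot>\<^bsub>M\<^esub> x) = a \<odot>\<^bsub>N\<^esub> f x"
  shows "mlin R M N f"
  using assms by (auto simp: mlin_def)

lemma mlin_closed: "mlin R M N f \<Longrightarrow> x \<in> carrier M \<Longrightarrow> f x \<in> carrier N"
  by (auto simp: mlin_def)

lemma mlin_add: "mlin R M N f \<Longrightarrow> x \<in> carrier M \<Longrightarrow> y \<in> carrier M \<Longrightarrow> f (x \<oplus>\<^bsub>M\<^esub> y) = f x \<oplus>\<^bsub>N\<^esub> f y"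
  by (auto simp: mlin_def)

lemma mlin_smult: "mlin R M N f \<Longrightarrow> a \<in> carrier R \<Longrightarrow> x \<in> carrier M \<Longrightarrow> f (a \<odot>\<^bsub>M\<^esub> x) = a \<odot>\<^bsub>N\<^esub> f x"
  by (auto simp: mlin_def)

lemma module_hom_iff: "f \<in> module_hom R M N \<longleftrightarrow> mlin R M N f \<and> f \<in> extensional (carrier M)"
  by (auto simp: module_hom_def mlin_def PiE_def)

lemma mlin_cong:
  assumes "module R M" "\<And>x. x \<in> carrier M \<Longrightarrow> f x = g x" "mlin R M N g"
  shows "mlin R M N f"
proof -
  interpret module R M by fact
  show ?thesis using assms(2,3) by (auto simp: mlin_def)
qed

lemma mlin_compose: "mlin R M N f \<Longrightarrow> mlin R N P g \<Longrightarrow> mlin R M P (\<lambda>x. g (f x))"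
  by (auto simp: mlin_def Pi_iff)

lemma restrict_module_hom:
  assumes "module R M" "mlin R M N f" shows "restrict f (carrier M) \<in> module_hom R M N"
  using mlin_cong[OF assms(1) _ assms(2), of "restrict f (carrier M)"] by (simp add: module_hom_iff)

lemma mlin_zero_const: "module R N \<Longrightarrow> mlin R M N (\<lambda>_. \<zero>\<^bsub>N\<^esub>)"
  by (rule mlinI) (auto simp: module.smult_r_null module_def abelian_group_def abelian_monoid.zero_closed abelian_monoid.l_zero)

locale module_pair = dom: module R M + cod: module R N for R M N
begin

context
  fixes f assumes f: "mlin R M N f"
begin

lemma mlin_zero: "f \<zero>\<^bsub>M\<^esub> = \<zero>\<^bsub>N\<^esub>"
  using mlin_smult[OF f, of "\<zero>\<^bsub>R\<^esub>" "\<zero>\<^bsub>M\<^esub>"] mlin_closed[OF f, of "\<zero>\<^bsub>M\<^esub>"] by simp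

lemma mlin_neg: "x \<in> carrier M \<Longrightarrow> f (\<ominus>\<^bsub>M\<^esub> x) = \<ominus>\<^bsub>N\<^esub> f x"
  using mlin_smult[OF f, of "\<ominus>\<^bsub>R\<^esub> \<one>\<^bsub>R\<^esub>" x] mlin_closed[OF f, of x]
  by (simp add: dom.smult_l_minus cod.smult_l_minus)

lemma mlin_diff: "x \<in> carrier M \<Longrightarrow> y \<in> carrier M \<Longrightarrow> f (x \<ominus>\<^bsub>M\<^esub> y) = f x \<ominus>\<^bsub>N\<^esub> f y"
  by (simp add: dom.M.minus_eq cod.M.minus_eq mlin_add[OF f] mlin_neg)

lemma mlin_image_submodule:
  assumes H: "submodule H R M" shows "submodule (f ` H) R N"
proof (rule cod.submodule_subI)
  have HM: "x \<in> carrier M" if "x \<in> H" for x using dom.submodule_carrier[OF H that] .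
  show "f ` H \<subseteq> carrier N" using HM mlin_closed[OF f] by auto
  show "\<zero>\<^bsub>N\<^esub> \<in> f ` H" using mlin_zero dom.submodule_zero[OF H] by force
  show "x \<oplus>\<^bsub>N\<^esub> y \<in> f ` H" if "x \<in> f ` H" "y \<in> f ` H" for x y
    using that HM mlin_add[OF f, symmetric] dom.submoduleE(5)[OF H] by auto
  show "a \<odot>\<^bsub>N\<^esub> x \<in> f ` H" if "a \<in> carrier R" "x \<in> f ` H" for a x
    using that HM mlin_smult[OF f, symmetric] dom.submoduleE(4)[OF H] by auto
qed

lemma mlin_preimage_submodule:
  assumes H: "submodule H R N" shows "submodule {x \<in> carrier M. f x \<in> H} R M"
  by (rule dom.submodule_subI)
    (use mlin_add[OF f] mlin_smult[OF f] mlin_zero cod.submodule_zero[OF H]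
      cod.submoduleE(4,5)[OF H] in auto)

end

lemma mlin_sum:
  assumes "mlin R M N f" "mlin R M N g" shows "mlin R M N (\<lambda>x. f x \<oplus>\<^bsub>N\<^esub> g x)"
  by (rule mlinI) (use assms[THEN mlin_closed] assms[THEN mlin_add] assms[THEN mlin_smult] in
    \<open>auto simp: cod.add_add_add cod.smult_r_distr\<close>)

lemma mlin_scale:
  assumes "a \<in> carrier R" "mlin R M N f" shows "mlin R M N (\<lambda>x. a \<odot>\<^bsub>N\<^esub> f x)"
  by (rule mlinI) (use assms mlin_closed[OF assms(2)] mlin_add[OF assms(2)] mlin_smult[OF assms(2)] in
    \<open>auto simp: cod.smult_r_distr cod.smult_commute[of a]\<close>)

lemma mlin_minus:
  assumes "mlin R M N f" "mlin R M N g" shows "mlin R M N (\<lambda>x. f x \<ominus>\<^bsub>N\<^esub> g x)"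
proof (rule mlin_cong[OF dom.module_axioms])
  show "mlin R M N (\<lambda>x. f x \<oplus>\<^bsub>N\<^esub> (\<ominus>\<^bsub>R\<^esub> \<one>\<^bsub>R\<^esub>) \<odot>\<^bsub>N\<^esub> g x)"
    by (intro mlin_sum mlin_scale assms) simp
  show "f x \<ominus>\<^bsub>N\<^esub> g x = f x \<oplus>\<^bsub>N\<^esub> (\<ominus>\<^bsub>R\<^esub> \<one>\<^bsub>R\<^esub>) \<odot>\<^bsub>N\<^esub> g x" if "x \<in> carrier M" for x
    using mlin_closed[OF assms(2) that] by (simp add: cod.smult_l_minus cod.M.minus_eq)
qed

end

text \<open>The universal property of \<open>M\<close> as a quotient of \<open>P\<close>:
  \<open>f\<close> is constant on the fibres of \<open>e\<close>, so every choice of preimages gives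
  the same linear map.\<close>

lemma mlin_factor:
  assumes P: "module R P" and M: "module R M" and N: "module R N"
    and e: "mlin R P M e" and e_surj: "e ` carrier P = carrier M" and f: "mlin R P N f"
    and f0: "\<And>x. x \<in> carrier P \<Longrightarrow> e x = \<zero>\<^bsub>M\<^esub> \<Longrightarrow> f x = \<zero>\<^bsub>N\<^esub>"
  obtains h where "mlin R M N h" "\<And>x. x \<in> carrier P \<Longrightarrow> h (e x) = f x"
proof -
  interpret P: module R P by fact
  interpret M: module R M by fact
  interpret N: module R N by fact
  interpret PM: module_pair R P M by unfold_locales
  interpret PN: module_pair R P N by unfold_locales
  have eq: "f x = f y" if xy: "x \<in> carrier P" "y \<in> carrier P" "e x = e y" for x y
  proof (rule N.diff_eq_zeroD)
    have "e (x \<ominus>\<^bsub>P\<^esub> y) = \<zero>\<^bsub>M\<^esub>"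
      using PM.mlin_diff[OF e xy(1,2)] xy(3) mlin_closed[OF e xy(2)] by (simp add: M.M.minus_eq M.M.r_neg)
    then show "f x \<ominus>\<^bsub>N\<^esub> f y = \<zero>\<^bsub>N\<^esub>"
      using f0[OF P.M.minus_closed[OF xy(1,2)]] PN.mlin_diff[OF f xy(1,2)] by simp
  qed (use mlin_closed[OF f] xy in auto)
  define h where "h = (\<lambda>m. f (inv_into (carrier P) e m))"
  have he: "h (e x) = f x" if "x \<in> carrier P" for x
    unfolding h_def using that by (intro eq) (auto simp: inv_into_into f_inv_into_f)
  have "mlin R M N h"
  proof (rule mlinI)
    fix m assume "m \<in> carrier M"
    then obtain x where x: "x \<in> carrier P" "m = e x" using e_surj by blast
    then show "h m \<in> carrier N" using he mlin_closed[OF f] by simp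
    show "h (a \<odot>\<^bsub>M\<^esub> m) = a \<odot>\<^bsub>N\<^esub> h m" if a: "a \<in> carrier R" for a
      using he[OF x(1)] he[OF P.smult_closed[OF a x(1)]] mlin_smult[OF e a x(1)]
        mlin_smult[OF f a x(1)] x(2) by simp
    show "h (m \<oplus>\<^bsub>M\<^esub> m') = h m \<oplus>\<^bsub>N\<^esub> h m'" if m': "m' \<in> carrier M" for m'
    proof -
      obtain y where y: "y \<in> carrier P" "m' = e y" using m' e_surj by blast
      show ?thesis
        using he[OF x(1)] he[OF y(1)] he[OF P.M.a_closed[OF x(1) y(1)]] mlin_add[OF e x(1) y(1)]
          mlin_add[OF f x(1) y(1)] x(2) y(2) by simp
    qed
  qed
  then show thesis using that he by blast
qed

section \<open>Powers of a module and linear combinations\<close>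

lemma module_power_simps:
  "carrier (module_power M n) = {..<n} \<rightarrow>\<^sub>E carrier M"
  "\<zero>\<^bsub>module_power M n\<^esub> = (\<lambda>i\<in>{..<n}. \<zero>\<^bsub>M\<^esub>)"
  "x \<oplus>\<^bsub>module_power M n\<^esub> y = (\<lambda>i\<in>{..<n}. x i \<oplus>\<^bsub>M\<^esub> y i)"
  "a \<odot>\<^bsub>module_power M n\<^esub> x = (\<lambda>i\<in>{..<n}. a \<odot>\<^bsub>M\<^esub> x i)"
  by (simp_all add: module_power_def)

lemmas module_power_zero = module_power_simps(2)
  and module_power_add = module_power_simps(3)
  and module_power_smult = module_power_simps(4)

declare module_power_simps(1) [simp]

definition single :: "('r, 'm, 'b) module_scheme \<Rightarrow> nat \<Rightarrow> nat \<Rightarrow> 'm \<Rightarrow> nat \<Rightarrow> 'm" where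
  "single M n i a = (\<lambda>j\<in>{..<n}. if j = i then a else \<zero>\<^bsub>M\<^esub>)"

text \<open>The partial sums of the expansion of a vector in its coordinate vectors; they carry the
  induction of \<open>power_induct\<close>.\<close>

definition truncated :: "('r, 'm, 'b) module_scheme \<Rightarrow> nat \<Rightarrow> (nat \<Rightarrow> 'm) \<Rightarrow> nat \<Rightarrow> nat \<Rightarrow> 'm" where
  "truncated M n x k = (\<lambda>j\<in>{..<n}. if j < k then x j else \<zero>\<^bsub>M\<^esub>)"

text \<open>Generators come before coefficients, so that \<open>lincomb M n y\<close> is a map from
  the free module to \<open>M\<close>. The same expression pairs a vector of a power of
  \<open>N\<close> with a relation, which is how \<open>Hom(K, N)\<close> enters.\<close>

definition lincomb :: "('r, 'm, 'b) module_scheme \<Rightarrow> nat \<Rightarrow> (nat \<Rightarrow> 'm) \<Rightarrow> (nat \<Rightarrow> 'r) \<Rightarrow> 'm" where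
  "lincomb M n y x = (\<Oplus>\<^bsub>M\<^esub> i\<in>{..<n}. x i \<odot>\<^bsub>M\<^esub> y i)"

abbreviation "unit_vector R n i \<equiv> single (regular_module R) n i \<one>\<^bsub>R\<^esub>"

context module
begin

lemma module_power_module: "module R (module_power M n)"
proof (rule moduleI)
  show "abelian_group (module_power M n)"
  proof (rule abelian_groupI)
    fix x assume x: "x \<in> carrier (module_power M n)"
    note module_power_simps [simp]
    show "\<exists>y\<in>carrier (module_power M n). y \<oplus>\<^bsub>module_power M n\<^esub> x = \<zero>\<^bsub>module_power M n\<^esub>"
      by (rule bexI[of _ "\<lambda>i\<in>{..<n}. \<ominus>\<^bsub>M\<^esub> x i"])
        (use x in \<open>auto simp: PiE_iff fun_eq_iff M.l_neg\<close>)
    show "\<zero>\<^bsub>module_power M n\<^esub> \<oplus>\<^bsub>module_power M n\<^esub> x = x"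
      using x by (auto simp: PiE_iff fun_eq_iff extensional_def)
  qed (auto simp: module_power_simps PiE_iff fun_eq_iff M.a_ac)
qed (auto simp: module_power_simps R.is_cring PiE_iff fun_eq_iff smult_l_distr smult_r_distr smult_assoc1 extensional_def)

lemma single_closed: "a \<in> carrier M \<Longrightarrow> single M n i a \<in> carrier (module_power M n)"
  by (auto simp: single_def)

lemma truncated_0: "truncated M n x 0 = \<zero>\<^bsub>module_power M n\<^esub>"
  by (auto simp: truncated_def module_power_zero)

lemma truncated_all: "x \<in> carrier (module_power M n) \<Longrightarrow> truncated M n x n = x"
  by (auto simp: truncated_def PiE_iff fun_eq_iff extensional_def)

lemma truncated_Suc:
  assumes "x \<in> carrier (module_power M n)" "k < n"
  shows "truncated M n x (Suc k) = single M n k (x k) \<oplus>\<^bsub>module_power M n\<^esub> truncated M n x k"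
  using assms by (auto simp: truncated_def single_def module_power_add PiE_iff fun_eq_iff less_Suc_eq)

text \<open>A vector is the sum of its coordinate vectors. Testing these replaces finite sums in the
  power module.\<close>

lemma power_induct:
  assumes S: "submodule S R (module_power M n)" and x: "x \<in> carrier (module_power M n)"
    and "\<And>i. i < n \<Longrightarrow> single M n i (x i) \<in> S"
  shows "x \<in> S"
proof -
  interpret P: module R "module_power M n" by (rule module_power_module)
  have "k \<le> n \<Longrightarrow> truncated M n x k \<in> S" for k
  proof (induction k)
    case 0
    then show ?case using P.submodule_zero[OF S] unfolding truncated_0 by blast
  next
    case (Suc k)
    then show ?case using assms(3)[of k] truncated_Suc[OF x, of k] P.submoduleE(5)[OF S] by simp
  qed
  then show ?thesis using truncated_all[OF x] by force
qed

lemma power_component_mlin: "i < n \<Longrightarrow> mlin R (module_power M n) M (\<lambda>x. x i)"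
  by (rule mlinI) (auto simp: module_power_simps PiE_iff)

lemma single_mlin: "mlin R M (module_power M n) (single M n i)"
  by (rule mlinI) (auto simp: single_def module_power_simps fun_eq_iff)

lemma power_fin_gen:
  assumes "fin_gen_module R M" shows "fin_gen_module R (module_power M n)"
proof -
  interpret P: module R "module_power M n" by (rule module_power_module)
  obtain A where A: "finite A" "A \<subseteq> carrier M" "mod_span R M A = carrier M"
    using assms by (auto simp: fin_gen_module_def)
  let ?B = "\<Union>i<n. single M n i ` A"
  have B: "?B \<subseteq> carrier (module_power M n)" using A(2) single_closed by blast
  note S = P.span_submodule[OF B]
  have "x \<in> mod_span R (module_power M n) ?B" if x: "x \<in> carrier (module_power M n)" for x
  proof (rule power_induct[OF S x])
    fix i assume i: "i < n"
    interpret MP: module_pair R M "module_power M n" by unfold_locales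
    have "mod_span R M A \<subseteq> {a \<in> carrier M. single M n i a \<in> mod_span R (module_power M n) ?B}"
      by (rule span_least[OF MP.mlin_preimage_submodule[OF single_mlin S]])
        (use A(2) i P.span_superset[of ?B] in blast)
    then show "single M n i (x i) \<in> mod_span R (module_power M n) ?B"
      using A(3) x i by (auto simp: PiE_iff)
  qed
  then have "mod_span R (module_power M n) ?B = carrier (module_power M n)"
    using P.submoduleE(1)[OF S] by blast
  then show ?thesis
    unfolding fin_gen_module_def using A(1) B P.module_axioms by (intro conjI exI[of _ ?B]) auto
qed

lemma lincomb_closed:
  assumes "\<And>i. i < n \<Longrightarrow> y i \<in> carrier M" "x \<in> carrier (free_module R n)"
  shows "lincomb M n y x \<in> carrier M"
  unfolding lincomb_def by (rule M.finsum_closed) (use assms in auto)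

lemma lincomb_mlin:
  assumes y: "\<And>i. i < n \<Longrightarrow> y i \<in> carrier M" shows "mlin R (free_module R n) M (lincomb M n y)"
proof (rule mlinI)
  fix x assume x: "x \<in> carrier (free_module R n)"
  show "lincomb M n y x \<in> carrier M" by (rule lincomb_closed[OF y x])
  show "lincomb M n y (a \<odot>\<^bsub>free_module R n\<^esub> x) = a \<odot>\<^bsub>M\<^esub> lincomb M n y x" if "a \<in> carrier R" for a
    unfolding lincomb_def using x y that
    by (subst finsum_smult_ldistr) (auto simp: module_power_smult PiE_iff smult_assoc1 intro!: M.finsum_cong')
  show "lincomb M n y (x \<oplus>\<^bsub>free_module R n\<^esub> x') = lincomb M n y x \<oplus>\<^bsub>M\<^esub> lincomb M n y x'"
    if "x' \<in> carrier (free_module R n)" for x'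
  proof -
    have "lincomb M n y (x \<oplus>\<^bsub>free_module R n\<^esub> x') = (\<Oplus>\<^bsub>M\<^esub> i\<in>{..<n}. x i \<odot>\<^bsub>M\<^esub> y i \<oplus>\<^bsub>M\<^esub> x' i \<odot>\<^bsub>M\<^esub> y i)"
      unfolding lincomb_def using x y that by (intro M.finsum_cong') (auto simp: module_power_add PiE_iff smult_l_distr)
    also have "\<dots> = lincomb M n y x \<oplus>\<^bsub>M\<^esub> lincomb M n y x'"
      unfolding lincomb_def using x y that by (intro M.finsum_addf) (auto simp: PiE_iff)
    finally show ?thesis .
  qed
qed

lemma lincomb_in_submodule:
  assumes H: "submodule H R M" shows "(\<And>i. i < n \<Longrightarrow> x i \<odot>\<^bsub>M\<^esub> y i \<in> H) \<Longrightarrow> lincomb M n y x \<in> H"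
proof (induction n)
  case 0
  then show ?case by (simp add: lincomb_def submodule_zero[OF H])
next
  case (Suc n)
  have "lincomb M (Suc n) y x = x n \<odot>\<^bsub>M\<^esub> y n \<oplus>\<^bsub>M\<^esub> lincomb M n y x"
    unfolding lincomb_def lessThan_Suc using Suc.prems submodule_carrier[OF H]
    by (subst M.finsum_insert) auto
  then show ?case using Suc submoduleE(5)[OF H] by simp
qed

lemma unit_vector_closed: "unit_vector R n i \<in> carrier (free_module R n)"
  by (auto simp: single_def)

lemma lincomb_single:
  assumes y: "\<And>i. i < n \<Longrightarrow> y i \<in> carrier M" and "i < n" "a \<in> carrier R"
  shows "lincomb M n y (single (regular_module R) n i a) = a \<odot>\<^bsub>M\<^esub> y i"
proof -
  have "lincomb M n y (single (regular_module R) n i a)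
      = (\<Oplus>\<^bsub>M\<^esub> j\<in>{..<n}. if i = j then a \<odot>\<^bsub>M\<^esub> y j else \<zero>\<^bsub>M\<^esub>)"
    unfolding lincomb_def single_def using assms by (intro M.finsum_cong') auto
  also have "\<dots> = a \<odot>\<^bsub>M\<^esub> y i" using assms by (intro M.finsum_singleton) auto
  finally show ?thesis .
qed

lemma lincomb_unit_vector:
  assumes "\<And>i. i < n \<Longrightarrow> y i \<in> carrier M" "i < n"
  shows "lincomb M n y (unit_vector R n i) = y i"
  using lincomb_single[OF assms R.one_closed] assms by simp

text \<open>The vectors on which \<open>f\<close> and \<open>g\<close> agree modulo \<open>H\<close>
  form a submodule, so unit vectors decide. The congruence form serves for maps into the quotient of
  \<open>M\<close> by \<open>H\<close>; \<open>H = 0\<close> gives equality.\<close>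

lemma mlin_free_eqI:
  assumes f: "mlin R (free_module R n) M f" and g: "mlin R (free_module R n) M g"
    and eq: "\<And>i. i < n \<Longrightarrow> f (unit_vector R n i) \<ominus>\<^bsub>M\<^esub> g (unit_vector R n i) \<in> H"
    and H: "submodule H R M" and x: "x \<in> carrier (free_module R n)"
  shows "f x \<ominus>\<^bsub>M\<^esub> g x \<in> H"
proof -
  interpret RM: module R "regular_module R" by (rule R.regular_module)
  interpret F: module R "free_module R n" by (rule RM.module_power_module)
  interpret FP: module_pair R "free_module R n" M by unfold_locales
  let ?S = "{x \<in> carrier (free_module R n). f x \<ominus>\<^bsub>M\<^esub> g x \<in> H}"
  note fg = FP.mlin_minus[OF f g]
  have S: "submodule ?S R (free_module R n)"
    by (rule FP.mlin_preimage_submodule[OF fg H])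
  have "x \<in> ?S"
  proof (rule RM.power_induct[OF S x])
    fix i assume i: "i < n"
    then have xi: "x i \<in> carrier R" using x by auto
    have "single (regular_module R) n i (x i) = x i \<odot>\<^bsub>free_module R n\<^esub> unit_vector R n i"
      using xi by (auto simp: single_def module_power_smult)
    then show "single (regular_module R) n i (x i) \<in> ?S"
      using F.submoduleE(4)[OF S xi] eq[OF i] unit_vector_closed[of n i] by auto
  qed
  then show ?thesis by simp
qed

lemma mlin_free_lincomb:
  assumes f: "mlin R (free_module R n) M f" and x: "x \<in> carrier (free_module R n)"
  shows "f x = lincomb M n (\<lambda>i. f (unit_vector R n i)) x"
proof (rule diff_eq_zeroD)
  have fc: "f (unit_vector R n i) \<in> carrier M" for i
    using mlin_closed[OF f unit_vector_closed] .
  show "f x \<in> carrier M" "lincomb M n (\<lambda>i. f (unit_vector R n i)) x \<in> carrier M"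
    using mlin_closed[OF f x] lincomb_closed[OF _ x] fc by auto
  have "f x \<ominus>\<^bsub>M\<^esub> lincomb M n (\<lambda>i. f (unit_vector R n i)) x \<in> {\<zero>\<^bsub>M\<^esub>}"
    by (rule mlin_free_eqI[OF f lincomb_mlin _ submodule_zero_singleton x])
      (auto simp: fc lincomb_unit_vector M.minus_eq M.r_neg)
  then show "f x \<ominus>\<^bsub>M\<^esub> lincomb M n (\<lambda>i. f (unit_vector R n i)) x = \<zero>\<^bsub>M\<^esub>" by simp
qed

lemma lincomb_image:
  assumes gc: "\<And>i. i < n \<Longrightarrow> g i \<in> carrier M"
  shows "lincomb M n g ` carrier (free_module R n) = mod_span R M (g ` {..<n})"
proof
  interpret RM: module R "regular_module R" by (rule R.regular_module)
  interpret F: module R "free_module R n" by (rule RM.module_power_module)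
  interpret FP: module_pair R "free_module R n" M by unfold_locales
  have A: "g ` {..<n} \<subseteq> carrier M" using gc by auto
  note I = FP.mlin_image_submodule[OF lincomb_mlin[OF gc] F.carrier_is_submodule]
  show "mod_span R M (g ` {..<n}) \<subseteq> lincomb M n g ` carrier (free_module R n)"
  proof (rule span_least[OF I])
    show "g ` {..<n} \<subseteq> lincomb M n g ` carrier (free_module R n)"
    proof
      fix a assume "a \<in> g ` {..<n}"
      then obtain i where i: "i < n" "a = g i" by auto
      then have "a = lincomb M n g (unit_vector R n i)" using lincomb_unit_vector[OF gc] by simp
      then show "a \<in> lincomb M n g ` carrier (free_module R n)" using unit_vector_closed by (rule image_eqI)
    qed
  qed
  note S = span_submodule[OF A]
  have "lincomb M n g x \<in> mod_span R M (g ` {..<n})" if x: "x \<in> carrier (free_module R n)" for x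
    by (rule lincomb_in_submodule[OF S])
      (use x span_superset[of "g ` {..<n}"] submoduleE(4)[OF S] in \<open>auto simp: PiE_iff\<close>)
  then show "lincomb M n g ` carrier (free_module R n) \<subseteq> mod_span R M (g ` {..<n})" by blast
qed

end

declare module_power_simps(1) [simp del]

lemma (in cring) free_module_module: "module R (free_module R n)"
  by (rule module.module_power_module[OF regular_module])

lemma free_module_noetherian:
  assumes "cring R" "noetherian_ring R" shows "noetherian_module R (free_module R n)"
proof -
  interpret cring R by fact
  show ?thesis
    by (rule fin_gen_module_noetherian[OF assms(2)
      module.power_fin_gen[OF regular_module regular_module_fin_gen]])
qed

lemma (in noetherian_module) submodule_lincomb:
  assumes H: "submodule H R M"
  obtains n g where "\<And>i. i < n \<Longrightarrow> g i \<in> H" "lincomb M n g ` carrier (free_module R n) = H"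
proof -
  obtain A where A: "finite A" "A \<subseteq> H" "mod_span R M A = H" using submodule_fg[OF H] by auto
  then have AM: "A \<subseteq> carrier M" using submodule_carrier[OF H] by auto
  obtain n and g :: "nat \<Rightarrow> 'c" where g: "A = g ` {i. i < n}"
    using finite_imp_nat_seg_image_inj_on[OF A(1)] by metis
  have "lincomb M n g ` carrier (free_module R n) = H"
    using lincomb_image[of n g] AM A(3) unfolding g by (auto simp: lessThan_def)
  moreover have "g i \<in> H" if "i < n" for i using A(2) g that by auto
  ultimately show thesis using that by blast
qed

section \<open>Maps out of free modules\<close>

lemma (in module) mlin_eq_on_unit_vectors:
  assumes "mlin R (free_module R n) M f" "mlin R (free_module R n) M g"
    and "\<And>i. i < n \<Longrightarrow> f (unit_vector R n i) = g (unit_vector R n i)" "x \<in> carrier (free_module R n)"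
  shows "f x = g x"
proof (rule diff_eq_zeroD)
  have "f x \<ominus>\<^bsub>M\<^esub> g x \<in> {\<zero>\<^bsub>M\<^esub>}"
  proof (rule mlin_free_eqI[OF assms(1,2) _ submodule_zero_singleton assms(4)])
    fix i assume "i < n"
    then show "f (unit_vector R n i) \<ominus>\<^bsub>M\<^esub> g (unit_vector R n i) \<in> {\<zero>\<^bsub>M\<^esub>}"
      using assms(3) mlin_closed[OF assms(2) unit_vector_closed] by (simp add: M.minus_eq M.r_neg)
  qed
  then show "f x \<ominus>\<^bsub>M\<^esub> g x = \<zero>\<^bsub>M\<^esub>" by simp
qed (rule mlin_closed[OF assms(1,4)], rule mlin_closed[OF assms(2,4)])

text \<open>Projectivity of a free module: preimages of the values on the unit vectors are extended
  linearly.\<close>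

lemma free_lift:
  assumes P: "module R P" and A: "module R A" and e: "mlin R P A e" "e ` carrier P = carrier A"
    and f: "mlin R (free_module R n) A f"
  obtains \<alpha> where "mlin R (free_module R n) P \<alpha>" "\<And>x. x \<in> carrier (free_module R n) \<Longrightarrow> e (\<alpha> x) = f x"
proof -
  interpret P: module R P by fact
  interpret A: module R A by fact
  have "\<exists>z\<in>carrier P. e z = f (unit_vector R n k)" for k
    using mlin_closed[OF f A.unit_vector_closed] e(2) by (metis imageE)
  then obtain z where z: "\<And>k. z k \<in> carrier P" "\<And>k. e (z k) = f (unit_vector R n k)" by metis
  have \<alpha>: "mlin R (free_module R n) P (lincomb P n z)" by (rule P.lincomb_mlin[OF z(1)])
  have "e (lincomb P n z x) = f x" if x: "x \<in> carrier (free_module R n)" for x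
    by (rule A.mlin_eq_on_unit_vectors[OF mlin_compose[OF \<alpha> e(1)] f _ x])
      (simp add: P.lincomb_unit_vector z)
  then show thesis using that \<alpha> by blast
qed

lemma mlin_lincomb:
  assumes M: "module R M" and N: "module R N" and f: "mlin R M N f"
    and y: "\<And>i. i < n \<Longrightarrow> y i \<in> carrier M" and y': "\<And>i. i < n \<Longrightarrow> y' i = f (y i)"
    and x: "x \<in> carrier (free_module R n)"
  shows "f (lincomb M n y x) = lincomb N n y' x"
proof -
  interpret M: module R M by fact
  interpret N: module R N by fact
  have y'c: "y' i \<in> carrier N" if "i < n" for i using y' y mlin_closed[OF f] that by simp
  have lc: "mlin R (free_module R n) M (lincomb M n y)" "mlin R (free_module R n) N (lincomb N n y')"
    using M.lincomb_mlin[OF y] N.lincomb_mlin[OF y'c] by simp_all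
  show ?thesis
  proof (rule N.mlin_eq_on_unit_vectors[OF mlin_compose[OF lc(1) f] lc(2) _ x])
    fix i assume i: "i < n"
    show "f (lincomb M n y (unit_vector R n i)) = lincomb N n y' (unit_vector R n i)"
      using M.lincomb_unit_vector[of n y i] N.lincomb_unit_vector[of n y' i] y y'c y'[OF i] i by metis
  qed
qed

lemma (in module) lincomb_single_right:
  assumes i: "i < n" and v: "v \<in> carrier M" and x: "x \<in> carrier (free_module R n)"
  shows "lincomb M n (single M n i v) x = x i \<odot>\<^bsub>M\<^esub> v"
proof -
  have xc: "x j \<in> carrier R" if "j < n" for j using x that by (auto simp: module_power_simps(1))
  have "lincomb M n (single M n i v) x = (\<Oplus>\<^bsub>M\<^esub> j\<in>{..<n}. if i = j then x j \<odot>\<^bsub>M\<^esub> v else \<zero>\<^bsub>M\<^esub>)"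
    unfolding lincomb_def single_def using v xc by (intro M.finsum_cong') auto
  also have "\<dots> = x i \<odot>\<^bsub>M\<^esub> v" using i v xc by (intro M.finsum_singleton) auto
  finally show ?thesis .
qed

text \<open>Both sides are \<open>P\<close> modulo the same kernel. Only \<open>P\<close> is assumed
  to be a module, so quotients and powers of quotients can be compared without verifying the module
  axioms for them.\<close>

lemma isomorphic_if_common_cover:
  assumes P: "module R P" and c: "mlin R P A c" "c ` carrier P = carrier A"
    and k: "mlin R P B k" "k ` carrier P = carrier B"
    and eq: "\<And>x y. x \<in> carrier P \<Longrightarrow> y \<in> carrier P \<Longrightarrow> c x = c y \<longleftrightarrow> k x = k y"
  shows "module_isomorphic R A B"
proof -
  interpret P: module R P by fact
  define f where "f = restrict (\<lambda>z. k (inv_into (carrier P) c z)) (carrier A)"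
  have fc: "f (c x) = k x" if x: "x \<in> carrier P" for x
  proof -
    have "c x \<in> c ` carrier P" using x by blast
    then have "inv_into (carrier P) c (c x) \<in> carrier P" "c (inv_into (carrier P) c (c x)) = c x"
      by (rule inv_into_into, rule f_inv_into_f)
    then show ?thesis using eq x mlin_closed[OF c(1) x] by (simp add: f_def)
  qed
  have cl: "c x \<oplus>\<^bsub>A\<^esub> c y = c (x \<oplus>\<^bsub>P\<^esub> y)" if "x \<in> carrier P" "y \<in> carrier P" for x y
    using mlin_add[OF c(1) that] by simp
  have cs: "a \<odot>\<^bsub>A\<^esub> c x = c (a \<odot>\<^bsub>P\<^esub> x)" if "a \<in> carrier R" "x \<in> carrier P" for a x
    using mlin_smult[OF c(1) that] by simp
  have "f \<in> module_hom R A B"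
    unfolding module_hom_iff
  proof
    show "mlin R A B f"
      by (rule mlinI; (unfold c(2)[symmetric]; elim imageE)?)
        (simp_all add: fc cl cs mlin_closed[OF k(1)] mlin_add[OF k(1)] mlin_smult[OF k(1)])
    show "f \<in> extensional (carrier A)" by (simp add: f_def)
  qed
  moreover have "bij_betw f (carrier A) (carrier B)"
    unfolding bij_betw_def
  proof
    show "inj_on f (carrier A)"
      unfolding c(2)[symmetric] by (rule inj_onI) (auto simp: fc eq)
    show "f ` carrier A = carrier B"
      unfolding c(2)[symmetric] k(2)[symmetric] image_image by (rule image_cong) (simp_all add: fc)
  qed
  ultimately show ?thesis unfolding module_isomorphic_def by blast
qed

section \<open>Free resolutions and the vanishing of Ext\<close>

text \<open>The kernel of each differential is finitely generated, hence the image of another finite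
  free module. Dependent choice strings these steps together; a state \<open>(a, b, g)\<close>
  records one differential by its target rank \<open>a\<close>, source rank \<open>b\<close> and
  columns \<open>g\<close>.\<close>

lemma free_resolution_exists:
  assumes "cring R" "noetherian_ring R" "fin_gen_module R M"
  shows "\<exists>n d e. free_resolution R M n d e"
proof -
  interpret R: cring R by fact
  interpret M: noetherian_module R M by (rule fin_gen_module_noetherian[OF assms(2,3)])
  note FM = R.free_module_module
  have FN: "noetherian_module R (free_module R n)" for n
    by (rule free_module_noetherian[OF assms(1,2)])
  have kernel: "submodule {x \<in> carrier (free_module R n). f x = \<zero>\<^bsub>P\<^esub>} R (free_module R n)"
    if P: "module R P" and f: "mlin R (free_module R n) P f" for n f and P :: "('a, 'z, 'y) module_scheme"
  proof -
    interpret P: module R P by fact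
    interpret F: module R "free_module R n" by (rule FM)
    interpret FP: module_pair R "free_module R n" P by unfold_locales
    show ?thesis using FP.mlin_preimage_submodule[OF f P.submodule_zero_singleton] by simp
  qed
  obtain n0 g where g: "\<And>i. i < n0 \<Longrightarrow> g i \<in> carrier M"
    "lincomb M n0 g ` carrier (free_module R n0) = carrier M"
    using M.submodule_lincomb[OF M.carrier_is_submodule] by metis
  define e where "e = restrict (lincomb M n0 g) (carrier (free_module R n0))"
  have e: "e \<in> module_hom R (free_module R n0) M"
    unfolding e_def by (rule restrict_module_hom[OF FM M.lincomb_mlin[OF g(1)]])
  define lc where "lc = (\<lambda>(a, b, g). restrict (lincomb (free_module R a) b g) (carrier (free_module R b)))"
  \<comment> \<open>\<open>?P\<close> ties the initial state to the kernel of the augmentation,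
    \<open>?Q\<close> is exactness between consecutive differentials.\<close>
  let ?P = "\<lambda>i (a, b, g). (\<forall>j<b. g j \<in> carrier (free_module R a)) \<and>
    (i = (0::nat) \<longrightarrow> a = n0 \<and> lc (a, b, g) ` carrier (free_module R b)
       = {x \<in> carrier (free_module R n0). e x = \<zero>\<^bsub>M\<^esub>})"
  let ?Q = "\<lambda>(i::nat) (a, b, g) (a', b', g'). a' = b \<and>
    lc (a', b', g') ` carrier (free_module R b')
      = {x \<in> carrier (free_module R b). lc (a, b, g) x = \<zero>\<^bsub>free_module R a\<^esub>}"
  have next_step: "\<exists>b g. (\<forall>j<b. g j \<in> carrier (free_module R a)) \<and>
      lc (a, b, g) ` carrier (free_module R b) = H"
    if H: "submodule H R (free_module R a)" for a H
  proof -
    interpret F: noetherian_module R "free_module R a" by (rule FN)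
    obtain b g where "\<And>i. i < b \<Longrightarrow> g i \<in> H"
      "lincomb (free_module R a) b g ` carrier (free_module R b) = H"
      using F.submodule_lincomb[OF H] by metis
    then show ?thesis using F.submodule_carrier[OF H] unfolding lc_def
      by (intro exI[of _ b] exI[of _ g]) simp
  qed
  have lc_hom: "lc (a, b, g) \<in> module_hom R (free_module R b) (free_module R a)"
    if "\<forall>j<b. g j \<in> carrier (free_module R a)" for a b g
    unfolding lc_def case_prod_conv
    by (rule restrict_module_hom[OF FM module.lincomb_mlin[OF FM]]) (use that in simp)
  have "\<exists>st. \<forall>i. ?P i (st i) \<and> ?Q i (st i) (st (Suc i))"
  proof (rule dependent_nat_choice)
    have "submodule {x \<in> carrier (free_module R n0). e x = \<zero>\<^bsub>M\<^esub>} R (free_module R n0)"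
      by (rule kernel[OF M.module_axioms]) (use e in \<open>simp add: module_hom_iff\<close>)
    from next_step[OF this] show "\<exists>x. ?P 0 x" by auto
  next
    fix x i assume P: "?P i x"
    obtain a b g where x: "x = (a, b, g)" by (cases x) auto
    have "submodule {x \<in> carrier (free_module R b). lc (a, b, g) x = \<zero>\<^bsub>free_module R a\<^esub>} R (free_module R b)"
      by (rule kernel[OF FM]) (use lc_hom P x in \<open>simp add: module_hom_iff\<close>)
    from next_step[OF this] show "\<exists>y. ?P (Suc i) y \<and> ?Q i x y" unfolding x by auto
  qed
  then obtain st where st_all: "\<forall>i. ?P i (st i) \<and> ?Q i (st i) (st (Suc i))" by (rule exE)
  have st: "?P i (st i)" "?Q i (st i) (st (Suc i))" for i
    using spec[OF st_all, of i] by (rule conjunct1, rule conjunct2)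
  define n b gs where "n = (\<lambda>i. fst (st i))" and "b = (\<lambda>i. fst (snd (st i)))" and "gs = (\<lambda>i. snd (snd (st i)))"
  have stq: "st = (\<lambda>i. (n i, b i, gs i))" by (simp add: n_def b_def gs_def)
  have closed: "\<forall>j<b i. gs i j \<in> carrier (free_module R (n i))" for i
    using st(1)[of i] unfolding stq case_prod_conv by (rule conjunct1)
  have n0: "n 0 = n0" and ex0: "lc (st 0) ` carrier (free_module R (b 0))
      = {x \<in> carrier (free_module R (n 0)). e x = \<zero>\<^bsub>M\<^esub>}"
    using st(1)[of 0] unfolding stq case_prod_conv by auto
  have nS: "n (Suc i) = b i" for i
    using st(2)[of i] unfolding stq case_prod_conv by (rule conjunct1)
  have exS: "lc (st (Suc i)) ` carrier (free_module R (b (Suc i)))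
      = {x \<in> carrier (free_module R (b i)). lc (st i) x = \<zero>\<^bsub>free_module R (n i)\<^esub>}" for i
    using st(2)[of i] unfolding stq case_prod_conv by (rule conjunct2)
  define d where "d = (\<lambda>i. lc (st i))"
  have dh: "d i \<in> module_hom R (free_module R (n (Suc i))) (free_module R (n i))" for i
    using lc_hom[OF closed[of i]] unfolding nS[symmetric] d_def stq .
  have dst: "lc (st i) = d i" for i by (simp add: d_def)
  note ex = ex0[folded nS, unfolded dst] exS[folded nS, unfolded dst]
  have "e ` carrier (free_module R n0) = carrier M" using g(2) by (simp add: e_def)
  then have "free_resolution R M n d e"
    unfolding free_resolution_def a_kernel_def'
    using dh e ex n0 by simp
  then show ?thesis by blast
qed

text \<open>If the quotient has one element, the coset of \<open>f\<close> is \<open>B\<close>; and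
  \<open>z\<close>, which acts as a zero on \<open>f\<close>, shows that \<open>f\<close> belongs to
  its own coset.\<close>

lemma (in module) module_quotient_trivialD:
  assumes "carrier (module_quotient (L\<lparr>carrier := C\<rparr>) B) = {\<zero>\<^bsub>module_quotient (L\<lparr>carrier := C\<rparr>) B\<^esub>}"
    and "f \<in> C" "z \<in> B" "z \<oplus>\<^bsub>L\<^esub> f = f"
  shows "f \<in> B"
proof -
  have "a_rcosets\<^bsub>L\<lparr>carrier := C\<rparr>\<^esub> B = {B}" using assms(1) by (simp add: module_quotient_def)
  moreover have "(\<Union>h\<in>B. {h \<oplus>\<^bsub>L\<^esub> f}) \<in> a_rcosets\<^bsub>L\<lparr>carrier := C\<rparr>\<^esub> B"
    unfolding A_RCOSETS_def RCOSETS_def r_coset_def using assms(2) by force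
  ultimately have B: "(\<Union>h\<in>B. {h \<oplus>\<^bsub>L\<^esub> f}) = B" by (simp only: singleton_iff)
  have "z \<oplus>\<^bsub>L\<^esub> f \<in> (\<Union>h\<in>B. {h \<oplus>\<^bsub>L\<^esub> f})" using assms(3) by blast
  then show ?thesis unfolding B assms(4) .
qed

locale resolved_pair = module_pair R M N for R M N +
  fixes n d e
  assumes res: "free_resolution R M n d e"
begin

abbreviation "F i \<equiv> free_module R (n i)"

lemma d_lin: "mlin R (F (Suc i)) (F i) (d i)" and e_lin: "mlin R (F 0) M e"
  using res by (auto simp: free_resolution_def module_hom_iff)

lemma e_surj: "e ` carrier (F 0) = carrier M" using res by (simp add: free_resolution_def)

lemma exact_0: "{x \<in> carrier (F 0). e x = \<zero>\<^bsub>M\<^esub>} = d 0 ` carrier (F (Suc 0))"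
  using res by (simp add: free_resolution_def a_kernel_def')

lemma e_d: "x \<in> carrier (F (Suc 0)) \<Longrightarrow> e (d 0 x) = \<zero>\<^bsub>M\<^esub>"
  using subsetD[OF equalityD2[OF exact_0] imageI[of x]] by simp

lemma d_d:
  assumes "x \<in> carrier (F (Suc (Suc i)))" shows "d i (d (Suc i) x) = \<zero>\<^bsub>F i\<^esub>"
proof -
  have "d (Suc i) x \<in> a_kernel (F (Suc i)) (F i) (d i)"
    using res assms unfolding free_resolution_def by blast
  then show ?thesis by (simp add: a_kernel_def')
qed

text \<open>Exactness of \<open>Hom(F, N)\<close> in degree \<open>Suc i\<close>, that is
  Ext^(i+1)(M, N) = 0: the index is shifted by one. Cocycles are taken as linear maps, without
  extensionality.\<close>

definition Ext_zero :: "nat \<Rightarrow> bool" where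
  "Ext_zero i \<longleftrightarrow> (\<forall>f. mlin R (F (Suc i)) N f \<longrightarrow> (\<forall>x\<in>carrier (F (Suc (Suc i))). f (d (Suc i) x) = \<zero>\<^bsub>N\<^esub>)
     \<longrightarrow> (\<exists>f'. mlin R (F i) N f' \<and> (\<forall>x\<in>carrier (F (Suc i)). f x = f' (d i x))))"

sublocale fm: module R "F i" for i by (rule dom.R.free_module_module)
sublocale fN: module_pair R "F i" N for i by unfold_locales

lemma Ext_zeroI:
  assumes z: "carrier (module_quotient ((Hom_module R (F (Suc i)) N)\<lparr>carrier := cocycles R n d N (Suc i)\<rparr>)
      (coboundaries R n d N (Suc i)))
    = {\<zero>\<^bsub>module_quotient ((Hom_module R (F (Suc i)) N)\<lparr>carrier := cocycles R n d N (Suc i)\<rparr>)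
      (coboundaries R n d N (Suc i))\<^esub>}"
  shows "Ext_zero i"
  unfolding Ext_zero_def
proof (intro allI impI)
  fix f assume f: "mlin R (F (Suc i)) N f" and f0: "\<forall>x\<in>carrier (F (Suc (Suc i))). f (d (Suc i) x) = \<zero>\<^bsub>N\<^esub>"
  let ?f = "restrict f (carrier (F (Suc i)))"
  let ?z = "\<lambda>x\<in>carrier (F (Suc i)). \<zero>\<^bsub>N\<^esub>"
  have fh: "?f \<in> module_hom R (F (Suc i)) N" by (rule restrict_module_hom[OF fm.module_axioms f])
  have dc: "d j x \<in> carrier (F j)" if "x \<in> carrier (F (Suc j))" for j x
    using mlin_closed[OF d_lin that] .
  have 1: "?f \<in> cocycles R n d N (Suc i)"
    using fh f0 dc[of _ "Suc i"]
    by (simp add: cocycles_def Hom_module_def compose_def fun_eq_iff restrict_def)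
  have "restrict (\<lambda>_. \<zero>\<^bsub>N\<^esub>) (carrier (F i)) \<in> module_hom R (F i) N"
    by (rule restrict_module_hom[OF fm.module_axioms mlin_zero_const[OF cod.module_axioms]])
  moreover have "?z = compose (carrier (F (Suc i))) (restrict (\<lambda>_. \<zero>\<^bsub>N\<^esub>) (carrier (F i))) (d i)"
    using dc[of _ i] by (simp add: compose_def fun_eq_iff restrict_def)
  ultimately have 2: "?z \<in> coboundaries R n d N (Suc i)" by (simp add: coboundaries_def)
  have 3: "?z \<oplus>\<^bsub>Hom_module R (F (Suc i)) N\<^esub> ?f = ?f"
    using mlin_closed[OF f] by (simp add: Hom_module_def fun_eq_iff restrict_def)
  have "?f \<in> coboundaries R n d N (Suc i)"
    by (rule dom.module_quotient_trivialD[OF z 1 2 3])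
  then obtain f' where f': "f' \<in> module_hom R (F i) N" "?f = compose (carrier (F (Suc i))) f' (d i)"
    by (auto simp: coboundaries_def)
  have "f x = f' (d i x)" if "x \<in> carrier (F (Suc i))" for x
    using fun_cong[OF f'(2), of x] that by (simp add: compose_def)
  then show "\<exists>f'. mlin R (F i) N f' \<and> (\<forall>x\<in>carrier (F (Suc i)). f x = f' (d i x))"
    using f'(1) by (auto simp: module_hom_iff)
qed

text \<open>Left exactness of Hom: homomorphisms on \<open>M\<close> are encoded as maps on
  \<open>F 0\<close> that kill boundaries, and this turns the code back into a map on
  \<open>M\<close>.\<close>

lemma descend:
  assumes f: "mlin R (F 0) N f" and f0: "\<And>y. y \<in> carrier (F (Suc 0)) \<Longrightarrow> f (d 0 y) = \<zero>\<^bsub>N\<^esub>"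
  obtains h where "mlin R M N h" "\<And>x. x \<in> carrier (F 0) \<Longrightarrow> h (e x) = f x"
proof -
  have "f x = \<zero>\<^bsub>N\<^esub>" if "x \<in> carrier (F 0)" "e x = \<zero>\<^bsub>M\<^esub>" for x
    using equalityD1[OF exact_0] that f0 by auto
  then show thesis
    using mlin_factor[OF fm.module_axioms dom.module_axioms cod.module_axioms e_lin e_surj f] that by blast
qed

end

text \<open>The choice hidden in \<open>Ext\<close> does not depend on the degree, so a single
  resolution serves all the vanishing hypotheses.\<close>

lemma Ext_resolution:
  assumes "cring R" "noetherian_ring R" "fin_gen_module R M" "module R N"
  obtains n d e where "resolved_pair R M N n d e"
    "\<And>i. carrier (Ext R M N (Suc i)) = {\<zero>\<^bsub>Ext R M N (Suc i)\<^esub>} \<Longrightarrow> resolved_pair.Ext_zero R N n d i"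
proof -
  define c where "c = (SOME (n, d, e). free_resolution R M n d e)"
  obtain n d e where c: "c = (n, d, e)" by (cases c) auto
  have "\<exists>c. (\<lambda>(n, d, e). free_resolution R M n d e) c"
    using free_resolution_exists[OF assms(1-3)] by auto
  then have "(\<lambda>(n, d, e). free_resolution R M n d e) c" unfolding c_def by (rule someI_ex)
  then have fr: "free_resolution R M n d e" by (simp add: c)
  have M: "module R M" using assms(3) by (simp add: fin_gen_module_def)
  interpret resolved_pair R M N n d e
    using M assms(4) fr by (intro resolved_pair.intro module_pair.intro resolved_pair_axioms.intro)
  have "Ext_zero i" if z: "carrier (Ext R M N (Suc i)) = {\<zero>\<^bsub>Ext R M N (Suc i)\<^esub>}" for i
  proof (rule Ext_zeroI)
    have "Ext R M N (Suc i) = module_quotient ((Hom_module R (F (Suc i)) N)\<lparr>carrier := cocycles R n d N (Suc i)\<rparr>)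
        (coboundaries R n d N (Suc i))"
      unfolding Ext_def c_def[symmetric] c by simp
    with z show "carrier (module_quotient ((Hom_module R (F (Suc i)) N)\<lparr>carrier := cocycles R n d N (Suc i)\<rparr>)
      (coboundaries R n d N (Suc i)))
    = {\<zero>\<^bsub>module_quotient ((Hom_module R (F (Suc i)) N)\<lparr>carrier := cocycles R n d N (Suc i)\<rparr>)
      (coboundaries R n d N (Suc i))\<^esub>}" by simp
  qed
  then show thesis using that resolved_pair_axioms by blast
qed

section \<open>Vanishing of Ext modulo a regular sequence\<close>

text \<open>\<open>H j\<close> plays the role of \<open>(x\<^sub>0, \<dots>, x\<^bsub>j-1\<^esub>) N\<close>.\<close>

definition regular_chain ::
  "('r, 'a) ring_scheme \<Rightarrow> ('r, 'n, 'c) module_scheme \<Rightarrow> nat \<Rightarrow> (nat \<Rightarrow> 'r) \<Rightarrow> (nat \<Rightarrow> 'n set) \<Rightarrow> bool" where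
  "regular_chain R N t x H \<longleftrightarrow> H 0 = {\<zero>\<^bsub>N\<^esub>} \<and>
     (\<forall>j<t. x j \<in> carrier R \<and> H (Suc j) = H j <+>\<^bsub>N\<^esub> {x j \<odot>\<^bsub>N\<^esub> v | v. v \<in> carrier N} \<and>
        (\<forall>v\<in>carrier N. x j \<odot>\<^bsub>N\<^esub> v \<in> H j \<longrightarrow> v \<in> H j))"

lemma (in module) regular_chain_submodule:
  assumes "regular_chain R M t x H" shows "j \<le> t \<Longrightarrow> submodule (H j) R M"
proof (induction j)
  case 0
  then show ?case using assms submodule_zero_singleton by (simp add: regular_chain_def)
next
  case (Suc j)
  then show ?case
    using assms submodule_set_add[OF _ submodule_image] by (simp add: regular_chain_def)
qed

context resolved_pair
begin

context
  fixes t s x H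
  assumes chain: "regular_chain R N t x H" and van: "\<And>i. i < s \<Longrightarrow> Ext_zero i"
begin

lemma H_sub: "j \<le> t \<Longrightarrow> submodule (H j) R N"
  by (rule cod.regular_chain_submodule[OF chain])

lemma x_closed: "j < t \<Longrightarrow> x j \<in> carrier R"
  and H_Suc: "j < t \<Longrightarrow> H (Suc j) = H j <+>\<^bsub>N\<^esub> {x j \<odot>\<^bsub>N\<^esub> v | v. v \<in> carrier N}"
  and H_regular: "j < t \<Longrightarrow> v \<in> carrier N \<Longrightarrow> x j \<odot>\<^bsub>N\<^esub> v \<in> H j \<Longrightarrow> v \<in> H j"
  using chain by (simp_all add: regular_chain_def)

lemma H_0: "H 0 = {\<zero>\<^bsub>N\<^esub>}"
  using chain by (simp add: regular_chain_def)

lemma H_SucI: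
  assumes "j < t" "u \<in> H j" "v \<in> carrier N" "w = u \<oplus>\<^bsub>N\<^esub> x j \<odot>\<^bsub>N\<^esub> v" shows "w \<in> H (Suc j)"
  using assms by (auto simp: H_Suc cod.mem_set_add)

text \<open>Freeness: a decomposition is chosen on each unit vector and extended linearly, so a map
  into \<open>H (Suc j)\<close> is \<open>x j\<close> times a map, modulo
  \<open>H j\<close>.\<close>

lemma split_free:
  assumes j: "j < t" and u: "mlin R (F i) N u" and uH: "\<And>y. y \<in> carrier (F i) \<Longrightarrow> u y \<in> H (Suc j)"
  obtains h where "mlin R (F i) N h" "\<And>y. y \<in> carrier (F i) \<Longrightarrow> u y \<ominus>\<^bsub>N\<^esub> x j \<odot>\<^bsub>N\<^esub> h y \<in> H j"
proof -
  note Hj = H_sub[OF less_imp_le[OF j]]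
  have "\<exists>v\<in>carrier N. u (unit_vector R (n i) k) \<ominus>\<^bsub>N\<^esub> x j \<odot>\<^bsub>N\<^esub> v \<in> H j" for k
  proof -
    have "u (unit_vector R (n i) k) \<in> H (Suc j)" by (rule uH[OF cod.unit_vector_closed])
    then obtain a v where av: "a \<in> H j" "v \<in> carrier N" "u (unit_vector R (n i) k) = a \<oplus>\<^bsub>N\<^esub> x j \<odot>\<^bsub>N\<^esub> v"
      by (auto simp: H_Suc[OF j] cod.mem_set_add)
    then have "u (unit_vector R (n i) k) \<ominus>\<^bsub>N\<^esub> x j \<odot>\<^bsub>N\<^esub> v = a"
      using cod.submodule_carrier[OF Hj av(1)] x_closed[OF j]
      by (simp add: cod.M.minus_eq cod.M.a_assoc cod.M.r_neg)
    then show ?thesis using av(1,2) by (intro bexI[of _ v]) simp_all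
  qed
  then obtain v where v: "\<And>k. v k \<in> carrier N"
    "\<And>k. u (unit_vector R (n i) k) \<ominus>\<^bsub>N\<^esub> x j \<odot>\<^bsub>N\<^esub> v k \<in> H j" by metis
  have h: "mlin R (F i) N (lincomb N (n i) v)" by (rule cod.lincomb_mlin[OF v(1)])
  have "u y \<ominus>\<^bsub>N\<^esub> x j \<odot>\<^bsub>N\<^esub> lincomb N (n i) v y \<in> H j" if y: "y \<in> carrier (F i)" for y
    by (rule cod.mlin_free_eqI[OF u fN.mlin_scale[OF x_closed[OF j] h] _ Hj y])
      (simp add: cod.lincomb_unit_vector v)
  then show thesis using that h by blast
qed

text \<open>Modulo \<open>H j\<close> the value \<open>u y\<close> vanishes and equals
  \<open>x j\<close> times \<open>h y\<close>, and \<open>x j\<close> can be cancelled.\<close>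

lemma regular_descend:
  assumes j: "j < t" and y: "y \<in> carrier (F i)" and h: "mlin R (F i) N h" and u: "mlin R (F i) N u"
    and uy: "u y \<in> H j" and d: "u y \<ominus>\<^bsub>N\<^esub> x j \<odot>\<^bsub>N\<^esub> h y \<in> H j"
  shows "h y \<in> H j"
proof (rule H_regular[OF j mlin_closed[OF h y]])
  note Hj = H_sub[OF less_imp_le[OF j]]
  have c: "u y \<in> carrier N" "x j \<odot>\<^bsub>N\<^esub> h y \<in> carrier N"
    using mlin_closed[OF h y] mlin_closed[OF u y] x_closed[OF j] by auto
  have "u y \<ominus>\<^bsub>N\<^esub> (u y \<ominus>\<^bsub>N\<^esub> x j \<odot>\<^bsub>N\<^esub> h y) = x j \<odot>\<^bsub>N\<^esub> h y"
    using c by (simp add: cod.M.minus_eq cod.M.minus_add cod.M.r_neg2)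
  then show "x j \<odot>\<^bsub>N\<^esub> h y \<in> H j" using cod.submodule_minus[OF Hj uy d] by simp
qed

lemma diff_combine:
  assumes "j < t" "a \<in> carrier N" "h \<in> carrier N" "h' \<in> carrier N"
    and 1: "a \<ominus>\<^bsub>N\<^esub> x j \<odot>\<^bsub>N\<^esub> h \<in> H j" and 2: "h \<ominus>\<^bsub>N\<^esub> h' \<in> H j"
  shows "a \<ominus>\<^bsub>N\<^esub> x j \<odot>\<^bsub>N\<^esub> h' \<in> H j"
proof -
  note Hj = H_sub[OF less_imp_le[OF assms(1)]] and xj = x_closed[OF assms(1)]
  have "a \<ominus>\<^bsub>N\<^esub> x j \<odot>\<^bsub>N\<^esub> h' = (a \<ominus>\<^bsub>N\<^esub> x j \<odot>\<^bsub>N\<^esub> h) \<oplus>\<^bsub>N\<^esub> x j \<odot>\<^bsub>N\<^esub> (h \<ominus>\<^bsub>N\<^esub> h')"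
    using assms xj by (simp add: cod.smult_r_diff) (simp add: cod.M.minus_eq cod.M.a_assoc cod.M.r_neg1 cod.M.l_neg)
  then show ?thesis using cod.submoduleE(5)[OF Hj 1 cod.submoduleE(4)[OF Hj xj 2]] by simp
qed

text \<open>Vanishing of Ext^(i+1)(M, N/H j), by the long exact sequence of 0 -> N/H j -> N/H j ->
  N/H (j+1) -> 0, whose first map is multiplication by \<open>x j\<close>. Each step borrows the
  next higher Ext of the previous quotient, hence the bound \<open>i + j < s\<close>.\<close>

lemma vanish_modulo:
  "j \<le> t \<Longrightarrow> i + j < s \<Longrightarrow> mlin R (F (Suc i)) N g
    \<Longrightarrow> (\<And>y. y \<in> carrier (F (Suc (Suc i))) \<Longrightarrow> g (d (Suc i) y) \<in> H j)
    \<Longrightarrow> \<exists>g'. mlin R (F i) N g' \<and> (\<forall>y\<in>carrier (F (Suc i)). g y \<ominus>\<^bsub>N\<^esub> g' (d i y) \<in> H j)"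
proof (induction j arbitrary: i g)
  case 0
  have "\<forall>y\<in>carrier (F (Suc (Suc i))). g (d (Suc i) y) = \<zero>\<^bsub>N\<^esub>" using 0(4) by (simp add: H_0)
  then obtain g' where g': "mlin R (F i) N g'" "\<forall>y\<in>carrier (F (Suc i)). g y = g' (d i y)"
    using van[of i] 0(2,3) by (auto simp: Ext_zero_def)
  then have "\<forall>y\<in>carrier (F (Suc i)). g y \<ominus>\<^bsub>N\<^esub> g' (d i y) \<in> H 0"
    using mlin_closed[OF 0(3)] by (auto simp: H_0 cod.M.minus_eq cod.M.r_neg)
  with g'(1) show ?case by blast
next
  case (Suc j)
  then have j: "j < t" by simp
  note g = Suc.prems(3) and Hj = H_sub[OF less_imp_le[OF j]] and xj = x_closed[OF j]
  have gd: "mlin R (F (Suc (Suc i))) N (\<lambda>y. g (d (Suc i) y))" by (rule mlin_compose[OF d_lin g])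
  \<comment> \<open>\<open>h\<close> represents the image of the class of \<open>g\<close> under the
    connecting homomorphism.\<close>
  obtain h where h: "mlin R (F (Suc (Suc i))) N h"
    "\<And>y. y \<in> carrier (F (Suc (Suc i))) \<Longrightarrow> g (d (Suc i) y) \<ominus>\<^bsub>N\<^esub> x j \<odot>\<^bsub>N\<^esub> h y \<in> H j"
    using split_free[OF j gd Suc.prems(4)] by blast
  have "h (d (Suc (Suc i)) y) \<in> H j" if y: "y \<in> carrier (F (Suc (Suc (Suc i))))" for y
  proof (rule regular_descend[OF j mlin_closed[OF d_lin y] h(1) gd])
    show "g (d (Suc i) (d (Suc (Suc i)) y)) \<in> H j"
      using d_d[OF y] fN.mlin_zero[OF g] cod.submodule_zero[OF Hj] by simp
  qed (rule h(2)[OF mlin_closed[OF d_lin y]])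
  then obtain h' where h': "mlin R (F (Suc i)) N h'"
    "\<forall>y\<in>carrier (F (Suc (Suc i))). h y \<ominus>\<^bsub>N\<^esub> h' (d (Suc i) y) \<in> H j"
    using Suc.IH[of "Suc i" h] Suc.prems(1,2) h(1) by auto
  \<comment> \<open>Since \<open>h\<close> is a coboundary modulo \<open>H j\<close>, subtracting
    \<open>x j\<close> times a primitive of it makes \<open>g\<close> a cocycle modulo
    \<open>H j\<close> and does not change \<open>g\<close> modulo \<open>H (Suc j)\<close>.\<close>
  let ?g = "\<lambda>y. g y \<ominus>\<^bsub>N\<^esub> x j \<odot>\<^bsub>N\<^esub> h' y"
  have xh': "mlin R (F (Suc i)) N (\<lambda>y. x j \<odot>\<^bsub>N\<^esub> h' y)" by (rule fN.mlin_scale[OF xj h'(1)])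
  have g1: "mlin R (F (Suc i)) N ?g" by (rule fN.mlin_minus[OF g xh'])
  have "?g (d (Suc i) y) \<in> H j" if y: "y \<in> carrier (F (Suc (Suc i)))" for y
  proof -
    have dy: "d (Suc i) y \<in> carrier (F (Suc i))" by (rule mlin_closed[OF d_lin y])
    show ?thesis
      using diff_combine[OF j mlin_closed[OF g dy] mlin_closed[OF h(1) y] mlin_closed[OF h'(1) dy]
          h(2)[OF y]] h'(2) y by blast
  qed
  then obtain g' where g': "mlin R (F i) N g'" "\<forall>y\<in>carrier (F (Suc i)). ?g y \<ominus>\<^bsub>N\<^esub> g' (d i y) \<in> H j"
    using Suc.IH[of i ?g] Suc.prems(1,2) g1 by auto
  have "g y \<ominus>\<^bsub>N\<^esub> g' (d i y) \<in> H (Suc j)" if y: "y \<in> carrier (F (Suc i))" for y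
  proof (rule H_SucI[OF j bspec[OF g'(2) y] mlin_closed[OF h'(1) y]])
    have "g' (d i y) \<in> carrier N" by (rule mlin_closed[OF g'(1) mlin_closed[OF d_lin y]])
    then show "g y \<ominus>\<^bsub>N\<^esub> g' (d i y) = (?g y \<ominus>\<^bsub>N\<^esub> g' (d i y)) \<oplus>\<^bsub>N\<^esub> x j \<odot>\<^bsub>N\<^esub> h' y"
      using mlin_closed[OF g y] mlin_closed[OF xh' y]
      by (simp add: cod.M.minus_eq cod.M.a_assoc)
        (simp add: cod.M.a_comm[of "\<ominus>\<^bsub>N\<^esub> g' (d i y)"] cod.M.a_lcomm[of _ "x j \<odot>\<^bsub>N\<^esub> h' y"] cod.M.r_neg1 cod.M.r_neg2)
  qed
  then show ?case using g'(1) by blast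
qed

text \<open>Surjectivity of Hom(M, N) -> Hom(M, N/H j). The obstruction to lifting through one more
  element is a class in Ext^1 with values in the preceding quotient, killed by
  \<open>vanish_modulo\<close>; the last such quotient has index \<open>j - 1\<close>, so
  \<open>j \<le> s\<close> suffices.\<close>

lemma lift_modulo:
  "j \<le> t \<Longrightarrow> j \<le> s \<Longrightarrow> mlin R (F 0) N g
    \<Longrightarrow> (\<And>y. y \<in> carrier (F (Suc 0)) \<Longrightarrow> g (d 0 y) \<in> H j)
    \<Longrightarrow> \<exists>f. mlin R (F 0) N f \<and> (\<forall>y\<in>carrier (F (Suc 0)). f (d 0 y) = \<zero>\<^bsub>N\<^esub>)
          \<and> (\<forall>y\<in>carrier (F 0). g y \<ominus>\<^bsub>N\<^esub> f y \<in> H j)"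
proof (induction j arbitrary: g)
  case 0
  then show ?case
    using mlin_closed[OF 0(3)] by (intro exI[of _ g]) (auto simp: H_0 cod.M.minus_eq cod.M.r_neg)
next
  case (Suc j)
  then have j: "j < t" by simp
  note g = Suc.prems(3) and Hj = H_sub[OF less_imp_le[OF j]] and xj = x_closed[OF j]
  have gd: "mlin R (F (Suc 0)) N (\<lambda>y. g (d 0 y))" by (rule mlin_compose[OF d_lin g])
  obtain h where h: "mlin R (F (Suc 0)) N h"
    "\<And>y. y \<in> carrier (F (Suc 0)) \<Longrightarrow> g (d 0 y) \<ominus>\<^bsub>N\<^esub> x j \<odot>\<^bsub>N\<^esub> h y \<in> H j"
    using split_free[OF j gd Suc.prems(4)] by blast
  have "h (d (Suc 0) y) \<in> H j" if y: "y \<in> carrier (F (Suc (Suc 0)))" for y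
  proof (rule regular_descend[OF j mlin_closed[OF d_lin y] h(1) gd])
    show "g (d 0 (d (Suc 0) y)) \<in> H j"
      using d_d[OF y] fN.mlin_zero[OF g] cod.submodule_zero[OF Hj] by simp
  qed (rule h(2)[OF mlin_closed[OF d_lin y]])
  then obtain h' where h': "mlin R (F 0) N h'"
    "\<forall>y\<in>carrier (F (Suc 0)). h y \<ominus>\<^bsub>N\<^esub> h' (d 0 y) \<in> H j"
    using vanish_modulo[of j 0 h] Suc.prems(1,2) h(1) by auto
  let ?g = "\<lambda>y. g y \<ominus>\<^bsub>N\<^esub> x j \<odot>\<^bsub>N\<^esub> h' y"
  have xh': "mlin R (F 0) N (\<lambda>y. x j \<odot>\<^bsub>N\<^esub> h' y)" by (rule fN.mlin_scale[OF xj h'(1)])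
  have g1: "mlin R (F 0) N ?g" by (rule fN.mlin_minus[OF g xh'])
  have "?g (d 0 y) \<in> H j" if y: "y \<in> carrier (F (Suc 0))" for y
  proof -
    have dy: "d 0 y \<in> carrier (F 0)" by (rule mlin_closed[OF d_lin y])
    show ?thesis
      using diff_combine[OF j mlin_closed[OF g dy] mlin_closed[OF h(1) y] mlin_closed[OF h'(1) dy]
          h(2)[OF y]] h'(2) y by blast
  qed
  then obtain f where f: "mlin R (F 0) N f" "\<forall>y\<in>carrier (F (Suc 0)). f (d 0 y) = \<zero>\<^bsub>N\<^esub>"
    "\<forall>y\<in>carrier (F 0). ?g y \<ominus>\<^bsub>N\<^esub> f y \<in> H j"
    using Suc.IH[of ?g] Suc.prems(1,2) g1 by auto
  have "g y \<ominus>\<^bsub>N\<^esub> f y \<in> H (Suc j)" if y: "y \<in> carrier (F 0)" for y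
  proof (rule H_SucI[OF j bspec[OF f(3) y] mlin_closed[OF h'(1) y]])
    show "g y \<ominus>\<^bsub>N\<^esub> f y = (?g y \<ominus>\<^bsub>N\<^esub> f y) \<oplus>\<^bsub>N\<^esub> x j \<odot>\<^bsub>N\<^esub> h' y"
      using mlin_closed[OF g y] mlin_closed[OF xh' y] mlin_closed[OF f(1) y]
      by (simp add: cod.M.minus_eq cod.M.a_assoc)
        (simp add: cod.M.a_comm[of "\<ominus>\<^bsub>N\<^esub> f y"] cod.M.a_lcomm[of _ "x j \<odot>\<^bsub>N\<^esub> h' y"] cod.M.r_neg1 cod.M.r_neg2)
  qed
  then show ?case using f(1,2) by blast
qed

text \<open>Linear maps \<open>M \<rightarrow> N\<close>, encoded as maps on \<open>F 0\<close> that kill boundaries, with values in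
  \<open>(x\<^sub>0, \<dots>, x\<^bsub>j-1\<^esub>) N\<close> lie in \<open>(x\<^sub>0, \<dots>, x\<^bsub>j-1\<^esub>) Hom(M, N)\<close>.\<close>

lemma hom_into_regular_chain:
  assumes Q0: "\<And>f. (\<And>y. y \<in> carrier (F 0) \<Longrightarrow> f y = \<zero>\<^bsub>N\<^esub>) \<Longrightarrow> Q f"
    and Q_step: "\<And>i f g g'. i < t \<Longrightarrow> Q f \<Longrightarrow> mlin R (F 0) N g
      \<Longrightarrow> (\<And>y. y \<in> carrier (F (Suc 0)) \<Longrightarrow> g (d 0 y) = \<zero>\<^bsub>N\<^esub>)
      \<Longrightarrow> (\<And>y. y \<in> carrier (F 0) \<Longrightarrow> g' y = f y \<oplus>\<^bsub>N\<^esub> x i \<odot>\<^bsub>N\<^esub> g y) \<Longrightarrow> Q g'"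
  shows "j \<le> t \<Longrightarrow> j \<le> s \<Longrightarrow> mlin R (F 0) N f
    \<Longrightarrow> (\<And>y. y \<in> carrier (F (Suc 0)) \<Longrightarrow> f (d 0 y) = \<zero>\<^bsub>N\<^esub>)
    \<Longrightarrow> (\<And>y. y \<in> carrier (F 0) \<Longrightarrow> f y \<in> H j) \<Longrightarrow> Q f"
proof (induction j arbitrary: f)
  case 0
  then show ?case by (simp add: H_0 Q0)
next
  case (Suc j)
  then have j: "j < t" by simp
  note f = Suc.prems(3) and Hj = H_sub[OF less_imp_le[OF j]] and xj = x_closed[OF j]
  obtain h where h: "mlin R (F 0) N h"
    "\<And>y. y \<in> carrier (F 0) \<Longrightarrow> f y \<ominus>\<^bsub>N\<^esub> x j \<odot>\<^bsub>N\<^esub> h y \<in> H j"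
    using split_free[OF j f Suc.prems(5)] by blast
  have "h (d 0 y) \<in> H j" if y: "y \<in> carrier (F (Suc 0))" for y
  proof (rule regular_descend[OF j mlin_closed[OF d_lin y] h(1) f])
    show "f (d 0 y) \<in> H j"
      using Suc.prems(4)[OF y] cod.submodule_zero[OF Hj] by simp
  qed (rule h(2)[OF mlin_closed[OF d_lin y]])
  \<comment> \<open>\<open>h\<close> kills boundaries only modulo \<open>H j\<close>; it is replaced
    by a true homomorphism \<open>g\<close> congruent to it, which preserves the congruence for
    \<open>f\<close>.\<close>
  then obtain g where g: "mlin R (F 0) N g" "\<forall>y\<in>carrier (F (Suc 0)). g (d 0 y) = \<zero>\<^bsub>N\<^esub>"
    "\<forall>y\<in>carrier (F 0). h y \<ominus>\<^bsub>N\<^esub> g y \<in> H j"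
    using lift_modulo[of j h] Suc.prems(1,2) h(1) by auto
  let ?f = "\<lambda>y. f y \<ominus>\<^bsub>N\<^esub> x j \<odot>\<^bsub>N\<^esub> g y"
  have xg: "mlin R (F 0) N (\<lambda>y. x j \<odot>\<^bsub>N\<^esub> g y)" by (rule fN.mlin_scale[OF xj g(1)])
  have "Q ?f"
  proof (rule Suc.IH)
    show "mlin R (F 0) N ?f" by (rule fN.mlin_minus[OF f xg])
    show "?f (d 0 y) = \<zero>\<^bsub>N\<^esub>" if "y \<in> carrier (F (Suc 0))" for y
      using Suc.prems(4)[OF that] g(2) that xj by (simp add: cod.M.minus_eq)
    show "?f y \<in> H j" if y: "y \<in> carrier (F 0)" for y
      using diff_combine[OF j mlin_closed[OF f y] mlin_closed[OF h(1) y] mlin_closed[OF g(1) y]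
          h(2)[OF y]] g(3) y by blast
  qed (use Suc.prems in auto)
  then show ?case
  proof (rule Q_step[OF j _ g(1)])
    show "g (d 0 y) = \<zero>\<^bsub>N\<^esub>" if "y \<in> carrier (F (Suc 0))" for y using g(2) that by simp
    show "f y = ?f y \<oplus>\<^bsub>N\<^esub> x j \<odot>\<^bsub>N\<^esub> g y" if "y \<in> carrier (F 0)" for y
      using mlin_closed[OF f that] mlin_closed[OF xg that]
      by (simp add: cod.M.minus_eq cod.M.a_assoc cod.M.l_neg)
  qed
qed

end

end

section \<open>Quotients\<close>

context module
begin

lemma mem_coset: "y \<in> H +>\<^bsub>M\<^esub> v \<longleftrightarrow> (\<exists>h\<in>H. y = h \<oplus>\<^bsub>M\<^esub> v)"
  by (auto simp: a_r_coset_def r_coset_def)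

lemma coset_eq_iff:
  assumes H: "submodule H R M" and v: "v \<in> carrier M" and w: "w \<in> carrier M"
  shows "H +>\<^bsub>M\<^esub> v = H +>\<^bsub>M\<^esub> w \<longleftrightarrow> v \<ominus>\<^bsub>M\<^esub> w \<in> H"
proof
  assume eq: "H +>\<^bsub>M\<^esub> v = H +>\<^bsub>M\<^esub> w"
  have "v \<in> H +>\<^bsub>M\<^esub> v" using v submodule_zero[OF H] by (auto simp: mem_coset intro!: bexI[of _ "\<zero>\<^bsub>M\<^esub>"])
  then obtain h where h: "h \<in> H" "v = h \<oplus>\<^bsub>M\<^esub> w" unfolding eq mem_coset by blast
  then have "v \<ominus>\<^bsub>M\<^esub> w = h" using w submodule_carrier[OF H] by (simp add: M.minus_eq M.a_assoc M.r_neg)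
  then show "v \<ominus>\<^bsub>M\<^esub> w \<in> H" using h by simp
next
  assume d: "v \<ominus>\<^bsub>M\<^esub> w \<in> H"
  have "v = (v \<ominus>\<^bsub>M\<^esub> w) \<oplus>\<^bsub>M\<^esub> w" using v w by (simp add: M.minus_eq M.a_assoc M.l_neg)
  then have "v \<in> H +>\<^bsub>M\<^esub> w" using d unfolding mem_coset by blast
  from M.a_repr_independence[OF this w submodule.axioms(1)[OF H]]
  show "H +>\<^bsub>M\<^esub> v = H +>\<^bsub>M\<^esub> w" ..
qed

lemma diff_zero: "v \<in> carrier M \<Longrightarrow> v \<ominus>\<^bsub>M\<^esub> \<zero>\<^bsub>M\<^esub> = v"
  by (metis M.minus_eq M.minus_equality M.l_zero M.r_zero M.zero_closed)

lemma coset_eq_self_iff: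
  assumes H: "submodule H R M" and v: "v \<in> carrier M"
  shows "H +>\<^bsub>M\<^esub> v = H \<longleftrightarrow> v \<in> H"
proof -
  have "H +>\<^bsub>M\<^esub> \<zero>\<^bsub>M\<^esub> = H" by (rule M.a_coset_add_zero[OF submoduleE(1)[OF H]])
  then show ?thesis using coset_eq_iff[OF H v M.zero_closed] diff_zero[OF v] by simp
qed

lemma quotient_carrier: "carrier (module_quotient M H) = (\<lambda>v. H +>\<^bsub>M\<^esub> v) ` carrier M"
  by (auto simp: module_quotient_def A_RCOSETS_def RCOSETS_def a_r_coset_def)

lemma quotient_zero: "\<zero>\<^bsub>module_quotient M H\<^esub> = H"
  by (simp add: module_quotient_def)

lemma quotient_smult:
  assumes H: "submodule H R M" and a: "a \<in> carrier R" and v: "v \<in> carrier M"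
  shows "a \<odot>\<^bsub>module_quotient M H\<^esub> (H +>\<^bsub>M\<^esub> v) = H +>\<^bsub>M\<^esub> (a \<odot>\<^bsub>M\<^esub> v)"
proof -
  have eq: "H +>\<^bsub>M\<^esub> (a \<odot>\<^bsub>M\<^esub> y) = H +>\<^bsub>M\<^esub> (a \<odot>\<^bsub>M\<^esub> v)" if y: "y \<in> H +>\<^bsub>M\<^esub> v" for y
  proof -
    obtain h where h: "h \<in> H" "y = h \<oplus>\<^bsub>M\<^esub> v" using y unfolding mem_coset by blast
    have "a \<odot>\<^bsub>M\<^esub> y \<ominus>\<^bsub>M\<^esub> a \<odot>\<^bsub>M\<^esub> v = a \<odot>\<^bsub>M\<^esub> h"
      using h v a submodule_carrier[OF H] by (simp add: smult_r_distr M.minus_eq M.a_assoc M.r_neg)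
    then show ?thesis
      using coset_eq_iff[OF H] h v a submodule_carrier[OF H] submoduleE(4)[OF H] by simp
  qed
  have "v \<in> H +>\<^bsub>M\<^esub> v" using v submodule_zero[OF H] by (auto simp: mem_coset intro!: bexI[of _ "\<zero>\<^bsub>M\<^esub>"])
  then have ne: "H +>\<^bsub>M\<^esub> v \<noteq> {}" by auto
  have "(\<Union>y\<in>H +>\<^bsub>M\<^esub> v. H +>\<^bsub>M\<^esub> (a \<odot>\<^bsub>M\<^esub> y)) = (\<Union>y\<in>H +>\<^bsub>M\<^esub> v. H +>\<^bsub>M\<^esub> (a \<odot>\<^bsub>M\<^esub> v))"
    by (rule SUP_cong[OF refl eq])
  also have "\<dots> = H +>\<^bsub>M\<^esub> (a \<odot>\<^bsub>M\<^esub> v)" using ne by simp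
  finally show ?thesis by (simp add: module_quotient_def)
qed

lemma quotient_add:
  assumes H: "submodule H R M" and v: "v \<in> carrier M" and w: "w \<in> carrier M"
  shows "(H +>\<^bsub>M\<^esub> v) \<oplus>\<^bsub>module_quotient M H\<^esub> (H +>\<^bsub>M\<^esub> w) = H +>\<^bsub>M\<^esub> (v \<oplus>\<^bsub>M\<^esub> w)"
proof -
  interpret abelian_subgroup H M
    by (rule abelian_subgroupI3[OF additive_subgroupI[OF submodule.axioms(1)[OF H]] M.abelian_group_axioms])
  show ?thesis using a_rcos_sum[OF v w] by (simp add: module_quotient_def)
qed

lemma quotient_regular_iff:
  assumes H: "submodule H R M" and a: "a \<in> carrier R"
  shows "(\<forall>z\<in>carrier (module_quotient M H). a \<odot>\<^bsub>module_quotient M H\<^esub> z = \<zero>\<^bsub>module_quotient M H\<^esub>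
      \<longrightarrow> z = \<zero>\<^bsub>module_quotient M H\<^esub>)
    \<longleftrightarrow> (\<forall>v\<in>carrier M. a \<odot>\<^bsub>M\<^esub> v \<in> H \<longrightarrow> v \<in> H)"
  unfolding quotient_carrier quotient_zero ball_simps
  using a by (simp add: quotient_smult[OF H a] coset_eq_self_iff[OF H])

section \<open>Depth\<close>

lemma ideal_smult_submodule: "I \<subseteq> carrier R \<Longrightarrow> submodule (ideal_smult R I M) R M"
  unfolding ideal_smult_def by (rule span_submodule) (use smult_closed in blast)

lemma ideal_smultI: "a \<in> I \<Longrightarrow> v \<in> carrier M \<Longrightarrow> a \<odot>\<^bsub>M\<^esub> v \<in> ideal_smult R I M"
  unfolding ideal_smult_def by (rule subsetD[OF span_superset]) auto

lemma ideal_smult_least: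
  assumes "submodule H R M" "\<And>a v. a \<in> I \<Longrightarrow> v \<in> carrier M \<Longrightarrow> a \<odot>\<^bsub>M\<^esub> v \<in> H"
  shows "ideal_smult R I M \<subseteq> H"
  unfolding ideal_smult_def by (rule span_least) (use assms in auto)

text \<open>The scalars that carry a fixed \<open>v\<close> into \<open>H\<close> form an ideal, so
  it suffices to test generators.\<close>

lemma ideal_smult_genideal_least:
  assumes H: "submodule H R M" and A: "A \<subseteq> carrier R"
    and AH: "\<And>a v. a \<in> A \<Longrightarrow> v \<in> carrier M \<Longrightarrow> a \<odot>\<^bsub>M\<^esub> v \<in> H"
  shows "ideal_smult R (Idl A) M \<subseteq> H"
proof (rule ideal_smult_least[OF H])
  fix a v assume a: "a \<in> Idl A" and v: "v \<in> carrier M"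
  have "Idl A \<subseteq> colon R M H v"
    by (rule R.genideal_minimal[OF colon_ideal[OF H v]]) (use A AH v in \<open>auto simp: colon_def\<close>)
  then show "a \<odot>\<^bsub>M\<^esub> v \<in> H" using a by (auto simp: colon_def)
qed

lemma genideal_carrier: "A \<subseteq> carrier R \<Longrightarrow> Idl A \<subseteq> carrier R"
  using ideal.Icarr[OF R.genideal_ideal] by blast

lemma ideal_smult_empty: "ideal_smult R (Idl {}) M = {\<zero>\<^bsub>M\<^esub>}"
proof
  show "ideal_smult R (Idl {}) M \<subseteq> {\<zero>\<^bsub>M\<^esub>}"
    by (rule ideal_smult_genideal_least[OF submodule_zero_singleton]) auto
  show "{\<zero>\<^bsub>M\<^esub>} \<subseteq> ideal_smult R (Idl {}) M"
    using submodule_zero[OF ideal_smult_submodule[OF genideal_carrier]] by auto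
qed

lemma ideal_smult_insert:
  assumes A: "A \<subseteq> carrier R" and x: "x \<in> carrier R"
  shows "ideal_smult R (Idl (insert x A)) M
    = ideal_smult R (Idl A) M <+>\<^bsub>M\<^esub> {x \<odot>\<^bsub>M\<^esub> v | v. v \<in> carrier M}" (is "?L = ?S <+>\<^bsub>M\<^esub> ?X")
proof
  note S = ideal_smult_submodule[OF genideal_carrier[OF A]] and X = submodule_image[OF x]
  have xA: "insert x A \<subseteq> carrier R" using x A by auto
  note L = ideal_smult_submodule[OF genideal_carrier[OF xA]]
  show "?L \<subseteq> ?S <+>\<^bsub>M\<^esub> ?X"
  proof (rule ideal_smult_genideal_least[OF submodule_set_add[OF S X] xA])
    fix a v assume a: "a \<in> insert x A" and v: "v \<in> carrier M"
    show "a \<odot>\<^bsub>M\<^esub> v \<in> ?S <+>\<^bsub>M\<^esub> ?X"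
    proof (cases "a = x")
      case True
      then have "a \<odot>\<^bsub>M\<^esub> v \<in> ?X" using v by blast
      then show ?thesis by (rule subsetD[OF set_add_upper2[OF S X]])
    next
      case False
      then have "a \<in> Idl A" using a R.genideal_self[OF A] by auto
      then show ?thesis by (rule subsetD[OF set_add_upper1[OF S X] ideal_smultI[OF _ v]])
    qed
  qed
  have "?S \<subseteq> ?L"
    by (rule ideal_smult_genideal_least[OF L A])
      (use R.genideal_self[OF xA] in \<open>auto intro: ideal_smultI\<close>)
  moreover have "?X \<subseteq> ?L" using R.genideal_self[OF xA] by (auto intro: ideal_smultI)
  ultimately show "?S <+>\<^bsub>M\<^esub> ?X \<subseteq> ?L" using submoduleE(5)[OF L] by (auto simp: mem_set_add subset_iff)
qed

end

text \<open>A coefficient outside the maximal ideal is a unit and would express one generator by the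
  others, against least cardinality. The enumeration \<open>g\<close> is injective, so that dropping
  an index does lower the cardinality.\<close>

lemma minimal_generators:
  assumes local: "noetherian_local_ring R" and fg: "fin_gen_module R M"
  obtains n g where "\<And>i. i < n \<Longrightarrow> g i \<in> carrier M"
    "lincomb M n g ` carrier (free_module R n) = carrier M"
    "\<And>x k. x \<in> carrier (free_module R n) \<Longrightarrow> lincomb M n g x = \<zero>\<^bsub>M\<^esub> \<Longrightarrow> k < n \<Longrightarrow> x k \<in> max_ideal R"
proof -
  interpret L: noetherian_local_ring R by fact
  interpret module R M using fg by (simp add: fin_gen_module_def)
  let ?P = "\<lambda>n. \<exists>A. finite A \<and> A \<subseteq> carrier M \<and> mod_span R M A = carrier M \<and> card A = n"
  define n where "n = (LEAST n. ?P n)"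
  have "\<exists>n. ?P n" using fg by (auto simp: fin_gen_module_def)
  then have "?P n" unfolding n_def by (rule LeastI_ex)
  then obtain A where A: "finite A" "A \<subseteq> carrier M" "mod_span R M A = carrier M" "card A = n" by blast
  obtain g where g: "bij_betw g {0..<n} A" using ex_bij_betw_nat_finite[OF A(1)] A(4) by auto
  have gA: "A = g ` {..<n}" using g by (auto simp: bij_betw_def atLeast0LessThan)
  have gi: "g i = g j \<longleftrightarrow> i = j" if "i < n" "j < n" for i j
    using g that by (auto simp: bij_betw_def inj_on_def atLeast0LessThan)
  have gc: "g i \<in> carrier M" if "i < n" for i using that A(2) gA by auto
  have "x k \<in> max_ideal R"
    if x: "x \<in> carrier (free_module R n)" and x0: "lincomb M n g x = \<zero>\<^bsub>M\<^esub>" and k: "k < n" for x k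
  proof (rule ccontr)
    assume nm: "x k \<notin> max_ideal R"
    have xc: "x i \<in> carrier R" if "i < n" for i
      using x that by (auto simp: module_power_simps(1))
    obtain b where b: "b \<in> carrier R" "b \<otimes>\<^bsub>R\<^esub> x k = \<one>\<^bsub>R\<^esub>"
      using L.unit_if_not_in_max_ideal[OF xc[OF k] nm] by blast
    let ?B = "A - {g k}"
    have B: "?B \<subseteq> carrier M" using A(2) by auto
    note S = span_submodule[OF B]
    define y where "y = (\<lambda>i\<in>{..<n}. if i = k then \<zero>\<^bsub>R\<^esub> else x i)"
    have y: "y \<in> carrier (free_module R n)" using xc by (auto simp: y_def module_power_simps(1))
    have sk: "single (regular_module R) n k (x k) \<in> carrier (free_module R n)"
      using module.single_closed[OF L.regular_module] xc[OF k] by simp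
    have xy: "x = single (regular_module R) n k (x k) \<oplus>\<^bsub>free_module R n\<^esub> y"
      using x xc by (auto simp: y_def single_def module_power_simps fun_eq_iff PiE_iff extensional_def)
    have lc: "lincomb M n g y \<in> mod_span R M ?B"
    proof (rule lincomb_in_submodule[OF S])
      fix i assume i: "i < n"
      show "y i \<odot>\<^bsub>M\<^esub> g i \<in> mod_span R M ?B"
      proof (cases "i = k")
        case True
        then show ?thesis using i gc submodule_zero[OF S] by (simp add: y_def)
      next
        case False
        then have "g i \<in> ?B" using i k gi gA by auto
        then have "g i \<in> mod_span R M ?B" using span_superset[of ?B] by auto
        then show ?thesis using i False submoduleE(4)[OF S xc[OF i]] by (simp add: y_def)
      qed
    qed
    have "x k \<odot>\<^bsub>M\<^esub> g k \<oplus>\<^bsub>M\<^esub> lincomb M n g y = \<zero>\<^bsub>M\<^esub>"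
      using mlin_add[OF lincomb_mlin[OF gc] sk y] x0 lincomb_single[OF gc k xc[OF k]]
      unfolding xy[symmetric] by simp
    then have "x k \<odot>\<^bsub>M\<^esub> g k \<in> mod_span R M ?B"
      using submodule_add_cancel[OF S lc] submodule_zero[OF S] gc[OF k] xc[OF k] by simp
    then have "b \<odot>\<^bsub>M\<^esub> (x k \<odot>\<^bsub>M\<^esub> g k) \<in> mod_span R M ?B" using submoduleE(4)[OF S b(1)] by simp
    then have gk: "g k \<in> mod_span R M ?B"
      using b gc[OF k] xc[OF k] by (simp flip: smult_assoc1)
    have "A \<subseteq> mod_span R M ?B" using gk span_superset[of ?B] by auto
    then have "carrier M \<subseteq> mod_span R M ?B" using span_least[OF S] A(3) by auto
    then have "mod_span R M ?B = carrier M" using submoduleE(1)[OF S] by auto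
    then have "?P (card ?B)" using A(1) B by blast
    then have "n \<le> card ?B" unfolding n_def by (rule Least_le)
    moreover have "card ?B < card A" using A(1) k gA by (intro psubset_card_mono) auto
    ultimately show False using A(4) by simp
  qed
  moreover have "lincomb M n g ` carrier (free_module R n) = carrier M"
    using lincomb_image[OF gc] A(3) gA by simp
  ultimately show thesis using that gc by blast
qed

text \<open>If \<open>I M = M\<close>, the generator \<open>g 0\<close> is a combination of all
  generators with coefficients in the maximal ideal. Moving it to the other side gives a relation
  whose coefficient at 0 is a unit, against minimality.\<close>

lemma nakayama:
  assumes local: "noetherian_local_ring R" and fg: "fin_gen_module R M"
    and nz: "carrier M \<noteq> {\<zero>\<^bsub>M\<^esub>}" and I: "I \<subseteq> max_ideal R"
  shows "ideal_smult R I M \<noteq> carrier M"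
proof
  assume eq: "ideal_smult R I M = carrier M"
  interpret L: noetherian_local_ring R by fact
  interpret module R M using fg by (simp add: fin_gen_module_def)
  interpret m: maximalideal "max_ideal R" R by (rule L.max_ideal_maximal)
  obtain n g where gc: "\<And>i. i < n \<Longrightarrow> g i \<in> carrier M"
    and gen: "lincomb M n g ` carrier (free_module R n) = carrier M"
    and min: "\<And>x k. x \<in> carrier (free_module R n) \<Longrightarrow> lincomb M n g x = \<zero>\<^bsub>M\<^esub> \<Longrightarrow> k < n \<Longrightarrow> x k \<in> max_ideal R"
    using minimal_generators[OF local fg] by blast
  interpret F: module R "free_module R n" by (rule L.free_module_module)
  interpret FM: module_pair R "free_module R n" M by unfold_locales
  have "n \<noteq> 0"
  proof
    assume "n = 0"
    then have "lincomb M n g x = \<zero>\<^bsub>M\<^esub>" for x by (simp add: lincomb_def)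
    then have "lincomb M n g ` carrier (free_module R n) \<subseteq> {\<zero>\<^bsub>M\<^esub>}" by auto
    then have "carrier M \<subseteq> {\<zero>\<^bsub>M\<^esub>}" unfolding gen .
    then show False using nz by auto
  qed
  then have n0: "0 < n" by simp
  let ?S = "{x \<in> carrier (free_module R n). \<forall>i<n. x i \<in> max_ideal R}"
  have S: "submodule ?S R (free_module R n)"
  proof (rule F.submodule_subI)
    show "\<zero>\<^bsub>free_module R n\<^esub> \<in> ?S" using F.M.zero_closed by (simp add: module_power_zero)
    show "x \<oplus>\<^bsub>free_module R n\<^esub> y \<in> ?S" if xy: "x \<in> ?S" "y \<in> ?S" for x y
    proof -
      have "(x \<oplus>\<^bsub>free_module R n\<^esub> y) i \<in> max_ideal R" if "i < n" for i
        using xy that m.a_closed[of "x i" "y i"] by (simp add: module_power_add)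
      moreover have "x \<oplus>\<^bsub>free_module R n\<^esub> y \<in> carrier (free_module R n)"
        by (rule F.M.a_closed) (use xy in auto)
      ultimately show ?thesis by simp
    qed
    show "a \<odot>\<^bsub>free_module R n\<^esub> x \<in> ?S" if ax: "a \<in> carrier R" "x \<in> ?S" for a x
    proof -
      have "(a \<odot>\<^bsub>free_module R n\<^esub> x) i \<in> max_ideal R" if "i < n" for i
        using ax that m.I_l_closed[of "x i" a] by (simp add: module_power_smult)
      moreover have "a \<odot>\<^bsub>free_module R n\<^esub> x \<in> carrier (free_module R n)"
        by (rule F.smult_closed) (use ax in auto)
      ultimately show ?thesis by simp
    qed
  qed (rule Collect_subset)
  have "ideal_smult R I M \<subseteq> lincomb M n g ` ?S"
  proof (rule ideal_smult_least[OF FM.mlin_image_submodule[OF lincomb_mlin[OF gc] S]])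
    fix a v assume a: "a \<in> I" and v: "v \<in> carrier M"
    then obtain x where x: "x \<in> carrier (free_module R n)" "v = lincomb M n g x" using gen by blast
    have ac: "a \<in> carrier R" using a I m.Icarr by auto
    have "(a \<odot>\<^bsub>free_module R n\<^esub> x) i \<in> max_ideal R" if "i < n" for i
    proof -
      have "x i \<in> carrier R" using x(1) that by (auto simp: module_power_simps(1))
      then show ?thesis using m.I_r_closed[of a "x i"] a I that by (auto simp: module_power_smult)
    qed
    then have "a \<odot>\<^bsub>free_module R n\<^esub> x \<in> ?S" using F.smult_closed[OF ac x(1)] by simp
    moreover have "a \<odot>\<^bsub>M\<^esub> v = lincomb M n g (a \<odot>\<^bsub>free_module R n\<^esub> x)"
      using mlin_smult[OF lincomb_mlin[OF gc] ac x(1)] x(2) by simp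
    ultimately show "a \<odot>\<^bsub>M\<^esub> v \<in> lincomb M n g ` ?S" by blast
  qed
  then have "g 0 \<in> lincomb M n g ` ?S" using eq gc[OF n0] by auto
  then obtain x where x: "x \<in> ?S" "g 0 = lincomb M n g x" by blast
  note e0 = unit_vector_closed[of n 0] and lg = lincomb_mlin[OF gc]
  have xF: "x \<in> carrier (free_module R n)" using x(1) by simp
  have "lincomb M n g (x \<ominus>\<^bsub>free_module R n\<^esub> unit_vector R n 0) = \<zero>\<^bsub>M\<^esub>"
    using FM.mlin_diff[OF lg xF e0] x(2) lincomb_unit_vector[OF gc n0] gc[OF n0]
    by (simp add: M.minus_eq M.r_neg)
  then have "(x \<ominus>\<^bsub>free_module R n\<^esub> unit_vector R n 0) 0 \<in> max_ideal R"
    by (rule min[OF F.M.minus_closed[OF xF e0] _ n0])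
  interpret RM: module R "regular_module R" by (rule L.regular_module)
  have "(x \<ominus>\<^bsub>free_module R n\<^esub> unit_vector R n 0) 0 \<oplus>\<^bsub>R\<^esub> \<one>\<^bsub>R\<^esub> = x 0"
  proof -
    have "(x \<ominus>\<^bsub>free_module R n\<^esub> unit_vector R n 0) \<oplus>\<^bsub>free_module R n\<^esub> unit_vector R n 0 = x"
      using xF e0 by (simp add: F.M.minus_eq F.M.a_assoc F.M.l_neg)
    from fun_cong[OF this, of 0] show ?thesis using n0 by (simp add: module_power_add single_def)
  qed
  with \<open>(x \<ominus>\<^bsub>free_module R n\<^esub> unit_vector R n 0) 0 \<in> max_ideal R\<close>
  have "\<one>\<^bsub>R\<^esub> \<in> max_ideal R"
    using RM.submodule_add_cancel[OF L.ideal_is_submodule[OF m.is_ideal], of _ "\<one>\<^bsub>R\<^esub>"] x(1) n0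
    by (auto simp: L.a_comm m.Icarr)
  then show False using m.one_imp_carrier m.I_notcarr by simp
qed

text \<open>A finite supremum of lengths is attained, and a sequence attaining it cannot be
  prolonged. So each element of the maximal ideal is a zero divisor modulo \<open>H t\<close>, and
  \<open>exists_colon_containing\<close> finds one \<open>v\<close> that works for all of
  them.\<close>

lemma depth_regular_chain:
  assumes local: "noetherian_local_ring R" and fg: "fin_gen_module R N" and depth: "depth R N = enat t"
  obtains x H v where "regular_chain R N t x H" "v \<in> carrier N" "v \<notin> H t"
    "\<And>a. a \<in> max_ideal R \<Longrightarrow> a \<odot>\<^bsub>N\<^esub> v \<in> H t"
proof -
  interpret L: noetherian_local_ring R by fact
  interpret noetherian_module R N by (rule fin_gen_module_noetherian[OF L.noetherian_ring_axioms fg])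
  interpret m: maximalideal "max_ideal R" R by (rule L.max_ideal_maximal)
  have nz: "carrier N \<noteq> {\<zero>\<^bsub>N\<^esub>}" using depth by (auto simp: depth_def)
  define I where "I = (\<lambda>xs. ideal_smult R (genideal R (set xs)) N)"
  have Isub: "submodule (I xs) R N" if "set xs \<subseteq> carrier R" for xs
    unfolding I_def by (rule ideal_smult_submodule[OF genideal_carrier[OF that]])
  have reg_iff: "regular_sequence R N xs \<longleftrightarrow> (\<forall>i<length xs. \<forall>v\<in>carrier N. (xs ! i) \<odot>\<^bsub>N\<^esub> v \<in> I (take i xs) \<longrightarrow> v \<in> I (take i xs))
      \<and> I xs \<noteq> carrier N" if xs: "set xs \<subseteq> carrier R" for xs
  proof -
    have eq: "(\<forall>z\<in>carrier (module_quotient N (I (take i xs))).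
          (xs ! i) \<odot>\<^bsub>module_quotient N (I (take i xs))\<^esub> z = \<zero>\<^bsub>module_quotient N (I (take i xs))\<^esub>
          \<longrightarrow> z = \<zero>\<^bsub>module_quotient N (I (take i xs))\<^esub>)
        \<longleftrightarrow> (\<forall>v\<in>carrier N. (xs ! i) \<odot>\<^bsub>N\<^esub> v \<in> I (take i xs) \<longrightarrow> v \<in> I (take i xs))" if "i < length xs" for i
      by (rule quotient_regular_iff[OF Isub]) (use xs that in \<open>auto dest: in_set_takeD\<close>)
    have "ideal_smult R (genideal R (set ys)) N = I ys" for ys by (simp add: I_def)
    then show ?thesis using xs by (simp only: regular_sequence_def Let_def all_cong[OF eq] simp_thms)
  qed
  have IN: "I xs \<noteq> carrier N" if xs: "set xs \<subseteq> max_ideal R" for xs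
    unfolding I_def
    by (rule nakayama[OF local fg nz L.genideal_minimal[OF m.is_ideal xs]])
  let ?S = "{enat (length xs) | xs. set xs \<subseteq> max_ideal R \<and> regular_sequence R N xs}"
  have Sup: "Sup ?S = enat t" using depth nz by (simp add: depth_def)
  have "regular_sequence R N []" using reg_iff[of "[]"] IN[of "[]"] by simp
  then have "enat (length []) \<in> ?S" by (intro CollectI exI[of _ "[]"]) simp
  then have ne: "?S \<noteq> {}" by blast
  \<comment> \<open>In \<open>enat\<close> an infinite set has supremum infinity, so
    \<open>?S\<close> is finite and its supremum a maximum. By Nakayama's lemma the empty sequence
    is regular, so \<open>?S\<close> is not empty.\<close>
  then have "finite ?S" using Sup by (auto simp: Sup_enat_def split: if_splits)
  moreover from this have "Sup ?S = Max ?S" using ne by (simp only: Sup_enat_def if_True if_False)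
  ultimately have "enat t \<in> ?S" using Max_in[OF _ ne] unfolding Sup by simp
  then obtain xs where xs: "set xs \<subseteq> max_ideal R" "regular_sequence R N xs" "length xs = t" by auto
  have xc: "set xs \<subseteq> carrier R" using xs(1) m.Icarr by auto
  define H where "H = (\<lambda>j. I (take j xs))"
  have reg: "\<forall>i<t. \<forall>v\<in>carrier N. (xs ! i) \<odot>\<^bsub>N\<^esub> v \<in> H i \<longrightarrow> v \<in> H i"
    using xs(2) unfolding reg_iff[OF xc] xs(3) H_def by blast
  have chain: "regular_chain R N t (\<lambda>j. xs ! j) H"
    unfolding regular_chain_def
  proof (intro conjI allI impI)
    show "H 0 = {\<zero>\<^bsub>N\<^esub>}" by (simp add: H_def I_def ideal_smult_empty)
    fix j assume j: "j < t"
    show xj: "xs ! j \<in> carrier R" using j xs(3) xc nth_mem by blast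
    have tc: "set (take j xs) \<subseteq> carrier R" using set_take_subset xc by (rule subset_trans)
    have "set (take (Suc j) xs) = insert (xs ! j) (set (take j xs))"
      using j xs(3) by (simp add: take_Suc_conv_app_nth)
    then show "H (Suc j) = H j <+>\<^bsub>N\<^esub> {xs ! j \<odot>\<^bsub>N\<^esub> v |v. v \<in> carrier N}"
      unfolding H_def I_def using ideal_smult_insert[OF tc xj] by simp
    show "\<forall>v\<in>carrier N. xs ! j \<odot>\<^bsub>N\<^esub> v \<in> H j \<longrightarrow> v \<in> H j" using reg j by blast
  qed
  have Ht: "submodule (H t) R N" by (rule regular_chain_submodule[OF chain]) simp
  \<comment> \<open>An \<open>a\<close> regular modulo \<open>H t\<close> could be appended to
    \<open>xs\<close>; properness for the longer sequence is again Nakayama's lemma.\<close>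
  have zd: "\<exists>v\<in>carrier N - H t. a \<odot>\<^bsub>N\<^esub> v \<in> H t" if a: "a \<in> max_ideal R" for a
  proof (rule ccontr)
    assume no: "\<not> ?thesis"
    let ?ys = "xs @ [a]"
    have ysm: "set ?ys \<subseteq> max_ideal R" using xs(1) a by simp
    then have ys: "set ?ys \<subseteq> carrier R" using m.Icarr by auto
    have "regular_sequence R N ?ys"
      unfolding reg_iff[OF ys]
    proof (intro conjI allI impI ballI)
      fix i v assume i: "i < length ?ys" and v: "v \<in> carrier N" "?ys ! i \<odot>\<^bsub>N\<^esub> v \<in> I (take i ?ys)"
      show "v \<in> I (take i ?ys)"
      proof (cases "i < t")
        case True
        then show ?thesis using v reg xs(3) by (simp add: nth_append H_def)
      next
        case False
        then have "i = t" using i xs(3) by simp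
        then show ?thesis using v no xs(3) by (auto simp: nth_append H_def)
      qed
    qed (rule IN[OF ysm])
    then have "enat (length ?ys) \<in> ?S" using ysm by blast
    then have "enat (length ?ys) \<le> enat t" unfolding Sup[symmetric] by (rule Sup_upper)
    then show False using xs(3) by simp
  qed
  obtain v where "v \<in> carrier N" "v \<notin> H t" "\<And>a. a \<in> max_ideal R \<Longrightarrow> a \<odot>\<^bsub>N\<^esub> v \<in> H t"
    using exists_colon_containing[OF L.noetherian_ring_axioms Ht m.is_ideal zd] by blast
  then show thesis using that chain by blast
qed

section \<open>The number of generators\<close>

text \<open>The isomorphism in the direction from N^r to \<open>Hom(M, N)\<close>, with
  homomorphisms seen only through their values on \<open>carrier M\<close>, so that a vector
  \<open>u\<close> parametrizes a homomorphism.\<close>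

locale hom_power = module_pair R M N for R M N +
  fixes r :: nat and \<Phi>
  assumes Phi_mlin: "u \<in> carrier (module_power N r) \<Longrightarrow> mlin R M N (\<Phi> u)"
    and Phi_add: "u \<in> carrier (module_power N r) \<Longrightarrow> w \<in> carrier (module_power N r) \<Longrightarrow> x \<in> carrier M
      \<Longrightarrow> \<Phi> (u \<oplus>\<^bsub>module_power N r\<^esub> w) x = \<Phi> u x \<oplus>\<^bsub>N\<^esub> \<Phi> w x"
    and Phi_smult: "a \<in> carrier R \<Longrightarrow> u \<in> carrier (module_power N r) \<Longrightarrow> x \<in> carrier M
      \<Longrightarrow> \<Phi> (a \<odot>\<^bsub>module_power N r\<^esub> u) x = a \<odot>\<^bsub>N\<^esub> \<Phi> u x"
    and Phi_inj: "u \<in> carrier (module_power N r) \<Longrightarrow> w \<in> carrier (module_power N r)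
      \<Longrightarrow> (\<And>x. x \<in> carrier M \<Longrightarrow> \<Phi> u x = \<Phi> w x) \<Longrightarrow> u = w"
    and Phi_surj: "mlin R M N h \<Longrightarrow> \<exists>u\<in>carrier (module_power N r). \<forall>x\<in>carrier M. \<Phi> u x = h x"

text \<open>\<open>\<Phi>\<close> is the inverse of the given bijection; its linearity is that of
  \<open>f\<close> read backwards, and extensionality turns equality of values into equality of
  homomorphisms.\<close>

lemma hom_power_if_isomorphic:
  assumes "module R M" "module R N" and iso: "module_isomorphic R (Hom_module R M N) (module_power N r)"
  obtains \<Phi> where "hom_power R M N r \<Phi>"
proof -
  interpret module_pair R M N using assms by (simp add: module_pair_def)
  let ?P = "module_power N r" and ?H = "Hom_module R M N"
  interpret P: module R ?P by (rule cod.module_power_module)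
  obtain f where f: "f \<in> module_hom R ?H ?P" and bij: "bij_betw f (carrier ?H) (carrier ?P)"
    using iso by (auto simp: module_isomorphic_def)
  have fl: "mlin R ?H ?P f" using f by (simp add: module_hom_iff)
  have H: "carrier ?H = module_hom R M N" "g \<oplus>\<^bsub>?H\<^esub> h = (\<lambda>x\<in>carrier M. g x \<oplus>\<^bsub>N\<^esub> h x)"
    "a \<odot>\<^bsub>?H\<^esub> g = (\<lambda>x\<in>carrier M. a \<odot>\<^bsub>N\<^esub> g x)" for g h a
    by (simp_all add: Hom_module_def)
  define \<Phi> where "\<Phi> = inv_into (carrier ?H) f"
  have \<Phi>H: "\<Phi> u \<in> carrier ?H" and f\<Phi>: "f (\<Phi> u) = u" if "u \<in> carrier ?P" for u
    unfolding \<Phi>_def using that bij by (auto simp: bij_betw_def inv_into_into f_inv_into_f)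
  have \<Phi>f: "\<Phi> (f g) = g" if "g \<in> carrier ?H" for g
    unfolding \<Phi>_def using that bij by (auto simp: bij_betw_def)
  have hom: "restrict g (carrier M) \<in> carrier ?H" if "mlin R M N g" for g
    unfolding H by (rule restrict_module_hom[OF dom.module_axioms that])
  have \<Phi>l: "mlin R M N (\<Phi> u)" if "u \<in> carrier ?P" for u
    using \<Phi>H[OF that] unfolding H module_hom_iff by simp
  have \<Phi>ext: "\<Phi> u \<in> extensional (carrier M)" if "u \<in> carrier ?P" for u
    using \<Phi>H[OF that] unfolding H module_hom_iff by simp
  have "hom_power R M N r \<Phi>"
  proof
    fix u w assume u: "u \<in> carrier ?P" and w: "w \<in> carrier ?P"
    have add: "\<Phi> u \<oplus>\<^bsub>?H\<^esub> \<Phi> w \<in> carrier ?H"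
      unfolding H(2) by (rule hom[OF mlin_sum[OF \<Phi>l[OF u] \<Phi>l[OF w]]])
    have "f (\<Phi> u \<oplus>\<^bsub>?H\<^esub> \<Phi> w) = u \<oplus>\<^bsub>?P\<^esub> w"
      using mlin_add[OF fl \<Phi>H[OF u] \<Phi>H[OF w]] f\<Phi>[OF u] f\<Phi>[OF w] by simp
    then have "\<Phi> (u \<oplus>\<^bsub>?P\<^esub> w) = \<Phi> u \<oplus>\<^bsub>?H\<^esub> \<Phi> w" using \<Phi>f[OF add] by simp
    then show "\<Phi> (u \<oplus>\<^bsub>?P\<^esub> w) x = \<Phi> u x \<oplus>\<^bsub>N\<^esub> \<Phi> w x" if "x \<in> carrier M" for x
      using that by (simp add: H(2))
    show "u = w" if eq: "\<And>x. x \<in> carrier M \<Longrightarrow> \<Phi> u x = \<Phi> w x"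
    proof -
      have "\<Phi> u = \<Phi> w"
        by (rule extensionalityI[OF \<Phi>ext[OF u] \<Phi>ext[OF w] eq])
      then have "f (\<Phi> u) = f (\<Phi> w)" by (rule arg_cong)
      then show ?thesis unfolding f\<Phi>[OF u] f\<Phi>[OF w] .
    qed
  next
    fix a u assume a: "a \<in> carrier R" and u: "u \<in> carrier ?P"
    have sm: "a \<odot>\<^bsub>?H\<^esub> \<Phi> u \<in> carrier ?H"
      unfolding H(3) by (rule hom[OF mlin_scale[OF a \<Phi>l[OF u]]])
    have "f (a \<odot>\<^bsub>?H\<^esub> \<Phi> u) = a \<odot>\<^bsub>?P\<^esub> u"
      using mlin_smult[OF fl a \<Phi>H[OF u]] f\<Phi>[OF u] by simp
    then have "\<Phi> (a \<odot>\<^bsub>?P\<^esub> u) = a \<odot>\<^bsub>?H\<^esub> \<Phi> u" using \<Phi>f[OF sm] by simp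
    then show "\<Phi> (a \<odot>\<^bsub>?P\<^esub> u) x = a \<odot>\<^bsub>N\<^esub> \<Phi> u x" if "x \<in> carrier M" for x
      using that by (simp add: H(3))
  next
    fix h assume h: "mlin R M N h"
    have "f (restrict h (carrier M)) \<in> carrier ?P" by (rule mlin_closed[OF fl hom[OF h]])
    moreover have "\<forall>x\<in>carrier M. \<Phi> (f (restrict h (carrier M))) x = h x" using \<Phi>f[OF hom[OF h]] by simp
    ultimately show "\<exists>u\<in>carrier ?P. \<forall>x\<in>carrier M. \<Phi> u x = h x" by blast
  qed (rule \<Phi>l)
  then show thesis using that by blast
qed

lemma (in module) componentwise_submodule:
  assumes H: "submodule H R M"
  shows "submodule {u \<in> carrier (module_power M n). \<forall>i<n. u i \<in> H} R (module_power M n)"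
proof -
  interpret P: module R "module_power M n" by (rule module_power_module)
  show ?thesis
  proof (rule P.submodule_subI)
    show "\<zero>\<^bsub>module_power M n\<^esub> \<in> {u \<in> carrier (module_power M n). \<forall>i<n. u i \<in> H}"
      using P.M.zero_closed submodule_zero[OF H] by (simp add: module_power_zero)
    fix x y assume x: "x \<in> {u \<in> carrier (module_power M n). \<forall>i<n. u i \<in> H}"
      and y: "y \<in> {u \<in> carrier (module_power M n). \<forall>i<n. u i \<in> H}"
    have "(x \<oplus>\<^bsub>module_power M n\<^esub> y) i \<in> H" if "i < n" for i
      using x y that submoduleE(5)[OF H, of "x i" "y i"] by (simp add: module_power_add)
    then show "x \<oplus>\<^bsub>module_power M n\<^esub> y \<in> {u \<in> carrier (module_power M n). \<forall>i<n. u i \<in> H}"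
      using x y P.M.a_closed[of x y] by simp
  next
    fix a x assume a: "a \<in> carrier R" and x: "x \<in> {u \<in> carrier (module_power M n). \<forall>i<n. u i \<in> H}"
    have "(a \<odot>\<^bsub>module_power M n\<^esub> x) i \<in> H" if "i < n" for i
      using a x that submoduleE(4)[OF H, of a "x i"] by (simp add: module_power_smult)
    then show "a \<odot>\<^bsub>module_power M n\<^esub> x \<in> {u \<in> carrier (module_power M n). \<forall>i<n. u i \<in> H}"
      using a x P.smult_closed[of a x] by simp
  qed (rule Collect_subset)
qed

lemma (in hom_power) Phi_zero: "x \<in> carrier M \<Longrightarrow> \<Phi> \<zero>\<^bsub>module_power N r\<^esub> x = \<zero>\<^bsub>N\<^esub>"
proof -
  interpret P: module R "module_power N r" by (rule cod.module_power_module)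
  assume x: "x \<in> carrier M"
  have "\<Phi> (\<zero>\<^bsub>R\<^esub> \<odot>\<^bsub>module_power N r\<^esub> \<zero>\<^bsub>module_power N r\<^esub>) x = \<zero>\<^bsub>R\<^esub> \<odot>\<^bsub>N\<^esub> \<Phi> \<zero>\<^bsub>module_power N r\<^esub> x"
    by (rule Phi_smult) (use x in auto)
  then show ?thesis using mlin_closed[OF Phi_mlin[OF P.M.zero_closed] x] by simp
qed

text \<open>By linearity: a vector with entries in \<open>H (Suc j)\<close> is one with entries in
  \<open>H j\<close> plus \<open>x j\<close> times a vector.\<close>

lemma (in hom_power) Phi_regular_chain:
  assumes chain: "regular_chain R N t x H" and y: "y \<in> carrier M"
  shows "j \<le> t \<Longrightarrow> u \<in> carrier (module_power N r) \<Longrightarrow> (\<And>i. i < r \<Longrightarrow> u i \<in> H j) \<Longrightarrow> \<Phi> u y \<in> H j"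
proof (induction j arbitrary: u)
  case 0
  then have "u = \<zero>\<^bsub>module_power N r\<^esub>"
    using chain by (auto simp: regular_chain_def module_power_simps fun_eq_iff PiE_iff extensional_def)
  then show ?case using Phi_zero[OF y] chain by (simp add: regular_chain_def)
next
  case (Suc j)
  have j: "j < t" using Suc.prems(1) by simp
  have xj: "x j \<in> carrier R" and HS: "H (Suc j) = H j <+>\<^bsub>N\<^esub> {x j \<odot>\<^bsub>N\<^esub> v | v. v \<in> carrier N}"
    using chain j by (simp_all add: regular_chain_def)
  note Hj = cod.regular_chain_submodule[OF chain less_imp_le[OF j]]
  have "\<forall>i. \<exists>h v. i < r \<longrightarrow> h \<in> H j \<and> v \<in> carrier N \<and> u i = h \<oplus>\<^bsub>N\<^esub> x j \<odot>\<^bsub>N\<^esub> v"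
    using Suc.prems(3) unfolding HS cod.mem_set_add by blast
  then obtain h v where hv: "\<And>i. i < r \<Longrightarrow> h i \<in> H j \<and> v i \<in> carrier N \<and> u i = h i \<oplus>\<^bsub>N\<^esub> x j \<odot>\<^bsub>N\<^esub> v i"
    by metis
  define h' v' where "h' = (\<lambda>i\<in>{..<r}. h i)" and "v' = (\<lambda>i\<in>{..<r}. v i)"
  have h': "h' \<in> carrier (module_power N r)" and v': "v' \<in> carrier (module_power N r)"
    using hv cod.submodule_carrier[OF Hj] by (auto simp: h'_def v'_def module_power_simps(1))
  have u: "u = h' \<oplus>\<^bsub>module_power N r\<^esub> x j \<odot>\<^bsub>module_power N r\<^esub> v'"
    using Suc.prems(2) hv
    by (auto simp: h'_def v'_def module_power_simps fun_eq_iff PiE_iff extensional_def)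
  interpret P: module R "module_power N r" by (rule cod.module_power_module)
  have "\<Phi> u y = \<Phi> h' y \<oplus>\<^bsub>N\<^esub> x j \<odot>\<^bsub>N\<^esub> \<Phi> v' y"
    unfolding u Phi_add[OF h' P.smult_closed[OF xj v'] y] Phi_smult[OF xj v' y] ..
  moreover have "h' i \<in> H j" if "i < r" for i using hv that by (simp add: h'_def)
  then have "\<Phi> h' y \<in> H j" by (rule Suc.IH[OF less_imp_le[OF j] h'])
  moreover have "\<Phi> v' y \<in> carrier N" by (rule mlin_closed[OF Phi_mlin[OF v'] y])
  ultimately show ?case unfolding HS cod.mem_set_add by blast
qed

lemma (in module) regular_chain_mono:
  assumes chain: "regular_chain R M t x H"
  shows "i \<le> j \<Longrightarrow> j \<le> t \<Longrightarrow> H i \<subseteq> H j"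
proof (induction j rule: dec_induct)
  case (step j)
  then have j: "j < t" by simp
  then have "H (Suc j) = H j <+>\<^bsub>M\<^esub> {x j \<odot>\<^bsub>M\<^esub> v | v. v \<in> carrier M}" "x j \<in> carrier R"
    using chain by (simp_all add: regular_chain_def)
  then show ?case
    using step.IH j set_add_upper1[OF regular_chain_submodule[OF chain] submodule_image, of j "x j"] by auto
qed simp

lemma (in module) regular_chain_smult:
  assumes chain: "regular_chain R M t x H" and i: "i < t" and v: "v \<in> carrier M"
  shows "x i \<odot>\<^bsub>M\<^esub> v \<in> H t"
proof -
  have "H (Suc i) = H i <+>\<^bsub>M\<^esub> {x i \<odot>\<^bsub>M\<^esub> v | v. v \<in> carrier M}" "x i \<in> carrier R"
    using chain i by (simp_all add: regular_chain_def)
  then have "x i \<odot>\<^bsub>M\<^esub> v \<in> H (Suc i)"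
    using set_add_upper2[OF regular_chain_submodule[OF chain] submodule_image, of i "x i"] i v by auto
  then show ?thesis using regular_chain_mono[OF chain, of "Suc i" t] i by auto
qed

section \<open>Comparison of Hom(M, N) and N^r modulo the regular chain\<close>

locale resolved_hom_power = resolved_pair R M N n d e + hom_power R M N r \<Phi>
  for R M N n d e r \<Phi>
begin

text \<open>The converse of \<open>Phi_regular_chain\<close>: a homomorphism into \<open>H t\<close>
  is a combination of the \<open>x i\<close> with coefficients in \<open>Hom(M, N)\<close>, and
  these coefficients come from vectors of N^r.\<close>

lemma hom_into_regular_chain_power:
  assumes chain: "regular_chain R N t x H" and van: "\<And>i. i < s \<Longrightarrow> Ext_zero i" and ts: "t \<le> s"
    and u: "u \<in> carrier (module_power N r)" and uH: "\<And>y. y \<in> carrier M \<Longrightarrow> \<Phi> u y \<in> H t" and i: "i < r"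
  shows "u i \<in> H t"
proof -
  let ?P = "module_power N r"
  interpret P: module R ?P by (rule cod.module_power_module)
  note Ht = cod.regular_chain_submodule[OF chain order_refl]
  let ?B = "{u \<in> carrier ?P. \<forall>i<r. u i \<in> H t}"
  note B = cod.componentwise_submodule[OF Ht, of r]
  \<comment> \<open>The property carried along the chain: \<open>f\<close> comes from a vector with
    all entries in \<open>H t\<close>. At the end, injectivity of \<open>\<Phi>\<close> identifies
    that vector with \<open>u\<close>.\<close>
  let ?Q = "\<lambda>f. \<exists>w\<in>?B. \<forall>y\<in>carrier (F 0). \<Phi> w (e y) = f y"
  note ec = mlin_closed[OF e_lin]
  have "?Q (\<lambda>y. \<Phi> u (e y))"
  proof (rule hom_into_regular_chain[where Q = ?Q, OF chain van _ _ order_refl ts])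
    show "?Q f" if "\<And>y. y \<in> carrier (F 0) \<Longrightarrow> f y = \<zero>\<^bsub>N\<^esub>" for f
      using that Phi_zero ec P.submodule_zero[OF B] by (intro bexI[of _ "\<zero>\<^bsub>?P\<^esub>"]) simp_all
    show "?Q g'" if k: "k < t" and f: "?Q f" and g: "mlin R (F 0) N g"
      and g0: "\<And>y. y \<in> carrier (F (Suc 0)) \<Longrightarrow> g (d 0 y) = \<zero>\<^bsub>N\<^esub>"
      and g': "\<And>y. y \<in> carrier (F 0) \<Longrightarrow> g' y = f y \<oplus>\<^bsub>N\<^esub> x k \<odot>\<^bsub>N\<^esub> g y" for k f g g'
    proof -
      obtain w where w: "w \<in> ?B" "\<forall>y\<in>carrier (F 0). \<Phi> w (e y) = f y" using f by blast
      obtain h where h: "mlin R M N h" "\<And>y. y \<in> carrier (F 0) \<Longrightarrow> h (e y) = g y"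
        using descend[OF g g0] by blast
      obtain v where v: "v \<in> carrier ?P" "\<forall>y\<in>carrier M. \<Phi> v y = h y" using Phi_surj[OF h(1)] by blast
      have xk: "x k \<in> carrier R" using chain k by (simp add: regular_chain_def)
      have "x k \<odot>\<^bsub>?P\<^esub> v \<in> ?B"
      proof -
        have "(x k \<odot>\<^bsub>?P\<^esub> v) i \<in> H t" if "i < r" for i
          using that v(1) cod.regular_chain_smult[OF chain k]
          by (auto simp: module_power_smult module_power_simps(1))
        then show ?thesis using P.smult_closed[OF xk v(1)] by simp
      qed
      then have "w \<oplus>\<^bsub>?P\<^esub> x k \<odot>\<^bsub>?P\<^esub> v \<in> ?B" by (rule P.submoduleE(5)[OF B w(1)])
      moreover have "\<Phi> (w \<oplus>\<^bsub>?P\<^esub> x k \<odot>\<^bsub>?P\<^esub> v) (e y) = g' y" if y: "y \<in> carrier (F 0)" for y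
        using Phi_add[OF _ P.smult_closed[OF xk v(1)] ec[OF y], of w] Phi_smult[OF xk v(1) ec[OF y]]
          w v(2) h(2)[OF y] g'[OF y] ec[OF y] y by simp
      ultimately show ?thesis by blast
    qed
    show "mlin R (F 0) N (\<lambda>y. \<Phi> u (e y))" by (rule mlin_compose[OF e_lin Phi_mlin[OF u]])
    show "\<Phi> u (e (d 0 y)) = \<zero>\<^bsub>N\<^esub>" if "y \<in> carrier (F (Suc 0))" for y
      unfolding e_d[OF that] by (rule mlin_zero[OF Phi_mlin[OF u]])
    show "\<Phi> u (e y) \<in> H t" if "y \<in> carrier (F 0)" for y by (rule uH[OF ec[OF that]])
  qed
  then obtain w where w: "w \<in> ?B" "\<forall>y\<in>carrier (F 0). \<Phi> w (e y) = \<Phi> u (e y)" by blast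
  have "w = u"
  proof (rule Phi_inj)
    show "\<Phi> w y = \<Phi> u y" if "y \<in> carrier M" for y
      using that w(2) unfolding e_surj[symmetric] by blast
  qed (use w u in auto)
  then show ?thesis using w i by blast
qed

end

lemma restrict_power_mlin:
  assumes "r \<le> n" shows "mlin R (module_power M n) (module_power M r) (\<lambda>u. restrict u {..<r})"
proof (rule mlinI)
  fix u assume u: "u \<in> carrier (module_power M n)"
  show "restrict u {..<r} \<in> carrier (module_power M r)"
    unfolding module_power_simps(1) restrict_PiE_iff
    using PiE_mem[OF u[unfolded module_power_simps(1)]] assms by simp
next
  fix u w
  show "restrict (u \<oplus>\<^bsub>module_power M n\<^esub> w) {..<r}
      = restrict u {..<r} \<oplus>\<^bsub>module_power M r\<^esub> restrict w {..<r}"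
    by (rule ext) (use assms in \<open>simp add: module_power_add\<close>)
next
  fix a u
  show "restrict (a \<odot>\<^bsub>module_power M n\<^esub> u) {..<r} = a \<odot>\<^bsub>module_power M r\<^esub> restrict u {..<r}"
    by (rule ext) (use assms in \<open>simp add: module_power_smult\<close>)
qed

context resolved_hom_power
begin

text \<open>If r < \<mu>, N^r sits in N^\<mu> with zeros in the last places. A vector of S^\<mu>,
  read as values on the minimal generators, defines a map from \<open>M\<close> to N/H t, which
  lifts to \<open>N\<close> and so gives a vector of N^r. This correspondence is injective modulo
  \<open>H t\<close>, hence onto at the maximal ideal, yet its last place is always 0.\<close>

lemma generator_bound:
  assumes local: "noetherian_local_ring R" and fgN: "fin_gen_module R N"
    and chain: "regular_chain R N t x H" and van: "\<And>i. i < s \<Longrightarrow> Ext_zero i" and ts: "t \<le> s"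
    and \<sigma>: "\<sigma> \<in> carrier N" "\<sigma> \<notin> H t" "\<And>a. a \<in> max_ideal R \<Longrightarrow> a \<odot>\<^bsub>N\<^esub> \<sigma> \<in> H t"
    and gc: "\<And>i. i < \<mu> \<Longrightarrow> g i \<in> carrier M"
    and gen: "lincomb M \<mu> g ` carrier (free_module R \<mu>) = carrier M"
    and min: "\<And>x k. x \<in> carrier (free_module R \<mu>) \<Longrightarrow> lincomb M \<mu> g x = \<zero>\<^bsub>M\<^esub> \<Longrightarrow> k < \<mu>
      \<Longrightarrow> x k \<in> max_ideal R"
  shows "\<mu> \<le> r"
proof (rule ccontr)
  assume "\<not> \<mu> \<le> r"
  then have r\<mu>: "r < \<mu>" by simp
  interpret L: noetherian_local_ring R by fact
  interpret m: maximalideal "max_ideal R" R by (rule L.max_ideal_maximal)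
  let ?V = "module_power N \<mu>" and ?P = "module_power N r"
  interpret V: noetherian_module R ?V
    by (rule fin_gen_module_noetherian[OF L.noetherian_ring_axioms cod.power_fin_gen[OF fgN]])
  interpret P: module R ?P by (rule cod.module_power_module)
  interpret R\<mu>: module R "free_module R \<mu>" by (rule dom.R.free_module_module)
  interpret R\<mu>N: module_pair R "free_module R \<mu>" N by unfold_locales
  interpret R\<mu>M: module_pair R "free_module R \<mu>" M by unfold_locales
  let ?\<pi> = "lincomb M \<mu> g"
  have \<pi>: "mlin R (free_module R \<mu>) M ?\<pi>" by (rule dom.lincomb_mlin[OF gc])
  note Ht = cod.regular_chain_submodule[OF chain order_refl]
  define S where "S = {v \<in> carrier N. \<forall>a\<in>max_ideal R. a \<odot>\<^bsub>N\<^esub> v \<in> H t}"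
  define W where "W = {w \<in> carrier ?V. \<forall>i<\<mu>. w i \<in> S}"
  define B where "B = {w \<in> carrier ?V. \<forall>i<\<mu>. w i \<in> H t}"
  have B: "submodule B R ?V" unfolding B_def by (rule cod.componentwise_submodule[OF Ht])
  let ?res = "\<lambda>u. restrict u {..<r}"
  have res: "mlin R ?V ?P ?res" by (rule restrict_power_mlin[OF less_imp_le[OF r\<mu>]])
  have cV: "u i \<in> carrier N" if "u \<in> carrier ?V" "i < \<mu>" for u i
    using that by (auto simp: module_power_simps(1))
  \<comment> \<open>\<open>w\<close> lists the values on the generators modulo \<open>H t\<close>;
    \<open>u\<close> is the zero-padded vector of a homomorphism with these values.\<close>
  define \<Gamma> where "\<Gamma> = {(w, u). w \<in> carrier ?V \<and> u \<in> carrier ?V \<and> (\<forall>i. r \<le> i \<longrightarrow> i < \<mu> \<longrightarrow> u i = \<zero>\<^bsub>N\<^esub>)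
    \<and> (\<forall>k<\<mu>. \<Phi> (?res u) (g k) \<ominus>\<^bsub>N\<^esub> w k \<in> H t)}"
  have \<Phi>c: "\<Phi> (?res u) (g k) \<in> carrier N" if "u \<in> carrier ?V" "k < \<mu>" for u k
    by (rule mlin_closed[OF Phi_mlin[OF mlin_closed[OF res that(1)]] gc[OF that(2)]])

  have total: "\<exists>u\<in>W. (w, u) \<in> \<Gamma>" if w: "w \<in> W" for w
  proof -
    have wV: "w \<in> carrier ?V" and wS: "\<And>i. i < \<mu> \<Longrightarrow> w i \<in> S" using w by (auto simp: W_def)
    let ?q = "lincomb N \<mu> w"
    have q: "mlin R (free_module R \<mu>) N ?q" by (rule cod.lincomb_mlin[OF cV[OF wV]])
    \<comment> \<open>Relations between minimal generators have coefficients in the maximal ideal,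
      which kills \<open>S\<close> modulo \<open>H t\<close>; so \<open>w\<close> defines a map on
      \<open>M\<close> modulo \<open>H t\<close>.\<close>
    have qH: "?q x \<in> H t" if "x \<in> carrier (free_module R \<mu>)" "?\<pi> x = \<zero>\<^bsub>M\<^esub>" for x
      by (rule cod.lincomb_in_submodule[OF Ht]) (use min[OF that] wS in \<open>auto simp: S_def\<close>)
    obtain \<alpha> where \<alpha>: "mlin R (F 0) (free_module R \<mu>) \<alpha>" "\<And>y. y \<in> carrier (F 0) \<Longrightarrow> ?\<pi> (\<alpha> y) = e y"
      using free_lift[OF R\<mu>.module_axioms dom.module_axioms \<pi> gen e_lin] by blast
    note \<alpha>c = mlin_closed[OF \<alpha>(1)] and ec = mlin_closed[OF e_lin]
    have q\<alpha>: "mlin R (F 0) N (\<lambda>y. ?q (\<alpha> y))" by (rule mlin_compose[OF \<alpha>(1) q])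
    have "\<exists>f. mlin R (F 0) N f \<and> (\<forall>y\<in>carrier (F (Suc 0)). f (d 0 y) = \<zero>\<^bsub>N\<^esub>)
          \<and> (\<forall>y\<in>carrier (F 0). ?q (\<alpha> y) \<ominus>\<^bsub>N\<^esub> f y \<in> H t)"
    proof (rule lift_modulo[OF chain van order_refl ts q\<alpha>])
      fix y assume y: "y \<in> carrier (F (Suc 0))"
      have dy: "d 0 y \<in> carrier (F 0)" by (rule mlin_closed[OF d_lin y])
      show "?q (\<alpha> (d 0 y)) \<in> H t" by (rule qH[OF \<alpha>c[OF dy]]) (simp add: \<alpha>(2)[OF dy] e_d[OF y])
    qed
    then obtain f where f: "mlin R (F 0) N f" "\<And>y. y \<in> carrier (F (Suc 0)) \<Longrightarrow> f (d 0 y) = \<zero>\<^bsub>N\<^esub>"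
      "\<And>y. y \<in> carrier (F 0) \<Longrightarrow> ?q (\<alpha> y) \<ominus>\<^bsub>N\<^esub> f y \<in> H t" by auto
    obtain h where h: "mlin R M N h" "\<And>y. y \<in> carrier (F 0) \<Longrightarrow> h (e y) = f y"
      using descend[OF f(1,2)] by blast
    obtain u' where u': "u' \<in> carrier ?P" and u'_all: "\<forall>y\<in>carrier M. \<Phi> u' y = h y"
      using Phi_surj[OF h(1)] by (rule bexE)
    note u'h = bspec[OF u'_all]
    define u where "u = (\<lambda>i\<in>{..<\<mu>}. if i < r then u' i else \<zero>\<^bsub>N\<^esub>)"
    have u'c: "u' i \<in> carrier N" if "i < r" for i
      using PiE_mem[OF u'[unfolded module_power_simps(1)], of i] that by simp
    have uV: "u \<in> carrier ?V"
      unfolding u_def module_power_simps(1) restrict_PiE_iff using u'c by simp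
    have res_u: "?res u = u'"
    proof
      fix i show "?res u i = u' i"
        using r\<mu> PiE_arb[OF u'[unfolded module_power_simps(1)], of i] by (cases "i < r") (simp_all add: u_def)
    qed
    have "\<Phi> (?res u) (g k) \<ominus>\<^bsub>N\<^esub> w k \<in> H t" if k: "k < \<mu>" for k
    proof -
      obtain y where y: "y \<in> carrier (F 0)" "g k = e y" using gc[OF k] e_surj by blast
      have fy: "\<Phi> u' (g k) = f y" using u'h[OF gc[OF k]] y h(2) by simp
      note u1 = dom.unit_vector_closed[of \<mu> k]
      have \<pi>u: "?\<pi> (unit_vector R \<mu> k) = e y" and qu: "?q (unit_vector R \<mu> k) = w k"
        using dom.lincomb_unit_vector[of \<mu> g k] gc k y(2) cod.lincomb_unit_vector[of \<mu> w k] cV[OF wV]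
        by simp_all
      \<comment> \<open>\<open>\<alpha> y\<close> and the unit vector both lie over
        \<open>g k\<close>, so their difference is a relation and \<open>?q\<close> does not
        separate them modulo \<open>H t\<close>.\<close>
      have "?\<pi> (\<alpha> y \<ominus>\<^bsub>free_module R \<mu>\<^esub> unit_vector R \<mu> k) = \<zero>\<^bsub>M\<^esub>"
        unfolding R\<mu>M.mlin_diff[OF \<pi> \<alpha>c[OF y(1)] u1] \<alpha>(2)[OF y(1)] \<pi>u
        using ec[OF y(1)] by (simp add: dom.M.minus_eq dom.M.r_neg)
      then have "?q (\<alpha> y \<ominus>\<^bsub>free_module R \<mu>\<^esub> unit_vector R \<mu> k) \<in> H t"
        by (rule qH[OF R\<mu>.M.minus_closed[OF \<alpha>c[OF y(1)] u1]])
      then have 1: "?q (\<alpha> y) \<ominus>\<^bsub>N\<^esub> w k \<in> H t"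
        unfolding R\<mu>N.mlin_diff[OF q \<alpha>c[OF y(1)] u1] qu .
      have c: "?q (\<alpha> y) \<in> carrier N" "f y \<in> carrier N" "w k \<in> carrier N"
        using mlin_closed[OF q\<alpha> y(1)] mlin_closed[OF f(1) y(1)] cV[OF wV k] by auto
      have eq: "(?q (\<alpha> y) \<ominus>\<^bsub>N\<^esub> w k) \<ominus>\<^bsub>N\<^esub> (?q (\<alpha> y) \<ominus>\<^bsub>N\<^esub> f y) = f y \<ominus>\<^bsub>N\<^esub> w k"
        using c by (simp add: cod.M.minus_eq cod.M.minus_add cod.M.a_ac cod.M.r_neg1 cod.M.r_neg2 cod.M.r_neg)
      show ?thesis unfolding res_u fy using cod.submodule_minus[OF Ht 1 f(3)[OF y(1)]] unfolding eq .
    qed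
    moreover have "u i = \<zero>\<^bsub>N\<^esub>" if "r \<le> i" "i < \<mu>" for i using that by (simp add: u_def)
    ultimately have "(w, u) \<in> \<Gamma>" using wV uV unfolding \<Gamma>_def by blast
    moreover have "u i \<in> S" if i: "i < \<mu>" for i
      unfolding S_def
    proof (intro CollectI conjI ballI)
      show "u i \<in> carrier N" by (rule cV[OF uV i])
      fix a assume a: "a \<in> max_ideal R"
      have ac: "a \<in> carrier R" by (rule m.Icarr[OF a])
      show "a \<odot>\<^bsub>N\<^esub> u i \<in> H t"
      proof (cases "i < r")
        case False
        then show ?thesis using i ac cod.submodule_zero[OF Ht] by (simp add: u_def)
      next
        case True
        \<comment> \<open>Since \<open>a\<close> kills \<open>w\<close> modulo \<open>H t\<close>,
          the homomorphism of \<open>a u'\<close> has values in \<open>H t\<close>, and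
          \<open>hom_into_regular_chain_power\<close> transfers this to the entries of the
          vector.\<close>
        note au' = P.smult_closed[OF ac u']
        have "(a \<odot>\<^bsub>?P\<^esub> u') i \<in> H t"
        proof (rule hom_into_regular_chain_power[OF chain van ts au' _ True])
          fix y' assume "y' \<in> carrier M"
          then obtain y where y: "y \<in> carrier (F 0)" "y' = e y" using e_surj by blast
          have fc: "f y \<in> carrier N" and qc: "?q (\<alpha> y) \<in> carrier N"
            using mlin_closed[OF f(1) y(1)] mlin_closed[OF q\<alpha> y(1)] by auto
          have "?q (a \<odot>\<^bsub>free_module R \<mu>\<^esub> \<alpha> y) \<in> H t"
          proof (rule cod.lincomb_in_submodule[OF Ht])
            fix j assume j: "j < \<mu>"
            have \<alpha>j: "\<alpha> y j \<in> carrier R" using \<alpha>c[OF y(1)] j by (auto simp: module_power_simps(1))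
            have "a \<odot>\<^bsub>N\<^esub> w j \<in> H t" "w j \<in> carrier N" using wS[OF j] a by (auto simp: S_def)
            then show "(a \<odot>\<^bsub>free_module R \<mu>\<^esub> \<alpha> y) j \<odot>\<^bsub>N\<^esub> w j \<in> H t"
              using cod.submoduleE(4)[OF Ht \<alpha>j] j ac \<alpha>j
              by (simp add: module_power_smult cod.smult_assoc1 cod.smult_commute[of a])
          qed
          then have 1: "a \<odot>\<^bsub>N\<^esub> ?q (\<alpha> y) \<in> H t" using mlin_smult[OF q ac \<alpha>c[OF y(1)]] by simp
          have eq: "a \<odot>\<^bsub>N\<^esub> ?q (\<alpha> y) \<ominus>\<^bsub>N\<^esub> a \<odot>\<^bsub>N\<^esub> (?q (\<alpha> y) \<ominus>\<^bsub>N\<^esub> f y) = a \<odot>\<^bsub>N\<^esub> f y"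
            using ac fc qc
            by (simp add: cod.smult_r_diff) (simp add: cod.M.minus_eq cod.M.minus_add cod.M.r_neg2)
          have "a \<odot>\<^bsub>N\<^esub> f y \<in> H t"
            using cod.submodule_minus[OF Ht 1 cod.submoduleE(4)[OF Ht ac f(3)[OF y(1)]]] unfolding eq .
          then show "\<Phi> (a \<odot>\<^bsub>?P\<^esub> u') y' \<in> H t"
            using Phi_smult[OF ac u' ec[OF y(1)]] u'h[OF ec[OF y(1)]] h(2)[OF y(1)] y(2) by simp
        qed
        then show ?thesis using True i by (simp add: u_def module_power_smult)
      qed
    qed
    then have "u \<in> W" using uV by (simp add: W_def)
    ultimately show ?thesis by blast
  qed

  \<comment> \<open>The test vector has \<sigma> in the last place, where every \<open>u\<close> in
    the correspondence is 0.\<close>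
  let ?z = "single N \<mu> (\<mu> - 1) \<sigma>"
  have S0: "\<zero>\<^bsub>N\<^esub> \<in> S" using m.Icarr cod.submodule_zero[OF Ht] by (auto simp: S_def)
  have z: "?z \<in> W"
    using cod.single_closed[OF \<sigma>(1)] S0 \<sigma> by (auto simp: W_def S_def single_def)
  obtain c w u b where cw: "c \<in> carrier R" "c \<notin> max_ideal R" "(w, u) \<in> \<Gamma>" "b \<in> B" "c \<odot>\<^bsub>?V\<^esub> ?z = u \<oplus>\<^bsub>?V\<^esub> b"
  proof (rule V.generic_surjectivity[OF dom.R.maximalideal_prime[OF L.max_ideal_maximal] B, of \<Gamma> W ?z])
    show "(\<zero>\<^bsub>?V\<^esub>, \<zero>\<^bsub>?V\<^esub>) \<in> \<Gamma>"
    proof -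
      have r0: "?res \<zero>\<^bsub>?V\<^esub> = \<zero>\<^bsub>?P\<^esub>" using r\<mu> by (auto simp: module_power_zero fun_eq_iff)
      have "\<Phi> (?res \<zero>\<^bsub>?V\<^esub>) (g k) \<ominus>\<^bsub>N\<^esub> \<zero>\<^bsub>?V\<^esub> k \<in> H t" if "k < \<mu>" for k
        unfolding r0 Phi_zero[OF gc[OF that]] using that cod.submodule_zero[OF Ht]
        by (simp add: module_power_zero cod.diff_zero)
      then show ?thesis unfolding \<Gamma>_def using V.M.zero_closed by (simp add: module_power_zero)
    qed
  next
    fix w u w' u' assume 1: "(w, u) \<in> \<Gamma>" and 2: "(w', u') \<in> \<Gamma>"
    have V: "w \<in> carrier ?V" "u \<in> carrier ?V" "w' \<in> carrier ?V" "u' \<in> carrier ?V"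
      using 1 2 by (auto simp: \<Gamma>_def)
    have "\<Phi> (?res (u \<oplus>\<^bsub>?V\<^esub> u')) (g k) \<ominus>\<^bsub>N\<^esub> (w \<oplus>\<^bsub>?V\<^esub> w') k \<in> H t" if k: "k < \<mu>" for k
    proof -
      have "\<Phi> (?res (u \<oplus>\<^bsub>?V\<^esub> u')) (g k) = \<Phi> (?res u) (g k) \<oplus>\<^bsub>N\<^esub> \<Phi> (?res u') (g k)"
        unfolding mlin_add[OF res V(2,4)]
        by (rule Phi_add[OF mlin_closed[OF res V(2)] mlin_closed[OF res V(4)] gc[OF k]])
      moreover have "(w \<oplus>\<^bsub>?V\<^esub> w') k = w k \<oplus>\<^bsub>N\<^esub> w' k" using k by (simp add: module_power_add)
      ultimately have "\<Phi> (?res (u \<oplus>\<^bsub>?V\<^esub> u')) (g k) \<ominus>\<^bsub>N\<^esub> (w \<oplus>\<^bsub>?V\<^esub> w') k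
          = (\<Phi> (?res u) (g k) \<ominus>\<^bsub>N\<^esub> w k) \<oplus>\<^bsub>N\<^esub> (\<Phi> (?res u') (g k) \<ominus>\<^bsub>N\<^esub> w' k)"
        using \<Phi>c[OF V(2) k] \<Phi>c[OF V(4) k] cV[OF V(1) k] cV[OF V(3) k] by (simp add: cod.add_diff_add)
      also have "\<dots> \<in> H t"
        by (rule cod.submoduleE(5)[OF Ht]) (use 1 2 k in \<open>auto simp: \<Gamma>_def\<close>)
      finally show ?thesis .
    qed
    moreover have zero: "(u \<oplus>\<^bsub>?V\<^esub> u') i = \<zero>\<^bsub>N\<^esub>" if "r \<le> i" "i < \<mu>" for i
      using 1 2 that by (simp add: \<Gamma>_def module_power_add)
    ultimately show "(w \<oplus>\<^bsub>?V\<^esub> w', u \<oplus>\<^bsub>?V\<^esub> u') \<in> \<Gamma>"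
      using zero V.M.a_closed[OF V(1,3)] V.M.a_closed[OF V(2,4)] unfolding \<Gamma>_def by blast
  next
    fix a w u assume a: "a \<in> carrier R" and 1: "(w, u) \<in> \<Gamma>"
    have V: "w \<in> carrier ?V" "u \<in> carrier ?V" using 1 by (auto simp: \<Gamma>_def)
    have "\<Phi> (?res (a \<odot>\<^bsub>?V\<^esub> u)) (g k) \<ominus>\<^bsub>N\<^esub> (a \<odot>\<^bsub>?V\<^esub> w) k \<in> H t" if k: "k < \<mu>" for k
    proof -
      have "\<Phi> (?res (a \<odot>\<^bsub>?V\<^esub> u)) (g k) = a \<odot>\<^bsub>N\<^esub> \<Phi> (?res u) (g k)"
        unfolding mlin_smult[OF res a V(2)]
        by (rule Phi_smult[OF a mlin_closed[OF res V(2)] gc[OF k]])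
      moreover have "(a \<odot>\<^bsub>?V\<^esub> w) k = a \<odot>\<^bsub>N\<^esub> w k" using k by (simp add: module_power_smult)
      ultimately have "\<Phi> (?res (a \<odot>\<^bsub>?V\<^esub> u)) (g k) \<ominus>\<^bsub>N\<^esub> (a \<odot>\<^bsub>?V\<^esub> w) k
          = a \<odot>\<^bsub>N\<^esub> (\<Phi> (?res u) (g k) \<ominus>\<^bsub>N\<^esub> w k)"
        using \<Phi>c[OF V(2) k] cV[OF V(1) k] a by (simp add: cod.smult_r_diff)
      also have "\<dots> \<in> H t"
        by (rule cod.submoduleE(4)[OF Ht a]) (use 1 k in \<open>auto simp: \<Gamma>_def\<close>)
      finally show ?thesis .
    qed
    moreover have "(a \<odot>\<^bsub>?V\<^esub> u) i = \<zero>\<^bsub>N\<^esub>" if "r \<le> i" "i < \<mu>" for i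
      using 1 that a by (simp add: \<Gamma>_def module_power_smult)
    ultimately show "(a \<odot>\<^bsub>?V\<^esub> w, a \<odot>\<^bsub>?V\<^esub> u) \<in> \<Gamma>"
      using V.smult_closed[OF a V(1)] V.smult_closed[OF a V(2)] unfolding \<Gamma>_def by blast
  next
    fix a w assume a: "a \<in> max_ideal R" and w: "w \<in> W"
    have "(a \<odot>\<^bsub>?V\<^esub> w) i \<in> H t" if "i < \<mu>" for i
      using a w that by (auto simp: W_def S_def module_power_smult)
    then show "a \<odot>\<^bsub>?V\<^esub> w \<in> B"
      using V.smult_closed[OF m.Icarr[OF a], of w] w by (simp add: B_def W_def)
  next
    fix w u assume 1: "(w, u) \<in> \<Gamma>" and u: "u \<in> B"
    have V: "w \<in> carrier ?V" "u \<in> carrier ?V" using 1 by (auto simp: \<Gamma>_def)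
    have "w k \<in> H t" if k: "k < \<mu>" for k
    proof -
      have 2: "\<Phi> (?res u) (g k) \<in> H t"
        by (rule Phi_regular_chain[OF chain gc[OF k] order_refl mlin_closed[OF res V(2)]])
          (use u r\<mu> in \<open>simp add: B_def\<close>)
      have 3: "\<Phi> (?res u) (g k) \<ominus>\<^bsub>N\<^esub> w k \<in> H t" using 1 k by (auto simp: \<Gamma>_def)
      have eq: "\<Phi> (?res u) (g k) \<ominus>\<^bsub>N\<^esub> (\<Phi> (?res u) (g k) \<ominus>\<^bsub>N\<^esub> w k) = w k"
        using \<Phi>c[OF V(2) k] cV[OF V(1) k] by (simp add: cod.M.minus_eq cod.M.minus_add cod.M.r_neg2)
      show ?thesis using cod.submodule_minus[OF Ht 2 3] unfolding eq .
    qed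
    then show "w \<in> B" using V by (simp add: B_def)
  next
    fix w assume "w \<in> W" then show "\<exists>u\<in>W. (w, u) \<in> \<Gamma>" by (rule total)
  next
    fix w u assume "(w, u) \<in> \<Gamma>" then show "w \<in> carrier ?V \<and> u \<in> carrier ?V" by (auto simp: \<Gamma>_def)
  next
    show "W \<subseteq> carrier ?V" by (auto simp: W_def)
    show "?z \<in> W" by (rule z)
  qed
  \<comment> \<open>In the last place the equation says that \<open>c\<close> times \<sigma> is in
    \<open>H t\<close>, and \<open>c\<close> is a unit.\<close>
  have l: "\<mu> - 1 < \<mu>" "r \<le> \<mu> - 1" using r\<mu> by auto
  have "u (\<mu> - 1) = \<zero>\<^bsub>N\<^esub>" using cw(3) l by (auto simp: \<Gamma>_def)
  moreover have bH: "b (\<mu> - 1) \<in> H t" using cw(4) l by (auto simp: B_def)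
  moreover have "c \<odot>\<^bsub>N\<^esub> \<sigma> = u (\<mu> - 1) \<oplus>\<^bsub>N\<^esub> b (\<mu> - 1)"
    using fun_cong[OF cw(5), of "\<mu> - 1"] l(1) by (simp add: module_power_simps single_def)
  ultimately have c\<sigma>: "c \<odot>\<^bsub>N\<^esub> \<sigma> \<in> H t" using cod.submodule_carrier[OF Ht bH] by simp
  obtain c' where c': "c' \<in> carrier R" "c' \<otimes>\<^bsub>R\<^esub> c = \<one>\<^bsub>R\<^esub>"
    using L.unit_if_not_in_max_ideal[OF cw(1,2)] by blast
  have "c' \<odot>\<^bsub>N\<^esub> (c \<odot>\<^bsub>N\<^esub> \<sigma>) = \<sigma>"
    using c' cw(1) \<sigma>(1) by (simp flip: cod.smult_assoc1)
  then show False using cod.submoduleE(4)[OF Ht c'(1) c\<sigma>] \<sigma>(2) by simp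
qed

end

section \<open>Evaluation at generators is surjective\<close>

text \<open>For finitely generated \<open>N\<close> every prime over the annihilator is in the
  support: if all fractions \<open>x/1\<close> vanish at \<open>q\<close>, one scalar outside
  \<open>q\<close> kills all generators, and it lies in the annihilator.\<close>

lemma Min_Supp_minimal:
  fixes R (structure)
  assumes fg: "fin_gen_module R N" and p: "p \<in> Min_Supp R N" and q: "primeideal q R" "q \<subseteq> p"
    and ann: "annihilator R N \<subseteq> q"
  shows "q = p"
proof -
  interpret module R N using fg by (simp add: fin_gen_module_def)
  interpret q: primeideal q R by fact
  let ?S = "carrier R - q"
  have one: "\<one> \<in> ?S" using q.one_imp_carrier q.I_notcarr by auto
  have "q \<in> Supp R N"
  proof (rule ccontr)
    assume "q \<notin> Supp R N"
    then have triv: "carrier (localization R N ?S) = {\<zero>\<^bsub>localization R N ?S\<^esub>}"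
      using q(1) by (simp add: Supp_def)
    have kill: "\<exists>s\<in>?S. s \<odot>\<^bsub>N\<^esub> x = \<zero>\<^bsub>N\<^esub>" if x: "x \<in> carrier N" for x
    proof -
      have "fraction_rel N ?S `` {(x, \<one>)} \<in> carrier (localization R N ?S)"
        using x one by (auto simp: localization_def quotient_def)
      then have "fraction_rel N ?S `` {(x, \<one>)} = fraction_rel N ?S `` {(\<zero>\<^bsub>N\<^esub>, \<one>)}"
        unfolding triv by (simp add: localization_def)
      moreover have "(x, \<one>) \<in> fraction_rel N ?S `` {(x, \<one>)}"
        using x one by (auto simp: fraction_rel_def)
      ultimately have "((\<zero>\<^bsub>N\<^esub>, \<one>), (x, \<one>)) \<in> fraction_rel N ?S" by blast
      then obtain s where "s \<in> ?S" "s \<odot>\<^bsub>N\<^esub> (\<one> \<odot>\<^bsub>N\<^esub> \<zero>\<^bsub>N\<^esub>) = s \<odot>\<^bsub>N\<^esub> (\<one> \<odot>\<^bsub>N\<^esub> x)"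
        unfolding fraction_rel_def by blast
      then show ?thesis using x by (intro bexI[of _ s]) auto
    qed
    obtain A where A: "finite A" "A \<subseteq> carrier N" "mod_span R N A = carrier N"
      using fg by (auto simp: fin_gen_module_def)
    let ?c = "colon R N {\<zero>\<^bsub>N\<^esub>}"
    have "\<exists>s\<in>?S. \<forall>I\<in>?c ` A. s \<in> I"
    proof (rule R.prime_avoids_finite[OF q(1)])
      show "ideal I R \<and> \<not> I \<subseteq> q" if I: "I \<in> ?c ` A" for I
      proof -
        obtain a where a: "a \<in> A" "I = ?c a" using I by auto
        have "a \<in> carrier N" using a A(2) by auto
        then show ?thesis using kill[of a] colon_ideal[OF submodule_zero_singleton, of a] a(2)
          by (auto simp: colon_def)
      qed
    qed (use A in auto)
    then obtain s where s: "s \<in> carrier R" "s \<notin> q" "\<And>a. a \<in> A \<Longrightarrow> s \<odot>\<^bsub>N\<^esub> a = \<zero>\<^bsub>N\<^esub>"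
      by (auto simp: colon_def)
    have "submodule {x \<in> carrier N. s \<odot>\<^bsub>N\<^esub> x = \<zero>\<^bsub>N\<^esub>} R N"
      by (rule submodule_subI) (use s(1) in \<open>auto simp: smult_r_distr smult_commute[of s]\<close>)
    then have "mod_span R N A \<subseteq> {x \<in> carrier N. s \<odot>\<^bsub>N\<^esub> x = \<zero>\<^bsub>N\<^esub>}"
      by (rule span_least) (use A(2) s(3) in auto)
    then have "s \<in> annihilator R N" using A(3) s(1) by (auto simp: annihilator_def)
    then show False using ann s(2) by blast
  qed
  then show ?thesis using p q(2) by (auto simp: Min_Supp_def)
qed

text \<open>Localized at a prime \<open>p\<close> minimal over the annihilator, \<open>M\<close> has finite length, so its injective
  endomorphism \<open>\<psi>\<close> is surjective there. A maximal submodule \<open>G\<close> on which this holds is found by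
  Noetherian induction and enlarged by one layer killed by \<open>p\<close>.\<close>

lemma (in noetherian_module) injective_endo_generically_surjective:
  assumes noeth: "noetherian_ring R" and p: "primeideal p R"
    and min: "\<And>q. primeideal q R \<Longrightarrow> q \<subseteq> p \<Longrightarrow> annihilator R M \<subseteq> q \<Longrightarrow> q = p"
    and \<psi>: "mlin R M M \<psi>" and inj: "\<And>v. v \<in> carrier M \<Longrightarrow> \<psi> v = \<zero>\<^bsub>M\<^esub> \<Longrightarrow> v = \<zero>\<^bsub>M\<^esub>"
    and z: "z \<in> carrier M"
  obtains c v where "c \<in> carrier R" "c \<notin> p" "v \<in> carrier M" "c \<odot>\<^bsub>M\<^esub> z = \<psi> v"
proof -
  interpret MM: module_pair R M M by unfold_locales
  interpret p: primeideal p R by fact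
  have one: "\<one> \<notin> p" using p.one_imp_carrier p.I_notcarr by auto
  note \<psi>c = mlin_closed[OF \<psi>]
  have mult: "a \<otimes> b \<notin> p" if "a \<in> carrier R" "b \<in> carrier R" "a \<notin> p" "b \<notin> p" for a b
    using p.I_prime[of a b] that by blast
  \<comment> \<open>Saturation says that scalars outside \<open>p\<close> act injectively on the
    quotient by \<open>G\<close>; two-way stability says that \<psi> is defined and injective on
    that quotient. The last clause is surjectivity at \<open>p\<close> onto
    \<open>G\<close>.\<close>
  define good where "good = (\<lambda>G. submodule G R M
    \<and> (\<forall>s\<in>carrier R - p. \<forall>v\<in>carrier M. s \<odot>\<^bsub>M\<^esub> v \<in> G \<longrightarrow> v \<in> G)
    \<and> (\<forall>v\<in>carrier M. \<psi> v \<in> G \<longleftrightarrow> v \<in> G)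
    \<and> (\<forall>z\<in>G. \<exists>c\<in>carrier R - p. c \<odot>\<^bsub>M\<^esub> z \<in> \<psi> ` carrier M))"
  \<comment> \<open>The kernel of the localization at \<open>p\<close>, which is the smallest
    saturated submodule.\<close>
  let ?G0 = "{v \<in> carrier M. \<exists>s\<in>carrier R - p. s \<odot>\<^bsub>M\<^esub> v = \<zero>\<^bsub>M\<^esub>}"
  have "good ?G0"
    unfolding good_def
  proof (intro conjI ballI impI iffI)
    show "submodule ?G0 R M"
    proof (rule submodule_subI)
      show "\<zero>\<^bsub>M\<^esub> \<in> ?G0" using one by (auto intro!: bexI[of _ \<one>])
      fix x y assume "x \<in> ?G0" "y \<in> ?G0"
      then obtain s s' where s: "s \<in> carrier R" "s \<notin> p" "s \<odot>\<^bsub>M\<^esub> x = \<zero>\<^bsub>M\<^esub>" "x \<in> carrier M"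
        "s' \<in> carrier R" "s' \<notin> p" "s' \<odot>\<^bsub>M\<^esub> y = \<zero>\<^bsub>M\<^esub>" "y \<in> carrier M" by blast
      have "(s' \<otimes> s) \<odot>\<^bsub>M\<^esub> x = \<zero>\<^bsub>M\<^esub>" using s by (simp add: smult_assoc1)
      moreover have "(s' \<otimes> s) \<odot>\<^bsub>M\<^esub> y = \<zero>\<^bsub>M\<^esub>" using s by (subst R.m_comm) (simp_all add: smult_assoc1)
      ultimately have "(s' \<otimes> s) \<odot>\<^bsub>M\<^esub> (x \<oplus>\<^bsub>M\<^esub> y) = \<zero>\<^bsub>M\<^esub>" using s by (simp add: smult_r_distr)
      then show "x \<oplus>\<^bsub>M\<^esub> y \<in> ?G0" using s mult[of s' s] by blast
    next
      fix a x assume "a \<in> carrier R" "x \<in> ?G0"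
      then obtain s where s: "s \<in> carrier R - p" "s \<odot>\<^bsub>M\<^esub> x = \<zero>\<^bsub>M\<^esub>" "x \<in> carrier M" by blast
      then have "s \<odot>\<^bsub>M\<^esub> (a \<odot>\<^bsub>M\<^esub> x) = \<zero>\<^bsub>M\<^esub>"
        using \<open>a \<in> carrier R\<close> smult_commute[of s a x] by simp
      then show "a \<odot>\<^bsub>M\<^esub> x \<in> ?G0" using s \<open>a \<in> carrier R\<close> by blast
    qed (rule Collect_subset)
    show "v \<in> ?G0" if sv: "s \<in> carrier R - p" "v \<in> carrier M" "s \<odot>\<^bsub>M\<^esub> v \<in> ?G0" for s v
    proof -
      obtain s' where s': "s' \<in> carrier R" "s' \<notin> p" "s' \<odot>\<^bsub>M\<^esub> (s \<odot>\<^bsub>M\<^esub> v) = \<zero>\<^bsub>M\<^esub>" using sv by blast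
      have "(s' \<otimes> s) \<odot>\<^bsub>M\<^esub> v = \<zero>\<^bsub>M\<^esub>" using s' sv by (simp add: smult_assoc1)
      then show ?thesis using s' sv mult[of s' s] by blast
    qed
    show "v \<in> ?G0" if v: "v \<in> carrier M" "\<psi> v \<in> ?G0" for v
    proof -
      obtain s where s: "s \<in> carrier R" "s \<notin> p" "s \<odot>\<^bsub>M\<^esub> \<psi> v = \<zero>\<^bsub>M\<^esub>" using v by blast
      then have "s \<odot>\<^bsub>M\<^esub> v = \<zero>\<^bsub>M\<^esub>" using inj[of "s \<odot>\<^bsub>M\<^esub> v"] mlin_smult[OF \<psi> s(1) v(1)] v(1) by simp
      then show ?thesis using s v by blast
    qed
    show "\<psi> v \<in> ?G0" if v: "v \<in> carrier M" "v \<in> ?G0" for v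
    proof -
      obtain s where s: "s \<in> carrier R" "s \<notin> p" "s \<odot>\<^bsub>M\<^esub> v = \<zero>\<^bsub>M\<^esub>" using v by blast
      then have "s \<odot>\<^bsub>M\<^esub> \<psi> v = \<zero>\<^bsub>M\<^esub>"
        using mlin_smult[OF \<psi> s(1) v(1)] MM.mlin_zero[OF \<psi>] by simp
      then show ?thesis using s \<psi>c[OF v(1)] by blast
    qed
    show "\<exists>c\<in>carrier R - p. c \<odot>\<^bsub>M\<^esub> z \<in> \<psi> ` carrier M" if z: "z \<in> ?G0" for z
    proof -
      obtain s where s: "s \<in> carrier R" "s \<notin> p" "s \<odot>\<^bsub>M\<^esub> z = \<zero>\<^bsub>M\<^esub>" using z by blast
      have "\<zero>\<^bsub>M\<^esub> \<in> \<psi> ` carrier M" using MM.mlin_zero[OF \<psi>] by force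
      then show ?thesis using s by (intro bexI[of _ s]) auto
    qed
  qed
  then have ne: "Collect good \<noteq> {}" by blast
  have "\<exists>G\<in>Collect good. \<forall>H\<in>Collect good. G \<subseteq> H \<longrightarrow> H = G"
    by (rule submodule_maximal[OF ne]) (simp add: good_def)
  then obtain G where "good G" and max: "\<And>H. good H \<Longrightarrow> G \<subseteq> H \<Longrightarrow> H = G" by blast
  then have G: "submodule G R M" and Gsat: "\<forall>s\<in>carrier R - p. \<forall>v\<in>carrier M. s \<odot>\<^bsub>M\<^esub> v \<in> G \<longrightarrow> v \<in> G"
    and G\<psi>: "\<forall>v\<in>carrier M. \<psi> v \<in> G \<longleftrightarrow> v \<in> G"
    and Gsurj: "\<forall>z\<in>G. \<exists>c\<in>carrier R - p. c \<odot>\<^bsub>M\<^esub> z \<in> \<psi> ` carrier M"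
    unfolding good_def by simp_all
  have "G = carrier M"
  proof (rule ccontr)
    assume "G \<noteq> carrier M"
    then obtain v where v: "v \<in> carrier M" "v \<notin> G" using submodule_carrier[OF G] by blast
    obtain b where b: "b \<in> carrier R" "b \<odot>\<^bsub>M\<^esub> v \<notin> G" "primeideal (colon R M G (b \<odot>\<^bsub>M\<^esub> v)) R"
      using exists_prime_colon[OF noeth G v] by blast
    let ?y = "b \<odot>\<^bsub>M\<^esub> v"
    have y: "?y \<in> carrier M" using b v by simp
    \<comment> \<open>Saturation puts this prime inside \<open>p\<close>; as it contains the
      annihilator, minimality of \<open>p\<close> forces equality.\<close>
    have "colon R M G ?y = p"
    proof (rule min[OF b(3)])
      show "colon R M G ?y \<subseteq> p" using Gsat y b(2) unfolding colon_def by blast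
      show "annihilator R M \<subseteq> colon R M G ?y"
        using y submodule_zero[OF G] by (auto simp: annihilator_def colon_def)
    qed
    then have py: "a \<odot>\<^bsub>M\<^esub> ?y \<in> G" if "a \<in> p" for a using that by (auto simp: colon_def)
    \<comment> \<open>The next layer: the elements that \<open>p\<close> carries into
      \<open>G\<close>. It is strictly larger, since it contains \<open>?y\<close>.\<close>
    let ?G' = "{v \<in> carrier M. \<forall>a\<in>p. a \<odot>\<^bsub>M\<^esub> v \<in> G}"
    have GG': "G \<subseteq> ?G'" using submodule_carrier[OF G] submoduleE(4)[OF G] p.Icarr by blast
    have "good ?G'"
      unfolding good_def
    proof (intro conjI ballI impI)
      show "submodule ?G' R M"
      proof (rule submodule_subI)
        show "\<zero>\<^bsub>M\<^esub> \<in> ?G'" using GG' submodule_zero[OF G] by blast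
        show "x \<oplus>\<^bsub>M\<^esub> y \<in> ?G'" if "x \<in> ?G'" "y \<in> ?G'" for x y
          using that submoduleE(5)[OF G] p.Icarr by (simp add: smult_r_distr)
        show "a \<odot>\<^bsub>M\<^esub> x \<in> ?G'" if "a \<in> carrier R" "x \<in> ?G'" for a x
          using that submoduleE(4)[OF G] p.Icarr by (simp add: smult_commute[of _ a])
      qed (rule Collect_subset)
      show "v \<in> ?G'" if sv: "s \<in> carrier R - p" "v \<in> carrier M" "s \<odot>\<^bsub>M\<^esub> v \<in> ?G'" for s v
      proof -
        have "a \<odot>\<^bsub>M\<^esub> v \<in> G" if a: "a \<in> p" for a
        proof -
          have "s \<odot>\<^bsub>M\<^esub> (a \<odot>\<^bsub>M\<^esub> v) \<in> G"
            using sv a p.Icarr[OF a] smult_commute[of s a v] by simp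
          then show ?thesis using Gsat sv smult_closed[OF p.Icarr[OF a] sv(2)] by blast
        qed
        then show ?thesis using sv by simp
      qed
      show "\<psi> v \<in> ?G' \<longleftrightarrow> v \<in> ?G'" if v: "v \<in> carrier M" for v
      proof -
        have "a \<odot>\<^bsub>M\<^esub> \<psi> v \<in> G \<longleftrightarrow> a \<odot>\<^bsub>M\<^esub> v \<in> G" if a: "a \<in> p" for a
          using G\<psi> mlin_smult[OF \<psi> p.Icarr[OF a] v] smult_closed[OF p.Icarr[OF a] v] by metis
        then show ?thesis using v \<psi>c[OF v] by blast
      qed
      then have \<psi>G': "\<psi> v \<in> ?G' \<longleftrightarrow> v \<in> ?G'" if "v \<in> carrier M" for v using that by blast
      show "\<exists>c\<in>carrier R - p. c \<odot>\<^bsub>M\<^esub> z \<in> \<psi> ` carrier M" if z: "z \<in> ?G'" for z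
      proof -
        \<comment> \<open>Here the correspondence is the graph of \<psi>, applied to the layer
          \<open>?G'\<close> modulo \<open>G\<close>.\<close>
        let ?\<Gamma> = "{(v, \<psi> v) | v. v \<in> carrier M}"
        obtain c x y g where c: "c \<in> carrier R" "c \<notin> p" "(x, y) \<in> ?\<Gamma>" "g \<in> G" "c \<odot>\<^bsub>M\<^esub> z = y \<oplus>\<^bsub>M\<^esub> g"
        proof (rule generic_surjectivity[OF p G, of ?\<Gamma> ?G' z])
          show "(\<zero>\<^bsub>M\<^esub>, \<zero>\<^bsub>M\<^esub>) \<in> ?\<Gamma>" using MM.mlin_zero[OF \<psi>] by force
          show "x \<in> carrier M \<and> y \<in> carrier M" if "(x, y) \<in> ?\<Gamma>" for x y using that \<psi>c by blast
          show "(x \<oplus>\<^bsub>M\<^esub> x', y \<oplus>\<^bsub>M\<^esub> y') \<in> ?\<Gamma>" if "(x, y) \<in> ?\<Gamma>" "(x', y') \<in> ?\<Gamma>" for x y x' y'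
          proof -
            have "x \<in> carrier M" "y = \<psi> x" "x' \<in> carrier M" "y' = \<psi> x'" using that by blast+
            then show ?thesis using mlin_add[OF \<psi>, of x x'] M.a_closed[of x x'] by (auto intro!: exI)
          qed
          show "(a \<odot>\<^bsub>M\<^esub> x, a \<odot>\<^bsub>M\<^esub> y) \<in> ?\<Gamma>" if "a \<in> carrier R" "(x, y) \<in> ?\<Gamma>" for a x y
          proof -
            have "x \<in> carrier M" "y = \<psi> x" using that by blast+
            then show ?thesis using mlin_smult[OF \<psi> that(1), of x] smult_closed[OF that(1), of x] by (auto intro!: exI)
          qed
          show "\<exists>w'\<in>?G'. (w, w') \<in> ?\<Gamma>" if w: "w \<in> ?G'" for w
          proof (rule bexI[of _ "\<psi> w"])
            have wM: "w \<in> carrier M" using w by blast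
            then show "(w, \<psi> w) \<in> ?\<Gamma>" by blast
            show "\<psi> w \<in> ?G'" by (rule iffD2[OF \<psi>G'[OF wM] w])
          qed
          show "a \<odot>\<^bsub>M\<^esub> w \<in> G" if "a \<in> p" "w \<in> ?G'" for a w using that by blast
          show "x \<in> G" if "(x, y) \<in> ?\<Gamma>" "y \<in> G" for x y using that G\<psi> by blast
          show "z \<in> ?G'" by (rule z)
        qed (rule Collect_subset)
        have x: "x \<in> carrier M" "y = \<psi> x" using c(3) by blast+
        \<comment> \<open>The remainder \<open>g\<close> lies in \<open>G\<close>, where
          surjectivity is known; one more factor \<open>c'\<close> absorbs it.\<close>
        obtain c' where c': "c' \<in> carrier R - p" "c' \<odot>\<^bsub>M\<^esub> g \<in> \<psi> ` carrier M"
          using Gsurj c(4) by blast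
        then obtain u where u: "u \<in> carrier M" "c' \<odot>\<^bsub>M\<^esub> g = \<psi> u" by blast
        have c'R: "c' \<in> carrier R" and zM: "z \<in> carrier M" and gM: "g \<in> carrier M"
          using c' z submodule_carrier[OF G c(4)] by blast+
        have "(c' \<otimes> c) \<odot>\<^bsub>M\<^esub> z = c' \<odot>\<^bsub>M\<^esub> (\<psi> x \<oplus>\<^bsub>M\<^esub> g)"
          using c(5) x(2) smult_assoc1[OF c'R c(1) zM] by simp
        also have "\<dots> = c' \<odot>\<^bsub>M\<^esub> \<psi> x \<oplus>\<^bsub>M\<^esub> \<psi> u"
          using smult_r_distr[OF c'R \<psi>c[OF x(1)] gM] u(2) by simp
        also have "\<dots> = \<psi> (c' \<odot>\<^bsub>M\<^esub> x \<oplus>\<^bsub>M\<^esub> u)"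
          using mlin_add[OF \<psi> smult_closed[OF c'R x(1)] u(1)] mlin_smult[OF \<psi> c'R x(1)] by simp
        finally have eq: "(c' \<otimes> c) \<odot>\<^bsub>M\<^esub> z = \<psi> (c' \<odot>\<^bsub>M\<^esub> x \<oplus>\<^bsub>M\<^esub> u)" .
        have "c' \<odot>\<^bsub>M\<^esub> x \<oplus>\<^bsub>M\<^esub> u \<in> carrier M" using c'R x(1) u(1) by simp
        then have "(c' \<otimes> c) \<odot>\<^bsub>M\<^esub> z \<in> \<psi> ` carrier M" unfolding eq by (rule imageI)
        moreover have "c' \<otimes> c \<in> carrier R - p" using c' c(1,2) mult[of c' c] by blast
        ultimately show ?thesis by (rule bexI)
      qed
    qed
    then have "?G' = G" by (rule max[OF _ GG'])
    moreover have "?y \<in> ?G'" using y py by blast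
    ultimately show False using b(2) by blast
  qed
  then obtain c where "c \<in> carrier R - p" "c \<odot>\<^bsub>M\<^esub> z \<in> \<psi> ` carrier M" using Gsurj z by blast
  then show thesis using that by blast
qed

context hom_power
begin

text \<open>The map \<psi> sends \<open>u\<close> to the values of \<open>\<Phi> u\<close> on the
  generators, and its image consists of the vectors that pair to zero with all relations. So the
  claim is surjectivity of \<psi>, tested at an associated prime of its cokernel.\<close>

lemma relations_annihilate:
  assumes noeth: "noetherian_ring R" and fgN: "fin_gen_module R N" and Ass: "Ass R N = Min_Supp R N"
    and gc: "\<And>i. i < r \<Longrightarrow> g i \<in> carrier M"
    and gen: "lincomb M r g ` carrier (free_module R r) = carrier M"
    and \<kappa>: "\<kappa> \<in> carrier (free_module R r)" "lincomb M r g \<kappa> = \<zero>\<^bsub>M\<^esub>"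
    and w: "w \<in> carrier (module_power N r)"
  shows "lincomb N r w \<kappa> = \<zero>\<^bsub>N\<^esub>"
proof -
  let ?V = "module_power N r" and ?\<pi> = "lincomb M r g"
  interpret V: noetherian_module R ?V
    by (rule fin_gen_module_noetherian[OF noeth cod.power_fin_gen[OF fgN]])
  interpret P: noetherian_module R "free_module R r"
    by (rule free_module_noetherian[OF dom.R.is_cring noeth])
  interpret PM: module_pair R "free_module R r" M by unfold_locales
  interpret VV: module_pair R ?V ?V by unfold_locales
  have \<pi>: "mlin R (free_module R r) M ?\<pi>" by (rule dom.lincomb_mlin[OF gc])
  have cV: "u i \<in> carrier N" if "u \<in> carrier ?V" "i < r" for u i
    using PiE_mem[OF that(1)[unfolded module_power_simps(1)], of i] that(2) by simp
  define \<psi> where "\<psi> = (\<lambda>u. \<lambda>i\<in>{..<r}. \<Phi> u (g i))"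
  have \<psi>: "mlin R ?V ?V \<psi>"
  proof (rule mlinI)
    fix u assume u: "u \<in> carrier ?V"
    show "\<psi> u \<in> carrier ?V"
      unfolding \<psi>_def module_power_simps(1) restrict_PiE_iff using mlin_closed[OF Phi_mlin[OF u]] gc by simp
    show "\<psi> (u \<oplus>\<^bsub>?V\<^esub> u') = \<psi> u \<oplus>\<^bsub>?V\<^esub> \<psi> u'" if "u' \<in> carrier ?V" for u'
      unfolding \<psi>_def module_power_add[of N r "restrict _ _"]
      by (rule ext) (simp add: Phi_add[OF u that] gc)
    show "\<psi> (a \<odot>\<^bsub>?V\<^esub> u) = a \<odot>\<^bsub>?V\<^esub> \<psi> u" if "a \<in> carrier R" for a
      unfolding \<psi>_def module_power_smult[of N r a "restrict _ _"]
      by (rule ext) (simp add: Phi_smult[OF that u] gc)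
  qed
  have \<Phi>_lincomb: "\<Phi> u (?\<pi> x) = lincomb N r (\<psi> u) x" if u: "u \<in> carrier ?V" and x: "x \<in> carrier (free_module R r)" for u x
    by (rule mlin_lincomb[OF dom.module_axioms cod.module_axioms Phi_mlin[OF u] gc _ x]) (simp_all add: \<psi>_def)
  have \<psi>_inj: "u = \<zero>\<^bsub>?V\<^esub>" if u: "u \<in> carrier ?V" and u0: "\<psi> u = \<zero>\<^bsub>?V\<^esub>" for u
  proof (rule Phi_inj[OF u V.M.zero_closed])
    fix m assume m: "m \<in> carrier M"
    then obtain x where x: "x \<in> carrier (free_module R r)" "m = ?\<pi> x" using gen by blast
    have "lincomb N r (\<psi> u) x \<in> {\<zero>\<^bsub>N\<^esub>}"
    proof (rule cod.lincomb_in_submodule[OF cod.submodule_zero_singleton])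
      fix i assume i: "i < r"
      have "x i \<in> carrier R"
        using PiE_mem[OF x(1)[unfolded module_power_simps(1)], of i] i by simp
      then show "x i \<odot>\<^bsub>N\<^esub> \<psi> u i \<in> {\<zero>\<^bsub>N\<^esub>}" unfolding u0 using i by (simp add: module_power_zero)
    qed
    then show "\<Phi> u m = \<Phi> \<zero>\<^bsub>?V\<^esub> m" using \<Phi>_lincomb[OF u x(1)] x(2) Phi_zero[OF m] by simp
  qed
  let ?K = "{x \<in> carrier (free_module R r). ?\<pi> x \<in> {\<zero>\<^bsub>M\<^esub>}}"
  have K: "submodule ?K R (free_module R r)"
    by (rule PM.mlin_preimage_submodule[OF \<pi> dom.submodule_zero_singleton])
  have q: "mlin R (free_module R r) N (lincomb N r u)" if "u \<in> carrier ?V" for u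
    by (rule cod.lincomb_mlin[OF cV[OF that]])
  let ?I = "\<psi> ` carrier ?V"
  have I: "submodule ?I R ?V" by (rule VV.mlin_image_submodule[OF \<psi> V.carrier_is_submodule])
  \<comment> \<open>A vector that vanishes on the relations is the list of values on the generators
    of a homomorphism on \<open>M\<close>, and \<Phi> reaches every homomorphism.\<close>
  have mem_I: "u \<in> ?I \<longleftrightarrow> (\<forall>x\<in>?K. lincomb N r u x = \<zero>\<^bsub>N\<^esub>)" if u: "u \<in> carrier ?V" for u
  proof
    assume "u \<in> ?I"
    then obtain u' where u': "u' \<in> carrier ?V" "u = \<psi> u'" by blast
    show "\<forall>x\<in>?K. lincomb N r u x = \<zero>\<^bsub>N\<^esub>"
    proof
      fix x assume x: "x \<in> ?K"
      then have "\<Phi> u' (?\<pi> x) = \<zero>\<^bsub>N\<^esub>" using mlin_zero[OF Phi_mlin[OF u'(1)]] by simp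
      then show "lincomb N r u x = \<zero>\<^bsub>N\<^esub>" using \<Phi>_lincomb[OF u'(1), of x] x u'(2) by simp
    qed
  next
    assume K0: "\<forall>x\<in>?K. lincomb N r u x = \<zero>\<^bsub>N\<^esub>"
    obtain h where h: "mlin R M N h" "\<And>x. x \<in> carrier (free_module R r) \<Longrightarrow> h (?\<pi> x) = lincomb N r u x"
      using mlin_factor[OF P.module_axioms dom.module_axioms cod.module_axioms \<pi> gen q[OF u]] K0 by blast
    obtain u' where u': "u' \<in> carrier ?V" "\<forall>y\<in>carrier M. \<Phi> u' y = h y"
      using Phi_surj[OF h(1)] by blast
    have "\<psi> u' = u"
    proof
      fix i show "\<psi> u' i = u i"
      proof (cases "i < r")
        case True
        have e: "unit_vector R r i \<in> carrier (free_module R r)" by (rule dom.unit_vector_closed)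
        have "?\<pi> (unit_vector R r i) = g i" "lincomb N r u (unit_vector R r i) = u i"
          using dom.lincomb_unit_vector[of r g i] gc True cod.lincomb_unit_vector[of r u i] cV[OF u] by simp_all
        then have "h (g i) = u i" using h(2)[OF e] by simp
        then show ?thesis using u'(2) gc[OF True] True by (simp add: \<psi>_def)
      next
        case False
        then show ?thesis using PiE_arb[OF u[unfolded module_power_simps(1)], of i] by (simp add: \<psi>_def)
      qed
    qed
    then show "u \<in> ?I" using u'(1) by blast
  qed
  have "w \<in> ?I"
  proof (rule ccontr)
    assume "w \<notin> ?I"
    then obtain b where b: "b \<in> carrier R" "b \<odot>\<^bsub>?V\<^esub> w \<notin> ?I" "primeideal (colon R ?V ?I (b \<odot>\<^bsub>?V\<^esub> w)) R"
      using V.exists_prime_colon[OF noeth I w] by blast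
    define y where "y = b \<odot>\<^bsub>?V\<^esub> w"
    define p where "p = colon R ?V ?I y"
    have y: "y \<in> carrier ?V" unfolding y_def by (rule V.smult_closed[OF b(1) w])
    have p: "primeideal p R" using b(3) by (simp add: p_def y_def)
    have qs: "lincomb N r (a \<odot>\<^bsub>?V\<^esub> y) x = a \<odot>\<^bsub>N\<^esub> lincomb N r y x"
      if a: "a \<in> carrier R" and x: "x \<in> carrier (free_module R r)" for a x
    proof (rule sym, rule mlin_lincomb[OF cod.module_axioms cod.module_axioms _ _ _ x])
      interpret NN: module_pair R N N by unfold_locales
      show "mlin R N N (\<lambda>v. a \<odot>\<^bsub>N\<^esub> v)" by (rule NN.mlin_scale[OF a]) (rule mlinI, auto)
    qed (use cV[OF y] in \<open>simp_all add: module_power_smult\<close>)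
    have p_iff: "a \<in> p \<longleftrightarrow> (\<forall>x\<in>?K. a \<odot>\<^bsub>N\<^esub> lincomb N r y x = \<zero>\<^bsub>N\<^esub>)" if a: "a \<in> carrier R" for a
    proof -
      have "a \<in> p \<longleftrightarrow> a \<odot>\<^bsub>?V\<^esub> y \<in> ?I" using a by (simp add: p_def colon_def)
      also have "\<dots> \<longleftrightarrow> (\<forall>x\<in>?K. lincomb N r (a \<odot>\<^bsub>?V\<^esub> y) x = \<zero>\<^bsub>N\<^esub>)"
        by (rule mem_I[OF V.smult_closed[OF a y]])
      also have "\<dots> \<longleftrightarrow> (\<forall>x\<in>?K. a \<odot>\<^bsub>N\<^esub> lincomb N r y x = \<zero>\<^bsub>N\<^esub>)"
        by (rule ball_cong[OF refl]) (use qs[OF a] in simp)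
      finally show ?thesis .
    qed
    obtain A where A: "finite A" "A \<subseteq> ?K" "mod_span R (free_module R r) A = ?K"
      using P.submodule_fg[OF K] by blast
    let ?ann = "\<lambda>x. colon R N {\<zero>\<^bsub>N\<^esub>} (lincomb N r y x)"
    have qc: "lincomb N r y x \<in> carrier N" if "x \<in> ?K" for x using mlin_closed[OF q[OF y]] that by blast
    \<comment> \<open>\<open>p\<close> annihilates exactly the values of \<open>y\<close> on all
      relations, so it is the intersection of the annihilators at the finitely many generators
      \<open>A\<close>. Being prime, it contains one of these and then equals it, which puts it in
      \<open>Ass R N\<close>.\<close>
    have "\<exists>x\<in>A. ?ann x \<subseteq> p"
    proof (rule ccontr)
      assume no: "\<not> (\<exists>x\<in>A. ?ann x \<subseteq> p)"
      have "\<exists>a\<in>carrier R - p. \<forall>J\<in>?ann ` A. a \<in> J"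
      proof (rule dom.R.prime_avoids_finite[OF p])
        fix J assume "J \<in> ?ann ` A"
        then obtain x where x: "x \<in> A" "J = ?ann x" by blast
        have "lincomb N r y x \<in> carrier N" using qc A(2) x(1) by blast
        then show "ideal J R \<and> \<not> J \<subseteq> p"
          using cod.colon_ideal[OF cod.submodule_zero_singleton] no x by blast
      qed (use A(1) in simp)
      then obtain a where a: "a \<in> carrier R" "a \<notin> p" "\<forall>J\<in>?ann ` A. a \<in> J" by blast
      interpret PN: module_pair R "free_module R r" N by unfold_locales
      have "mlin R (free_module R r) N (\<lambda>x. a \<odot>\<^bsub>N\<^esub> lincomb N r y x)"
        by (rule PN.mlin_scale[OF a(1) q[OF y]])
      from PN.mlin_preimage_submodule[OF this cod.submodule_zero_singleton]
      have "mod_span R (free_module R r) A \<subseteq> {x \<in> carrier (free_module R r). a \<odot>\<^bsub>N\<^esub> lincomb N r y x \<in> {\<zero>\<^bsub>N\<^esub>}}"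
        by (rule P.span_least) (use A(2) a(3) in \<open>auto simp: colon_def\<close>)
      then have "a \<in> p" unfolding A(3) p_iff[OF a(1)] by blast
      then show False using a(2) by blast
    qed
    then obtain x where x: "x \<in> A" "?ann x \<subseteq> p" by blast
    have xK: "x \<in> ?K" using x A(2) by blast
    have "p \<subseteq> ?ann x"
    proof
      fix a assume a: "a \<in> p"
      then have aR: "a \<in> carrier R" by (simp add: p_def colon_def)
      then show "a \<in> ?ann x" using p_iff[OF aR] a xK by (simp add: colon_def)
    qed
    then have "p = ?ann x" using x(2) by (rule subset_antisym)
    then have px: "p = {a \<in> carrier R. a \<odot>\<^bsub>N\<^esub> lincomb N r y x = \<zero>\<^bsub>N\<^esub>}"
      unfolding colon_def singleton_iff .
    then have "p \<in> Ass R N" unfolding Ass_def using p qc[OF xK] by blast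
    then have pm: "p \<in> Min_Supp R N" using Ass by simp
    have annV: "annihilator R N \<subseteq> annihilator R ?V"
    proof
      fix a assume a: "a \<in> annihilator R N"
      have "a \<odot>\<^bsub>?V\<^esub> u = \<zero>\<^bsub>?V\<^esub>" if u: "u \<in> carrier ?V" for u
        by (rule ext) (use a cV[OF u] in \<open>simp add: module_power_simps annihilator_def\<close>)
      then show "a \<in> annihilator R ?V" using a by (simp add: annihilator_def)
    qed
    obtain c v where c: "c \<in> carrier R" "c \<notin> p" "v \<in> carrier ?V" "c \<odot>\<^bsub>?V\<^esub> y = \<psi> v"
    proof (rule V.injective_endo_generically_surjective[OF noeth p _ \<psi> \<psi>_inj y])
      show "q' = p" if "primeideal q' R" "q' \<subseteq> p" "annihilator R ?V \<subseteq> q'" for q'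
        by (rule Min_Supp_minimal[OF fgN pm that(1,2)]) (use annV that(3) in blast)
    qed
    \<comment> \<open>\<open>p\<close> is the colon ideal of \<open>y\<close> modulo the image of
      \<psi>, and \<open>c y\<close> has just been found in that image.\<close>
    then have "c \<in> p" by (simp add: p_def colon_def)
    then show False using c(2) by blast
  qed
  then show ?thesis using mem_I[OF w] \<kappa> by simp
qed

end

section \<open>Triviality of the relations\<close>

text \<open>A maximal \<open>p\<close>-saturated proper submodule \<open>H\<close> of \<open>K\<close> has \<open>K / H\<close> torsion-free of rank one over
  \<open>R / p\<close>, and \<open>R / p\<close> embeds into \<open>N\<close> as \<open>R v\<close>.\<close>

lemma (in noetherian_module) exists_nonzero_hom:
  assumes noeth: "noetherian_ring R" and N: "module R N" and p: "primeideal p R"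
    and v: "v \<in> carrier N" "p = {a \<in> carrier R. a \<odot>\<^bsub>N\<^esub> v = \<zero>\<^bsub>N\<^esub>}"
    and K: "submodule K R M" and \<kappa>: "\<kappa> \<in> K" "\<And>s. s \<in> carrier R \<Longrightarrow> s \<notin> p \<Longrightarrow> s \<odot>\<^bsub>M\<^esub> \<kappa> \<noteq> \<zero>\<^bsub>M\<^esub>"
  obtains h z where "mlin R (M\<lparr>carrier := K\<rparr>) N h" "z \<in> K" "h z \<noteq> \<zero>\<^bsub>N\<^esub>"
proof -
  interpret N: module R N by fact
  interpret p: primeideal p R by fact
  have one: "\<one> \<notin> p" using p.one_imp_carrier p.I_notcarr by auto
  note KM = submodule_carrier[OF K]
  have mult: "a \<otimes> b \<notin> p" if "a \<in> carrier R" "b \<in> carrier R" "a \<notin> p" "b \<notin> p" for a b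
    using p.I_prime[of a b] that by blast
  \<comment> \<open>The elements of \<open>K\<close> that fall into \<open>H\<close> after
    localization at \<open>p\<close>.\<close>
  define sat where "sat = (\<lambda>H. {x \<in> K. \<exists>s\<in>carrier R - p. s \<odot>\<^bsub>M\<^esub> x \<in> H})"
  have sat_sub: "submodule (sat H) R M" if H: "submodule H R M" for H
  proof (rule submodule_subI)
    show "sat H \<subseteq> carrier M" using KM by (auto simp: sat_def)
    show "\<zero>\<^bsub>M\<^esub> \<in> sat H"
      using one submodule_zero[OF H] submodule_zero[OF K] by (auto simp: sat_def intro!: bexI[of _ \<one>])
    fix x y assume "x \<in> sat H" "y \<in> sat H"
    then obtain s s' where s: "x \<in> K" "s \<in> carrier R" "s \<notin> p" "s \<odot>\<^bsub>M\<^esub> x \<in> H"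
      "y \<in> K" "s' \<in> carrier R" "s' \<notin> p" "s' \<odot>\<^bsub>M\<^esub> y \<in> H" unfolding sat_def by blast
    have xy: "x \<in> carrier M" "y \<in> carrier M" using s KM by auto
    have "(s' \<otimes> s) \<odot>\<^bsub>M\<^esub> (x \<oplus>\<^bsub>M\<^esub> y) = s' \<odot>\<^bsub>M\<^esub> (s \<odot>\<^bsub>M\<^esub> x) \<oplus>\<^bsub>M\<^esub> s \<odot>\<^bsub>M\<^esub> (s' \<odot>\<^bsub>M\<^esub> y)"
      using s xy smult_commute[of s s' y] by (simp add: smult_r_distr smult_assoc1)
    moreover have "\<dots> \<in> H"
      by (intro submoduleE(4,5)[OF H] s)
    ultimately have "(s' \<otimes> s) \<odot>\<^bsub>M\<^esub> (x \<oplus>\<^bsub>M\<^esub> y) \<in> H" by simp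
    moreover have "s' \<otimes> s \<in> carrier R - p" using s mult[of s' s] by blast
    ultimately show "x \<oplus>\<^bsub>M\<^esub> y \<in> sat H" unfolding sat_def using submoduleE(5)[OF K s(1,5)] by blast
  next
    fix a x assume a: "a \<in> carrier R" and "x \<in> sat H"
    then obtain s where s: "x \<in> K" "s \<in> carrier R - p" "s \<odot>\<^bsub>M\<^esub> x \<in> H" unfolding sat_def by blast
    have "s \<odot>\<^bsub>M\<^esub> (a \<odot>\<^bsub>M\<^esub> x) = a \<odot>\<^bsub>M\<^esub> (s \<odot>\<^bsub>M\<^esub> x)" using s a KM[OF s(1)] smult_commute[of s a x] by simp
    then have "s \<odot>\<^bsub>M\<^esub> (a \<odot>\<^bsub>M\<^esub> x) \<in> H" using submoduleE(4)[OF H a s(3)] by simp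
    then show "a \<odot>\<^bsub>M\<^esub> x \<in> sat H" unfolding sat_def using s(2) submoduleE(4)[OF K a s(1)] by blast
  qed
  have sat_idem: "x \<in> sat H" if H: "x \<in> K" "s \<in> carrier R - p" "s \<odot>\<^bsub>M\<^esub> x \<in> sat H" for H s x
  proof -
    obtain s' where s': "s' \<in> carrier R - p" "s' \<odot>\<^bsub>M\<^esub> (s \<odot>\<^bsub>M\<^esub> x) \<in> H" using H(3) unfolding sat_def by blast
    have "(s' \<otimes> s) \<odot>\<^bsub>M\<^esub> x \<in> H" using s' H KM[OF H(1)] by (simp add: smult_assoc1)
    moreover have "s' \<otimes> s \<in> carrier R - p" using s' H(2) mult[of s' s] by blast
    ultimately show ?thesis unfolding sat_def using H(1) by blast
  qed
  have sat_upper: "x \<in> sat H" if "x \<in> K" "x \<in> H" for x H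
    unfolding sat_def using that one KM by (auto intro!: bexI[of _ \<one>])
  define good where "good = (\<lambda>H. submodule H R M \<and> H \<subseteq> K \<and> H \<noteq> K
    \<and> (\<forall>s\<in>carrier R - p. \<forall>x\<in>K. s \<odot>\<^bsub>M\<^esub> x \<in> H \<longrightarrow> x \<in> H))"
  have good_sat: "good (sat H)" if "submodule H R M" "sat H \<noteq> K" for H
    unfolding good_def using sat_sub[OF that(1)] that(2) sat_idem by (auto simp: sat_def)
  have "\<kappa> \<notin> sat {\<zero>\<^bsub>M\<^esub>}" using \<kappa>(2) unfolding sat_def by blast
  then have "sat {\<zero>\<^bsub>M\<^esub>} \<noteq> K" using \<kappa>(1) by metis
  then have "good (sat {\<zero>\<^bsub>M\<^esub>})" by (rule good_sat[OF submodule_zero_singleton])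
  then have ne: "Collect good \<noteq> {}" by blast
  have "\<exists>G\<in>Collect good. \<forall>H\<in>Collect good. G \<subseteq> H \<longrightarrow> H = G"
    by (rule submodule_maximal[OF ne]) (simp add: good_def)
  then obtain H where "good H" and max: "\<And>G. good G \<Longrightarrow> H \<subseteq> G \<Longrightarrow> G = H" by blast
  then have H: "submodule H R M" and HK: "H \<subseteq> K" "H \<noteq> K"
    and Hsat: "\<And>s x. s \<in> carrier R - p \<Longrightarrow> x \<in> K \<Longrightarrow> s \<odot>\<^bsub>M\<^esub> x \<in> H \<Longrightarrow> x \<in> H"
    unfolding good_def by blast+
  obtain x where x: "x \<in> K" "x \<notin> H" using HK by blast
  obtain b where b: "b \<in> carrier R" "b \<odot>\<^bsub>M\<^esub> x \<notin> H" "primeideal (colon R M H (b \<odot>\<^bsub>M\<^esub> x)) R"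
    using exists_prime_colon[OF noeth H KM[OF x(1)] x(2)] by blast
  define z where "z = b \<odot>\<^bsub>M\<^esub> x"
  have z: "z \<in> K" "z \<notin> H" using b(2) submoduleE(4)[OF K b(1) x(1)] by (simp_all add: z_def)
  note zM = KM[OF z(1)]
  let ?Rz = "\<lambda>y. {a \<odot>\<^bsub>M\<^esub> y | a. a \<in> carrier R}"
  \<comment> \<open>Adjoining one more element to \<open>H\<close> and saturating would otherwise
    give a good submodule strictly above \<open>H\<close>. This is the rank one property.\<close>
  have sat_all: "sat (H <+>\<^bsub>M\<^esub> ?Rz y) = K" if y: "y \<in> K" "y \<notin> H" for y
  proof (rule ccontr)
    assume ne: "sat (H <+>\<^bsub>M\<^esub> ?Rz y) \<noteq> K"
    note C = submodule_cyclic[OF KM[OF y(1)]]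
    note HC = submodule_set_add[OF H C]
    have up: "H \<subseteq> H <+>\<^bsub>M\<^esub> ?Rz y" by (rule set_add_upper1[OF H C])
    have "H \<subseteq> sat (H <+>\<^bsub>M\<^esub> ?Rz y)" using sat_upper HK(1) up by blast
    then have "sat (H <+>\<^bsub>M\<^esub> ?Rz y) = H" by (rule max[OF good_sat[OF HC ne]])
    moreover have "y \<in> ?Rz y" using KM[OF y(1)] by (auto intro!: exI[of _ \<one>])
    then have "y \<in> sat (H <+>\<^bsub>M\<^esub> ?Rz y)"
      by (intro sat_upper[OF y(1)] subsetD[OF set_add_upper2[OF H C]])
    ultimately show False using y(2) by simp
  qed
  \<comment> \<open>If some \<open>a\<close> in \<open>p\<close> moved \<open>z\<close> outside
    \<open>H\<close>, then \<open>s z\<close> would agree modulo \<open>H\<close> with a multiple of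
    \<open>a z\<close>. The scalar \<open>s - c a\<close> is outside \<open>p\<close> but carries
    \<open>z\<close> into \<open>H\<close>, against saturation.\<close>
  have colon_z: "a \<odot>\<^bsub>M\<^esub> z \<in> H \<longleftrightarrow> a \<in> p" if a: "a \<in> carrier R" for a
  proof
    assume az: "a \<odot>\<^bsub>M\<^esub> z \<in> H"
    show "a \<in> p" using Hsat[of a z] az a z by blast
  next
    assume ap: "a \<in> p"
    show "a \<odot>\<^bsub>M\<^esub> z \<in> H"
    proof (rule ccontr)
      assume no: "a \<odot>\<^bsub>M\<^esub> z \<notin> H"
      have "z \<in> sat (H <+>\<^bsub>M\<^esub> ?Rz (a \<odot>\<^bsub>M\<^esub> z))"
        using sat_all[OF submoduleE(4)[OF K a z(1)] no] z(1) by simp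
      then obtain s h c where s: "s \<in> carrier R" "s \<notin> p" "h \<in> H" "c \<in> carrier R"
        "s \<odot>\<^bsub>M\<^esub> z = h \<oplus>\<^bsub>M\<^esub> c \<odot>\<^bsub>M\<^esub> (a \<odot>\<^bsub>M\<^esub> z)"
        unfolding sat_def mem_set_add by blast
      have hM: "h \<in> carrier M" by (rule submodule_carrier[OF H s(3)])
      have "(s \<ominus> c \<otimes> a) \<odot>\<^bsub>M\<^esub> z = h"
        using s a zM hM by (simp add: smult_l_diff smult_assoc1) (simp add: M.minus_eq M.a_assoc M.r_neg)
      then have "(s \<ominus> c \<otimes> a) \<odot>\<^bsub>M\<^esub> z \<in> H" using s(3) by simp
      moreover have "s \<ominus> c \<otimes> a \<notin> p"
      proof
        assume 1: "s \<ominus> c \<otimes> a \<in> p"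
        have 2: "c \<otimes> a \<in> p" by (rule p.I_l_closed[OF ap s(4)])
        have "s = (s \<ominus> c \<otimes> a) \<oplus> c \<otimes> a"
          using s a by (simp add: R.minus_eq R.a_assoc R.l_neg)
        then have "s \<in> p" using p.a_closed[OF 1 2] by metis
        then show False using s(2) by simp
      qed
      ultimately show False using Hsat[of "s \<ominus> c \<otimes> a" z] s a z by blast
    qed
  qed
  note Cz = submodule_cyclic[OF zM]
  note HC = submodule_set_add[OF H Cz]
  obtain A where A: "finite A" "A \<subseteq> K" "mod_span R M A = K" using submodule_fg[OF K] by blast
  \<comment> \<open>As \<open>K\<close> is finitely generated, a single \<open>s\<close> outside
    \<open>p\<close> clears all denominators: \<open>s K\<close> lies in
    \<open>H + R z\<close>.\<close>
  have "\<exists>s\<in>carrier R - p. \<forall>J\<in>colon R M (H <+>\<^bsub>M\<^esub> ?Rz z) ` A. s \<in> J"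
  proof (rule R.prime_avoids_finite[OF p])
    fix J assume "J \<in> colon R M (H <+>\<^bsub>M\<^esub> ?Rz z) ` A"
    then obtain a where a: "a \<in> A" "J = colon R M (H <+>\<^bsub>M\<^esub> ?Rz z) a" by blast
    have aK: "a \<in> K" using a(1) A(2) by blast
    then have "a \<in> sat (H <+>\<^bsub>M\<^esub> ?Rz z)" using sat_all[OF z] by simp
    then have "\<not> J \<subseteq> p" unfolding a(2) sat_def colon_def by blast
    then show "ideal J R \<and> \<not> J \<subseteq> p" using colon_ideal[OF HC KM[OF aK]] a(2) by simp
  qed (use A(1) in simp)
  then obtain s where s: "s \<in> carrier R" "s \<notin> p" "\<forall>J\<in>colon R M (H <+>\<^bsub>M\<^esub> ?Rz z) ` A. s \<in> J" by blast
  have sK: "s \<odot>\<^bsub>M\<^esub> y \<in> H <+>\<^bsub>M\<^esub> ?Rz z" if y: "y \<in> K" for y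
  proof -
    interpret MM: module_pair R M M by unfold_locales
    have "mlin R M M (\<lambda>y. s \<odot>\<^bsub>M\<^esub> y)" by (rule MM.mlin_scale[OF s(1)]) (rule mlinI, auto)
    from MM.mlin_preimage_submodule[OF this HC]
    have "mod_span R M A \<subseteq> {y \<in> carrier M. s \<odot>\<^bsub>M\<^esub> y \<in> H <+>\<^bsub>M\<^esub> ?Rz z}"
    proof (rule span_least)
      show "A \<subseteq> {y \<in> carrier M. s \<odot>\<^bsub>M\<^esub> y \<in> H <+>\<^bsub>M\<^esub> ?Rz z}"
      proof
        fix a assume a: "a \<in> A"
        then have "s \<in> colon R M (H <+>\<^bsub>M\<^esub> ?Rz z) a" using s(3) by simp
        then have "s \<odot>\<^bsub>M\<^esub> a \<in> H <+>\<^bsub>M\<^esub> ?Rz z" unfolding colon_def mem_Collect_eq by (rule conjunct2)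
        moreover have "a \<in> carrier M" using a A(2) KM by auto
        ultimately show "a \<in> {y \<in> carrier M. s \<odot>\<^bsub>M\<^esub> y \<in> H <+>\<^bsub>M\<^esub> ?Rz z}" by (intro CollectI conjI)
      qed
    qed
    then show ?thesis using y A(3) by blast
  qed
  have "\<exists>c\<in>carrier R. s \<odot>\<^bsub>M\<^esub> y \<ominus>\<^bsub>M\<^esub> c \<odot>\<^bsub>M\<^esub> z \<in> H" if y: "y \<in> K" for y
  proof -
    obtain h c where hc: "h \<in> H" "c \<in> carrier R" "s \<odot>\<^bsub>M\<^esub> y = h \<oplus>\<^bsub>M\<^esub> c \<odot>\<^bsub>M\<^esub> z"
      using sK[OF y] unfolding mem_set_add by blast
    have "s \<odot>\<^bsub>M\<^esub> y \<ominus>\<^bsub>M\<^esub> c \<odot>\<^bsub>M\<^esub> z = h"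
      using hc zM submodule_carrier[OF H hc(1)] by (simp add: M.minus_eq M.a_assoc M.r_neg)
    then show ?thesis using hc(1,2) by (intro bexI[of _ c]) simp_all
  qed
  \<comment> \<open>\<open>f y\<close> is a numerator of \<open>y\<close> with respect to
    \<open>z\<close>, determined only modulo \<open>p\<close>. That is enough, because
    \<open>p\<close> is exactly the annihilator of \<open>v\<close>.\<close>
  then obtain f where f: "\<And>y. y \<in> K \<Longrightarrow> f y \<in> carrier R \<and> s \<odot>\<^bsub>M\<^esub> y \<ominus>\<^bsub>M\<^esub> f y \<odot>\<^bsub>M\<^esub> z \<in> H" by metis
  have fR: "f y \<in> carrier R" and fH: "s \<odot>\<^bsub>M\<^esub> y \<ominus>\<^bsub>M\<^esub> f y \<odot>\<^bsub>M\<^esub> z \<in> H" if "y \<in> K" for y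
    using f that by auto
  have uniq: "f y \<odot>\<^bsub>N\<^esub> v = c \<odot>\<^bsub>N\<^esub> v"
    if y: "y \<in> K" and c: "c \<in> carrier R" and ch: "s \<odot>\<^bsub>M\<^esub> y \<ominus>\<^bsub>M\<^esub> c \<odot>\<^bsub>M\<^esub> z \<in> H" for y c
  proof -
    have sy: "s \<odot>\<^bsub>M\<^esub> y \<in> carrier M" "f y \<odot>\<^bsub>M\<^esub> z \<in> carrier M" "c \<odot>\<^bsub>M\<^esub> z \<in> carrier M"
      using s y KM[OF y] fR[OF y] zM c by auto
    have "(s \<odot>\<^bsub>M\<^esub> y \<ominus>\<^bsub>M\<^esub> c \<odot>\<^bsub>M\<^esub> z) \<ominus>\<^bsub>M\<^esub> (s \<odot>\<^bsub>M\<^esub> y \<ominus>\<^bsub>M\<^esub> f y \<odot>\<^bsub>M\<^esub> z) = f y \<odot>\<^bsub>M\<^esub> z \<ominus>\<^bsub>M\<^esub> c \<odot>\<^bsub>M\<^esub> z"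
      by (rule diff_diff_left_cancel[OF sy])
    then have "(f y \<ominus> c) \<odot>\<^bsub>M\<^esub> z \<in> H"
      using submodule_minus[OF H ch fH[OF y]] smult_l_diff[OF fR[OF y] c zM] by simp
    then have "f y \<ominus> c \<in> p" using colon_z[of "f y \<ominus> c"] fR[OF y] c by simp
    then have "(f y \<ominus> c) \<odot>\<^bsub>N\<^esub> v = \<zero>\<^bsub>N\<^esub>" unfolding v(2) by simp
    then show ?thesis
      using N.diff_eq_zeroD[of "f y \<odot>\<^bsub>N\<^esub> v" "c \<odot>\<^bsub>N\<^esub> v"] N.smult_l_diff[OF fR[OF y] c v(1)] fR[OF y] c v(1) by simp
  qed
  have "mlin R (M\<lparr>carrier := K\<rparr>) N (\<lambda>y. f y \<odot>\<^bsub>N\<^esub> v)"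
  proof (rule mlinI)
    fix y assume "y \<in> carrier (M\<lparr>carrier := K\<rparr>)"
    then have y: "y \<in> K" by simp
    show "f y \<odot>\<^bsub>N\<^esub> v \<in> carrier N" using fR[OF y] v(1) by simp
    show "f (y \<oplus>\<^bsub>M\<lparr>carrier := K\<rparr>\<^esub> y') \<odot>\<^bsub>N\<^esub> v = f y \<odot>\<^bsub>N\<^esub> v \<oplus>\<^bsub>N\<^esub> f y' \<odot>\<^bsub>N\<^esub> v"
      if "y' \<in> carrier (M\<lparr>carrier := K\<rparr>)" for y'
    proof -
      have y': "y' \<in> K" using that by simp
      have "s \<odot>\<^bsub>M\<^esub> (y \<oplus>\<^bsub>M\<^esub> y') \<ominus>\<^bsub>M\<^esub> (f y \<oplus> f y') \<odot>\<^bsub>M\<^esub> z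
          = (s \<odot>\<^bsub>M\<^esub> y \<ominus>\<^bsub>M\<^esub> f y \<odot>\<^bsub>M\<^esub> z) \<oplus>\<^bsub>M\<^esub> (s \<odot>\<^bsub>M\<^esub> y' \<ominus>\<^bsub>M\<^esub> f y' \<odot>\<^bsub>M\<^esub> z)"
        using s(1) KM[OF y] KM[OF y'] fR[OF y] fR[OF y'] zM
        by (simp add: smult_r_distr smult_l_distr add_diff_add)
      moreover have "\<dots> \<in> H" by (rule submoduleE(5)[OF H fH[OF y] fH[OF y']])
      ultimately have "f (y \<oplus>\<^bsub>M\<^esub> y') \<odot>\<^bsub>N\<^esub> v = (f y \<oplus> f y') \<odot>\<^bsub>N\<^esub> v"
        by (intro uniq[OF submoduleE(5)[OF K y y']]) (simp_all add: fR[OF y] fR[OF y'])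
      then show ?thesis using N.smult_l_distr[OF fR[OF y] fR[OF y'] v(1)] by simp
    qed
    show "f (a \<odot>\<^bsub>M\<lparr>carrier := K\<rparr>\<^esub> y) \<odot>\<^bsub>N\<^esub> v = a \<odot>\<^bsub>N\<^esub> (f y \<odot>\<^bsub>N\<^esub> v)" if a: "a \<in> carrier R" for a
    proof -
      have "s \<odot>\<^bsub>M\<^esub> (a \<odot>\<^bsub>M\<^esub> y) \<ominus>\<^bsub>M\<^esub> (a \<otimes> f y) \<odot>\<^bsub>M\<^esub> z = a \<odot>\<^bsub>M\<^esub> (s \<odot>\<^bsub>M\<^esub> y \<ominus>\<^bsub>M\<^esub> f y \<odot>\<^bsub>M\<^esub> z)"
        using s(1) KM[OF y] fR[OF y] zM a smult_commute[of s a y] by (simp add: smult_r_diff smult_assoc1)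
      moreover have "\<dots> \<in> H" by (rule submoduleE(4)[OF H a fH[OF y]])
      ultimately have "f (a \<odot>\<^bsub>M\<^esub> y) \<odot>\<^bsub>N\<^esub> v = (a \<otimes> f y) \<odot>\<^bsub>N\<^esub> v"
        by (intro uniq[OF submoduleE(4)[OF K a y]]) (simp_all add: fR[OF y] a)
      then show ?thesis using N.smult_assoc1[OF a fR[OF y] v(1)] by simp
    qed
  qed
  \<comment> \<open>At \<open>z\<close> the numerator may be taken to be \<open>s\<close>, which is
    outside \<open>p\<close>.\<close>
  moreover have "f z \<odot>\<^bsub>N\<^esub> v \<noteq> \<zero>\<^bsub>N\<^esub>"
  proof -
    have "s \<odot>\<^bsub>M\<^esub> z \<ominus>\<^bsub>M\<^esub> s \<odot>\<^bsub>M\<^esub> z \<in> H"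
      using submodule_zero[OF H] s(1) zM by (simp add: M.minus_eq M.r_neg)
    then have "f z \<odot>\<^bsub>N\<^esub> v = s \<odot>\<^bsub>N\<^esub> v" by (rule uniq[OF z(1) s(1)])
    then show ?thesis using s(1,2) unfolding v(2) by simp
  qed
  ultimately show thesis using that z(1) by blast
qed

text \<open>Schanuel's argument: with lifts \<open>\<alpha>\<close> and \<open>\<beta>\<close> between the cover \<open>\<pi>\<close> and the resolution, \<open>h \<circ> \<beta>\<close>
  extends from the boundaries to some \<open>g'\<close>, and \<open>h\<close> extends to \<open>g' \<circ> \<alpha> + h \<circ> (id - \<beta> \<circ> \<alpha>)\<close>.\<close>

lemma (in resolved_pair) extend_from_relations:
  assumes Ez: "Ext_zero 0" and \<pi>: "mlin R (free_module R r) M \<pi>" "\<pi> ` carrier (free_module R r) = carrier M"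
    and h: "mlin R ((free_module R r)\<lparr>carrier := {x \<in> carrier (free_module R r). \<pi> x = \<zero>\<^bsub>M\<^esub>}\<rparr>) N h"
  obtains g where "mlin R (free_module R r) N g"
    "\<And>x. x \<in> carrier (free_module R r) \<Longrightarrow> \<pi> x = \<zero>\<^bsub>M\<^esub> \<Longrightarrow> g x = h x"
proof -
  let ?L = "free_module R r"
  let ?K = "{x \<in> carrier ?L. \<pi> x = \<zero>\<^bsub>M\<^esub>}"
  interpret L: module R ?L by (rule dom.R.free_module_module)
  interpret LL: module_pair R ?L ?L by unfold_locales
  interpret LM: module_pair R ?L M by unfold_locales
  interpret LN: module_pair R ?L N by unfold_locales
  have hc: "h x \<in> carrier N" if "x \<in> ?K" for x using mlin_closed[OF h, of x] that by simp
  have ha: "h (x \<oplus>\<^bsub>?L\<^esub> y) = h x \<oplus>\<^bsub>N\<^esub> h y" if "x \<in> ?K" "y \<in> ?K" for x y using mlin_add[OF h, of x y] that by simp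
  have hs: "h (a \<odot>\<^bsub>?L\<^esub> x) = a \<odot>\<^bsub>N\<^esub> h x" if "a \<in> carrier R" "x \<in> ?K" for a x using mlin_smult[OF h, of a x] that by simp
  have h0: "h \<zero>\<^bsub>?L\<^esub> = \<zero>\<^bsub>N\<^esub>"
  proof -
    have "\<zero>\<^bsub>?L\<^esub> \<in> ?K" using LM.mlin_zero[OF \<pi>(1)] by simp
    then show ?thesis using hs[OF dom.R.zero_closed, of "\<zero>\<^bsub>?L\<^esub>"] hc by simp
  qed
  have h_comp: "mlin R P N (\<lambda>x. h (f x))" if f: "mlin R P ?L f" and fK: "\<And>x. x \<in> carrier P \<Longrightarrow> f x \<in> ?K"
    for f and P :: "('a, 'z, 'y) module_scheme"
    by (rule mlinI) (simp_all only: mlin_add[OF f] mlin_smult[OF f] ha hs hc fK)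
  obtain \<alpha> where \<alpha>: "mlin R ?L (F 0) \<alpha>" "\<And>x. x \<in> carrier ?L \<Longrightarrow> e (\<alpha> x) = \<pi> x"
    using free_lift[OF fm.module_axioms dom.module_axioms e_lin e_surj \<pi>(1)] by blast
  obtain \<beta> where \<beta>: "mlin R (F 0) ?L \<beta>" "\<And>y. y \<in> carrier (F 0) \<Longrightarrow> \<pi> (\<beta> y) = e y"
    using free_lift[OF L.module_axioms dom.module_axioms \<pi> e_lin] by blast
  note \<alpha>c = mlin_closed[OF \<alpha>(1)] and \<beta>c = mlin_closed[OF \<beta>(1)]
  have \<beta>d: "mlin R (F (Suc 0)) ?L (\<lambda>y. \<beta> (d 0 y))" by (rule mlin_compose[OF d_lin \<beta>(1)])
  have \<beta>dK: "\<beta> (d 0 y) \<in> ?K" if y: "y \<in> carrier (F (Suc 0))" for y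
    using \<beta>(2)[OF mlin_closed[OF d_lin y]] e_d[OF y] \<beta>c[OF mlin_closed[OF d_lin y]] by simp
  interpret FL: module_pair R "F 0" ?L by unfold_locales
  \<comment> \<open>The map \<open>h (\<beta> (d 0 y))\<close> is a cocycle in degree 1, so
    vanishing of Ext^1 extends it from boundaries to \<open>F 0\<close>.\<close>
  have "\<forall>y\<in>carrier (F (Suc (Suc 0))). h (\<beta> (d 0 (d (Suc 0) y))) = \<zero>\<^bsub>N\<^esub>"
    using d_d[of _ 0] FL.mlin_zero[OF \<beta>(1)] h0 by simp
  then obtain g' where g': "mlin R (F 0) N g'" "\<forall>y\<in>carrier (F (Suc 0)). h (\<beta> (d 0 y)) = g' (d 0 y)"
    using Ez h_comp[OF \<beta>d \<beta>dK] unfolding Ext_zero_def by blast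
  define \<delta> where "\<delta> = (\<lambda>x. x \<ominus>\<^bsub>?L\<^esub> \<beta> (\<alpha> x))"
  have id: "mlin R ?L ?L (\<lambda>x. x)" by (rule mlinI) auto
  have \<delta>: "mlin R ?L ?L \<delta>" unfolding \<delta>_def
    by (rule LL.mlin_minus[OF id mlin_compose[OF \<alpha>(1) \<beta>(1)]])
  have \<delta>K: "\<delta> x \<in> ?K" if x: "x \<in> carrier ?L" for x
  proof -
    have "\<pi> (\<delta> x) = \<pi> x \<ominus>\<^bsub>M\<^esub> \<pi> (\<beta> (\<alpha> x))" unfolding \<delta>_def by (rule LM.mlin_diff[OF \<pi>(1) x \<beta>c[OF \<alpha>c[OF x]]])
    also have "\<dots> = \<zero>\<^bsub>M\<^esub>"
      unfolding \<beta>(2)[OF \<alpha>c[OF x]] \<alpha>(2)[OF x]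
      using mlin_closed[OF \<pi>(1) x] by (simp add: dom.M.minus_eq dom.M.r_neg)
    finally show ?thesis using mlin_closed[OF \<delta> x] by simp
  qed
  have g: "mlin R ?L N (\<lambda>x. g' (\<alpha> x) \<oplus>\<^bsub>N\<^esub> h (\<delta> x))"
    by (rule LN.mlin_sum[OF mlin_compose[OF \<alpha>(1) g'(1)] h_comp[OF \<delta> \<delta>K]])
  have "g' (\<alpha> x) \<oplus>\<^bsub>N\<^esub> h (\<delta> x) = h x" if x: "x \<in> carrier ?L" "\<pi> x = \<zero>\<^bsub>M\<^esub>" for x
  proof -
    \<comment> \<open>On a relation \<open>x\<close> the lift \<open>\<alpha> x\<close> is a
      boundary. There \<open>g'\<close> agrees with \<open>h\<close> after \<beta>, so the two terms
      add up to \<open>h x\<close>.\<close>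
    have "\<alpha> x \<in> {y \<in> carrier (F 0). e y = \<zero>\<^bsub>M\<^esub>}" using \<alpha>c[OF x(1)] \<alpha>(2)[OF x(1)] x(2) by simp
    then obtain y where y: "y \<in> carrier (F (Suc 0))" "\<alpha> x = d 0 y" unfolding exact_0 by blast
    have "g' (\<alpha> x) = h (\<beta> (\<alpha> x))" using g'(2) y by simp
    then have "g' (\<alpha> x) \<oplus>\<^bsub>N\<^esub> h (\<delta> x) = h (\<beta> (\<alpha> x)) \<oplus>\<^bsub>N\<^esub> h (\<delta> x)" by simp
    also have "\<dots> = h (\<beta> (\<alpha> x) \<oplus>\<^bsub>?L\<^esub> \<delta> x)" using ha[OF \<beta>dK[OF y(1)] \<delta>K[OF x(1)]] y(2) by simp
    also have "\<beta> (\<alpha> x) \<oplus>\<^bsub>?L\<^esub> \<delta> x = x" unfolding \<delta>_def by (rule L.diff_add_cancel[OF x(1) \<beta>c[OF \<alpha>c[OF x(1)]]])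
    finally show ?thesis .
  qed
  then show thesis using that g by blast
qed

text \<open>\<open>kill\<close> makes every map on the free module vanish on the relations, and by
  Ext^1 = 0 every map on the relations extends. So the relations admit no nonzero map to
  \<open>N\<close>, whereas a nonzero relation supplies one through an associated prime that
  \<open>R\<close> shares with \<open>N\<close>.\<close>

lemma (in resolved_pair) relations_trivial:
  assumes noeth: "noetherian_ring R" and Ez: "Ext_zero 0" and Ass: "Ass R (regular_module R) \<subseteq> Ass R N"
    and \<pi>: "mlin R (free_module R r) M \<pi>" "\<pi> ` carrier (free_module R r) = carrier M"
    and kill: "\<And>g x. mlin R (free_module R r) N g \<Longrightarrow> x \<in> carrier (free_module R r) \<Longrightarrow> \<pi> x = \<zero>\<^bsub>M\<^esub>
      \<Longrightarrow> g x = \<zero>\<^bsub>N\<^esub>"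
    and x: "x \<in> carrier (free_module R r)" "\<pi> x = \<zero>\<^bsub>M\<^esub>"
  shows "x = \<zero>\<^bsub>free_module R r\<^esub>"
proof (rule ccontr)
  assume "x \<noteq> \<zero>\<^bsub>free_module R r\<^esub>"
  let ?L = "free_module R r"
  let ?K = "{x \<in> carrier ?L. \<pi> x = \<zero>\<^bsub>M\<^esub>}"
  interpret L: noetherian_module R ?L by (rule free_module_noetherian[OF dom.R.is_cring noeth])
  interpret LM: module_pair R ?L M by unfold_locales
  interpret RM: module R "regular_module R" by (rule dom.R.regular_module)
  have K: "submodule ?K R ?L" using LM.mlin_preimage_submodule[OF \<pi>(1) dom.submodule_zero_singleton] by simp
  obtain b where b: "b \<in> carrier R" "b \<odot>\<^bsub>?L\<^esub> x \<notin> {\<zero>\<^bsub>?L\<^esub>}" "primeideal (colon R ?L {\<zero>\<^bsub>?L\<^esub>} (b \<odot>\<^bsub>?L\<^esub> x)) R"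
    using L.exists_prime_colon[OF noeth L.submodule_zero_singleton x(1)] \<open>x \<noteq> \<zero>\<^bsub>?L\<^esub>\<close> by blast
  define \<kappa> where "\<kappa> = b \<odot>\<^bsub>?L\<^esub> x"
  define p where "p = colon R ?L {\<zero>\<^bsub>?L\<^esub>} \<kappa>"
  have p: "primeideal p R" using b(3) by (simp add: p_def \<kappa>_def)
  have \<kappa>K: "\<kappa> \<in> ?K" unfolding \<kappa>_def by (rule L.submoduleE(4)[OF K b(1)]) (use x in simp)
  have \<kappa>c: "\<kappa> i \<in> carrier R" if "i < r" for i
    using \<kappa>K PiE_mem[of \<kappa> "{..<r}" "\<lambda>_. carrier R" i] that by (simp add: module_power_simps(1))
  \<comment> \<open>\<open>p\<close> is the intersection of the annihilators of the coordinates of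
    \<kappa>. As a prime it contains one of them, hence equals it, and so is associated to
    \<open>R\<close>.\<close>
  have "\<exists>i<r. colon R (regular_module R) {\<zero>\<^bsub>R\<^esub>} (\<kappa> i) \<subseteq> p"
  proof (rule ccontr)
    assume no: "\<not> ?thesis"
    have "\<exists>a\<in>carrier R - p. \<forall>J\<in>(\<lambda>i. colon R (regular_module R) {\<zero>\<^bsub>R\<^esub>} (\<kappa> i)) ` {..<r}. a \<in> J"
    proof (rule dom.R.prime_avoids_finite[OF p])
      fix J assume "J \<in> (\<lambda>i. colon R (regular_module R) {\<zero>\<^bsub>R\<^esub>} (\<kappa> i)) ` {..<r}"
      then obtain i where i: "i < r" "J = colon R (regular_module R) {\<zero>\<^bsub>R\<^esub>} (\<kappa> i)" by blast
      show "ideal J R \<and> \<not> J \<subseteq> p"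
        using RM.colon_ideal[OF RM.submodule_zero_singleton, of "\<kappa> i"] \<kappa>c[OF i(1)] no i by auto
    qed simp
    then obtain a where a: "a \<in> carrier R" "a \<notin> p" "\<And>i. i < r \<Longrightarrow> a \<otimes>\<^bsub>R\<^esub> \<kappa> i = \<zero>\<^bsub>R\<^esub>"
      by (auto simp: colon_def)
    have "a \<odot>\<^bsub>?L\<^esub> \<kappa> = \<zero>\<^bsub>?L\<^esub>" by (rule ext) (simp add: module_power_simps a(3))
    then show False using a(1,2) by (simp add: p_def colon_def)
  qed
  then obtain i where i: "i < r" "colon R (regular_module R) {\<zero>\<^bsub>R\<^esub>} (\<kappa> i) \<subseteq> p" by blast
  have "p \<subseteq> colon R (regular_module R) {\<zero>\<^bsub>R\<^esub>} (\<kappa> i)"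
  proof
    fix a assume "a \<in> p"
    then have a: "a \<in> carrier R" "a \<odot>\<^bsub>?L\<^esub> \<kappa> = \<zero>\<^bsub>?L\<^esub>" by (simp_all add: p_def colon_def)
    from fun_cong[OF a(2), of i] have "a \<otimes>\<^bsub>R\<^esub> \<kappa> i = \<zero>\<^bsub>R\<^esub>"
      using i(1) by (simp add: module_power_simps)
    then show "a \<in> colon R (regular_module R) {\<zero>\<^bsub>R\<^esub>} (\<kappa> i)" using a(1) by (simp add: colon_def)
  qed
  then have "p = colon R (regular_module R) {\<zero>\<^bsub>R\<^esub>} (\<kappa> i)" using i(2) by (rule subset_antisym)
  then have "p \<in> Ass R (regular_module R)"
    unfolding Ass_def using p \<kappa>c[OF i(1)] by (auto simp: colon_def)
  then obtain v where v: "v \<in> carrier N" "p = {a \<in> carrier R. a \<odot>\<^bsub>N\<^esub> v = \<zero>\<^bsub>N\<^esub>}"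
    using Ass unfolding Ass_def by blast
  obtain h z where h: "mlin R (?L\<lparr>carrier := ?K\<rparr>) N h" "z \<in> ?K" "h z \<noteq> \<zero>\<^bsub>N\<^esub>"
  proof (rule L.exists_nonzero_hom[OF noeth cod.module_axioms p v K \<kappa>K])
    show "s \<odot>\<^bsub>?L\<^esub> \<kappa> \<noteq> \<zero>\<^bsub>?L\<^esub>" if "s \<in> carrier R" "s \<notin> p" for s using that by (simp add: p_def colon_def)
  qed
  obtain g where g: "mlin R ?L N g" "\<And>x. x \<in> carrier ?L \<Longrightarrow> \<pi> x = \<zero>\<^bsub>M\<^esub> \<Longrightarrow> g x = h x"
    using extend_from_relations[OF Ez \<pi> h(1)] by blast
  have zL: "z \<in> carrier ?L" "\<pi> z = \<zero>\<^bsub>M\<^esub>" using h(2) by simp_all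
  show False using g(2)[OF zL] kill[OF g(1) zL] h(3) by simp
qed

section \<open>The isomorphisms\<close>

text \<open>The free module maps onto both sides, and both kernels are \<open>I\<close> times the
  free module; for the left side this uses that all relations have entries in
  \<open>I\<close>.\<close>

lemma (in module) quotient_isomorphic_to_power:
  assumes I: "ideal I R" and gc: "\<And>i. i < r \<Longrightarrow> g i \<in> carrier M"
    and gen: "lincomb M r g ` carrier (free_module R r) = carrier M"
    and rel: "\<And>x i. x \<in> carrier (free_module R r) \<Longrightarrow> lincomb M r g x = \<zero>\<^bsub>M\<^esub> \<Longrightarrow> i < r \<Longrightarrow> x i \<in> I"
  shows "module_isomorphic R (module_quotient M (ideal_smult R I M))
    (module_power (module_quotient (regular_module R) I) r)"
proof -
  let ?L = "free_module R r" and ?\<pi> = "lincomb M r g" and ?IM = "ideal_smult R I M"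
  let ?Q = "module_quotient (regular_module R) I"
  interpret I: ideal I R by fact
  interpret RM: module R "regular_module R" by (rule R.regular_module)
  interpret L: module R ?L by (rule R.free_module_module)
  interpret LM: module_pair R ?L M by unfold_locales
  interpret LR: module_pair R ?L "regular_module R" by unfold_locales
  have \<pi>: "mlin R ?L M ?\<pi>" by (rule lincomb_mlin[OF gc])
  have Is: "submodule I R (regular_module R)" by (rule R.ideal_is_submodule[OF I])
  have IM: "submodule ?IM R M" by (rule ideal_smult_submodule) (use I.Icarr in blast)
  let ?S = "{x \<in> carrier ?L. \<forall>i<r. x i \<in> I}"
  have S: "submodule ?S R ?L" by (rule RM.componentwise_submodule[OF Is])
  have comp: "x i \<in> carrier R" if "x \<in> carrier ?L" "i < r" for x i
    using PiE_mem[OF that(1)[unfolded module_power_simps(1)], of i] that(2) by simp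
  have \<pi>S: "?\<pi> x \<in> ?IM" if x: "x \<in> ?S" for x
    by (rule lincomb_in_submodule[OF IM]) (use x gc in \<open>auto intro: ideal_smultI\<close>)
  have IM_le: "?IM \<subseteq> ?\<pi> ` ?S"
  proof (rule ideal_smult_least[OF LM.mlin_image_submodule[OF \<pi> S]])
    fix a v assume a: "a \<in> I" and v: "v \<in> carrier M"
    then obtain x where x: "x \<in> carrier ?L" "v = ?\<pi> x" using gen by blast
    have aR: "a \<in> carrier R" by (rule I.Icarr[OF a])
    have "(a \<odot>\<^bsub>?L\<^esub> x) i \<in> I" if "i < r" for i
      using I.I_r_closed[OF a comp[OF x(1) that]] that by (simp add: module_power_smult)
    then have "a \<odot>\<^bsub>?L\<^esub> x \<in> ?S" using L.smult_closed[OF aR x(1)] by blast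
    moreover have "a \<odot>\<^bsub>M\<^esub> v = ?\<pi> (a \<odot>\<^bsub>?L\<^esub> x)" using mlin_smult[OF \<pi> aR x(1)] x(2) by simp
    ultimately show "a \<odot>\<^bsub>M\<^esub> v \<in> ?\<pi> ` ?S" by blast
  qed
  \<comment> \<open>A vector over \<open>I M\<close> differs from one with entries in
    \<open>I\<close> by a relation, whose entries are in \<open>I\<close> as well.\<close>
  have mem: "?\<pi> x \<in> ?IM \<longleftrightarrow> x \<in> ?S" if x: "x \<in> carrier ?L" for x
  proof
    assume "?\<pi> x \<in> ?IM"
    then obtain y where y: "y \<in> ?S" "?\<pi> x = ?\<pi> y" using IM_le by blast
    then have yL: "y \<in> carrier ?L" by blast
    have xy: "x \<ominus>\<^bsub>?L\<^esub> y \<in> carrier ?L" by (rule L.M.minus_closed[OF x yL])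
    have "?\<pi> (x \<ominus>\<^bsub>?L\<^esub> y) = \<zero>\<^bsub>M\<^esub>"
      using LM.mlin_diff[OF \<pi> x yL] y(2) mlin_closed[OF \<pi> yL] by (simp add: M.minus_eq M.r_neg)
    then have "x \<ominus>\<^bsub>?L\<^esub> y \<in> ?S" using rel[OF xy] xy by blast
    then show "x \<in> ?S" by (rule L.submodule_diff_cancel[OF S y(1) x])
  qed (rule \<pi>S)
  define c where "c = (\<lambda>x. ?IM +>\<^bsub>M\<^esub> ?\<pi> x)"
  define k where "k = (\<lambda>x. \<lambda>i\<in>{..<r}. I +>\<^bsub>regular_module R\<^esub> x i)"
  have kQ: "I +>\<^bsub>regular_module R\<^esub> a \<in> carrier ?Q" if "a \<in> carrier R" for a
    unfolding RM.quotient_carrier using that by simp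
  show ?thesis
  proof (rule isomorphic_if_common_cover[OF L.module_axioms])
    show "mlin R ?L (module_quotient M ?IM) c"
    proof (rule mlinI)
      fix x assume x: "x \<in> carrier ?L"
      note \<pi>x = mlin_closed[OF \<pi> x]
      show "c x \<in> carrier (module_quotient M ?IM)" unfolding c_def quotient_carrier using \<pi>x by blast
      show "c (x \<oplus>\<^bsub>?L\<^esub> y) = c x \<oplus>\<^bsub>module_quotient M ?IM\<^esub> c y" if y: "y \<in> carrier ?L" for y
        unfolding c_def mlin_add[OF \<pi> x y] quotient_add[OF IM \<pi>x mlin_closed[OF \<pi> y]] ..
      show "c (a \<odot>\<^bsub>?L\<^esub> x) = a \<odot>\<^bsub>module_quotient M ?IM\<^esub> c x" if a: "a \<in> carrier R" for a
        unfolding c_def mlin_smult[OF \<pi> a x] quotient_smult[OF IM a \<pi>x] ..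
    qed
    show "c ` carrier ?L = carrier (module_quotient M ?IM)"
      unfolding c_def quotient_carrier gen[symmetric] by (simp add: image_image)
    show "mlin R ?L (module_power ?Q r) k"
    proof (rule mlinI)
      fix x assume x: "x \<in> carrier ?L"
      show "k x \<in> carrier (module_power ?Q r)"
        unfolding k_def module_power_simps(1) restrict_PiE_iff using kQ comp[OF x] by simp
      show "k (x \<oplus>\<^bsub>?L\<^esub> y) = k x \<oplus>\<^bsub>module_power ?Q r\<^esub> k y" if y: "y \<in> carrier ?L" for y
      proof (rule ext)
        fix i show "k (x \<oplus>\<^bsub>?L\<^esub> y) i = (k x \<oplus>\<^bsub>module_power ?Q r\<^esub> k y) i"
        proof (cases "i < r")
          case True
          then show ?thesis
            using RM.quotient_add[OF Is, of "x i" "y i"] comp[OF x True] comp[OF y True]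
            by (simp add: k_def module_power_add)
        qed (simp add: k_def module_power_add)
      qed
      show "k (a \<odot>\<^bsub>?L\<^esub> x) = a \<odot>\<^bsub>module_power ?Q r\<^esub> k x" if a: "a \<in> carrier R" for a
      proof (rule ext)
        fix i show "k (a \<odot>\<^bsub>?L\<^esub> x) i = (a \<odot>\<^bsub>module_power ?Q r\<^esub> k x) i"
        proof (cases "i < r")
          case True
          then show ?thesis
            using RM.quotient_smult[OF Is a, of "x i"] comp[OF x True]
            by (simp add: k_def module_power_smult)
        qed (simp add: k_def module_power_smult)
      qed
    qed
    show "k ` carrier ?L = carrier (module_power ?Q r)"
    proof
      show "k ` carrier ?L \<subseteq> carrier (module_power ?Q r)"
      proof
        fix u assume "u \<in> k ` carrier ?L"
        then obtain x where x: "x \<in> carrier ?L" "u = k x" by blast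
        show "u \<in> carrier (module_power ?Q r)"
          unfolding x(2) k_def module_power_simps(1) restrict_PiE_iff using kQ comp[OF x(1)] by simp
      qed
      show "carrier (module_power ?Q r) \<subseteq> k ` carrier ?L"
      proof
        fix u assume u: "u \<in> carrier (module_power ?Q r)"
        have "\<exists>a. i < r \<longrightarrow> a \<in> carrier R \<and> u i = I +>\<^bsub>regular_module R\<^esub> a" for i
          using PiE_mem[OF u[unfolded module_power_simps(1)], of i] unfolding RM.quotient_carrier by auto
        then obtain a where a: "\<And>i. i < r \<Longrightarrow> a i \<in> carrier R \<and> u i = I +>\<^bsub>regular_module R\<^esub> a i" by metis
        have "restrict a {..<r} \<in> carrier ?L"
          unfolding module_power_simps(1) restrict_PiE_iff using a by simp
        moreover have "u = k (restrict a {..<r})"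
        proof (rule ext)
          fix i show "u i = k (restrict a {..<r}) i"
            using a[of i] PiE_arb[OF u[unfolded module_power_simps(1)], of i]
            by (cases "i < r") (simp_all add: k_def)
        qed
        ultimately show "u \<in> k ` carrier ?L" by blast
      qed
    qed
    fix x y assume x: "x \<in> carrier ?L" and y: "y \<in> carrier ?L"
    have diff: "(x \<ominus>\<^bsub>?L\<^esub> y) i = x i \<ominus>\<^bsub>regular_module R\<^esub> y i" if "i < r" for i
      by (rule LR.mlin_diff[OF RM.power_component_mlin[OF that] x y])
    have "c x = c y \<longleftrightarrow> ?\<pi> (x \<ominus>\<^bsub>?L\<^esub> y) \<in> ?IM"
      unfolding c_def LM.mlin_diff[OF \<pi> x y]
      by (rule coset_eq_iff[OF IM mlin_closed[OF \<pi> x] mlin_closed[OF \<pi> y]])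
    also have "\<dots> \<longleftrightarrow> x \<ominus>\<^bsub>?L\<^esub> y \<in> ?S" by (rule mem[OF L.M.minus_closed[OF x y]])
    also have "\<dots> \<longleftrightarrow> (\<forall>i<r. (x \<ominus>\<^bsub>?L\<^esub> y) i \<in> I)" using L.M.minus_closed[OF x y] by simp
    also have "\<dots> \<longleftrightarrow> (\<forall>i<r. I +>\<^bsub>regular_module R\<^esub> x i = I +>\<^bsub>regular_module R\<^esub> y i)"
      using diff RM.coset_eq_iff[OF Is] comp[OF x] comp[OF y] by simp
    also have "\<dots> \<longleftrightarrow> k x = k y" by (auto simp: k_def fun_eq_iff)
    finally show "c x = c y \<longleftrightarrow> k x = k y" .
  qed
qed

lemma (in module) isomorphic_to_free:
  assumes gc: "\<And>i. i < r \<Longrightarrow> g i \<in> carrier M"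
    and gen: "lincomb M r g ` carrier (free_module R r) = carrier M"
    and rel: "\<And>x. x \<in> carrier (free_module R r) \<Longrightarrow> lincomb M r g x = \<zero>\<^bsub>M\<^esub> \<Longrightarrow> x = \<zero>\<^bsub>free_module R r\<^esub>"
  shows "module_isomorphic R M (free_module R r)"
proof -
  let ?L = "free_module R r" and ?\<pi> = "lincomb M r g"
  interpret L: module R ?L by (rule R.free_module_module)
  interpret LM: module_pair R ?L M by unfold_locales
  have \<pi>: "mlin R ?L M ?\<pi>" by (rule lincomb_mlin[OF gc])
  show ?thesis
  proof (rule isomorphic_if_common_cover[OF L.module_axioms \<pi> gen])
    show "mlin R ?L ?L (\<lambda>x. x)" by (rule mlinI) auto
    show "?\<pi> x = ?\<pi> y \<longleftrightarrow> x = y" if x: "x \<in> carrier ?L" and y: "y \<in> carrier ?L" for x y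
    proof
      assume eq: "?\<pi> x = ?\<pi> y"
      have "?\<pi> (x \<ominus>\<^bsub>?L\<^esub> y) = \<zero>\<^bsub>M\<^esub>"
        using LM.mlin_diff[OF \<pi> x y] eq mlin_closed[OF \<pi> y] by (simp add: M.minus_eq M.r_neg)
      then show "x = y" using rel[OF L.M.minus_closed[OF x y]] L.diff_eq_zeroD[OF x y] by blast
    qed simp
  qed simp
qed

theorem theorem4p7:
  fixes R :: "('r, 'a) ring_scheme"
    and M :: "('r, 'm, 'b) module_scheme"
    and N :: "('r, 'n, 'c) module_scheme"
    and t s :: int and r :: nat
  assumes "noetherian_local_ring R"
    and "fin_gen_module R M" and "fin_gen_module R N"
    and "ereal_of_enat (depth R M) \<ge> ereal (of_int t)"
    and "ereal_of_enat (depth R N) = ereal (of_int t)"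
    and "Ass R N = Min_Supp R N"
    and "s \<ge> t"
    and "\<forall>i::nat. 1 \<le> i \<and> int i \<le> s \<longrightarrow> carrier (Ext R M N i) = {\<zero>\<^bsub>Ext R M N i\<^esub>}"
    and "module_isomorphic R (Hom_module R M N) (module_power N r)"
  shows "module_isomorphic R
           (module_quotient M (ideal_smult R (annihilator R N) M))
           (module_power (module_quotient (regular_module R) (annihilator R N)) r) \<and>
         (faithful_module R N \<or> (Ass R (regular_module R) \<subseteq> Ass R N \<and> s > 0) \<longrightarrow>
           module_isomorphic R M (module_power (regular_module R) r))"
proof -
  interpret L: noetherian_local_ring R by fact
  note noeth = L.noetherian_ring_axioms
  have M: "module R M" and N: "module R N" using assms(2,3) by (simp_all add: fin_gen_module_def)
  interpret M: module R M by fact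
  interpret N: module R N by fact
  \<comment> \<open>Finite depth makes \<open>t\<close> a natural number, the length of a regular
    sequence.\<close>
  obtain k where k: "depth R N = enat k" "int k = t"
  proof (cases "depth R N")
    case (enat k)
    then have "real k = of_int t" using assms(5) by simp
    then have "int k = t" by linarith
    then show thesis using that enat by blast
  next
    case infinity
    then show thesis using assms(5) by simp
  qed
  obtain n d e where res: "resolved_pair R M N n d e"
    and Ez: "\<And>i. carrier (Ext R M N (Suc i)) = {\<zero>\<^bsub>Ext R M N (Suc i)\<^esub>} \<Longrightarrow> resolved_pair.Ext_zero R N n d i"
    using Ext_resolution[OF L.is_cring noeth assms(2) N] by blast
  obtain \<Phi> where \<Phi>: "hom_power R M N r \<Phi>" using hom_power_if_isomorphic[OF M N assms(9)] by blast
  interpret resolved_hom_power R M N n d e r \<Phi>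
    using res \<Phi> by (simp add: resolved_hom_power_def)
  \<comment> \<open>\<open>Ext_zero i\<close> concerns degree \<open>i + 1\<close>, so the degrees 1
    to \<open>s\<close> become the indices below \<open>nat s\<close>.\<close>
  have van: "Ext_zero i" if "i < nat s" for i
    by (rule Ez) (use assms(8) that in auto)
  have ks: "k \<le> nat s" using k(2) assms(7) by linarith
  obtain x H \<sigma> where chain: "regular_chain R N k x H" and \<sigma>: "\<sigma> \<in> carrier N" "\<sigma> \<notin> H k"
    "\<And>a. a \<in> max_ideal R \<Longrightarrow> a \<odot>\<^bsub>N\<^esub> \<sigma> \<in> H k"
    using depth_regular_chain[OF assms(1,3) k(1)] by blast
  obtain \<mu> g where gc: "\<And>i. i < \<mu> \<Longrightarrow> g i \<in> carrier M"
    and gen: "lincomb M \<mu> g ` carrier (free_module R \<mu>) = carrier M"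
    and min: "\<And>x k. x \<in> carrier (free_module R \<mu>) \<Longrightarrow> lincomb M \<mu> g x = \<zero>\<^bsub>M\<^esub> \<Longrightarrow> k < \<mu> \<Longrightarrow> x k \<in> max_ideal R"
    using minimal_generators[OF assms(1,2)] by blast
  have \<mu>r: "\<mu> \<le> r" using assms(1,3) chain van ks \<sigma> gc gen min by (rule generator_bound)
  \<comment> \<open>The \<mu> generators are padded with zeros to exactly \<open>r\<close>, so that
    evaluation becomes an endomorphism of N^r.\<close>
  define g' where "g' = (\<lambda>i. if i < \<mu> then g i else \<zero>\<^bsub>M\<^esub>)"
  have g'c: "g' i \<in> carrier M" if "i < r" for i using gc by (simp add: g'_def)
  have "mod_span R M (g ` {..<\<mu>}) \<subseteq> mod_span R M (g' ` {..<r})"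
    by (rule M.span_mono) (use \<mu>r in \<open>force simp: g'_def\<close>)
  then have "carrier M \<subseteq> mod_span R M (g' ` {..<r})" using gen M.lincomb_image[OF gc] by simp
  moreover have "mod_span R M (g' ` {..<r}) \<subseteq> carrier M"
    by (rule M.submoduleE(1)[OF M.span_submodule]) (use g'c in blast)
  ultimately have gen': "lincomb M r g' ` carrier (free_module R r) = carrier M"
    using M.lincomb_image[OF g'c] by simp
  let ?I = "annihilator R N"
  have kill: "lincomb N r w y = \<zero>\<^bsub>N\<^esub>"
    if "y \<in> carrier (free_module R r)" "lincomb M r g' y = \<zero>\<^bsub>M\<^esub>" "w \<in> carrier (module_power N r)" for y w
    using noeth assms(3,6) g'c gen' that by (rule relations_annihilate)
  \<comment> \<open>Pairing \<open>y\<close> with the vector that has \<open>v\<close> in place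
    \<open>i\<close> isolates \<open>y i\<close> times \<open>v\<close>.\<close>
  have rel: "y i \<in> ?I" if y: "y \<in> carrier (free_module R r)" "lincomb M r g' y = \<zero>\<^bsub>M\<^esub>" and i: "i < r" for y i
  proof -
    have "y i \<odot>\<^bsub>N\<^esub> v = \<zero>\<^bsub>N\<^esub>" if v: "v \<in> carrier N" for v
      using kill[OF y N.single_closed[OF v]] N.lincomb_single_right[OF i v y(1)] by simp
    moreover have "y i \<in> carrier R" using PiE_mem[OF y(1)[unfolded module_power_simps(1)], of i] i by simp
    ultimately show ?thesis by (simp add: annihilator_def)
  qed
  have I: "ideal ?I R"
  proof -
    have "submodule ?I R (regular_module R)"
      by (rule module.submodule_subI[OF L.regular_module])
        (auto simp: annihilator_def N.smult_l_distr N.smult_assoc1)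
    \<comment> \<open>The colon ideal of 1 in the regular module turns the submodule back into an
      ideal.\<close>
    then have "ideal (colon R (regular_module R) ?I \<one>\<^bsub>R\<^esub>) R"
      by (rule module.colon_ideal[OF L.regular_module]) simp
    moreover have "colon R (regular_module R) ?I \<one>\<^bsub>R\<^esub> = ?I" by (auto simp: colon_def annihilator_def)
    ultimately show ?thesis by simp
  qed
  have "module_isomorphic R M (module_power (regular_module R) r)"
    if "faithful_module R N \<or> (Ass R (regular_module R) \<subseteq> Ass R N \<and> s > 0)"
  proof (rule M.isomorphic_to_free[OF g'c gen'])
    fix y assume y: "y \<in> carrier (free_module R r)" "lincomb M r g' y = \<zero>\<^bsub>M\<^esub>"
    from that show "y = \<zero>\<^bsub>free_module R r\<^esub>"
    proof
      assume "faithful_module R N"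
      then have "y i = \<zero>\<^bsub>R\<^esub>" if "i < r" for i using rel[OF y that] by (simp add: faithful_module_def)
      then show ?thesis
        using PiE_arb[OF y(1)[unfolded module_power_simps(1)]]
        by (intro ext) (simp add: module_power_zero restrict_def)
    next
      assume *: "Ass R (regular_module R) \<subseteq> Ass R N \<and> s > 0"
      then have "Ext_zero 0" by (intro van) simp
      then show ?thesis
      proof (rule relations_trivial[OF noeth _ conjunct1[OF *] M.lincomb_mlin[OF g'c] gen' _ y])
        fix f z assume f: "mlin R (free_module R r) N f"
          and z: "z \<in> carrier (free_module R r)" "lincomb M r g' z = \<zero>\<^bsub>M\<^esub>"
        \<comment> \<open>A map from the free module to \<open>N\<close> is pairing with the vector
          of its values on the unit vectors, so \<open>kill\<close> applies.\<close>
        let ?w = "restrict (\<lambda>i. f (unit_vector R r i)) {..<r}"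
        have fc: "f (unit_vector R r i) \<in> carrier N" for i by (rule mlin_closed[OF f M.unit_vector_closed])
        have "?w \<in> carrier (module_power N r)"
          unfolding module_power_simps(1) restrict_PiE_iff using fc by simp
        then have "lincomb N r ?w z = \<zero>\<^bsub>N\<^esub>" by (rule kill[OF z])
        moreover have "lincomb N r ?w z = lincomb N r (\<lambda>i. f (unit_vector R r i)) z"
          unfolding lincomb_def
          by (rule N.M.finsum_cong')
            (use fc PiE_mem[OF z(1)[unfolded module_power_simps(1)]] in auto)
        ultimately show "f z = \<zero>\<^bsub>N\<^esub>" using N.mlin_free_lincomb[OF f z(1)] by simp
      qed
    qed
  qed
  moreover have "module_isomorphic R (module_quotient M (ideal_smult R ?I M))
      (module_power (module_quotient (regular_module R) ?I) r)"
    using I g'c gen' rel by (rule M.quotient_isomorphic_to_power)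
  ultimately show ?thesis by blast
qed

end
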